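(* For every $t>0$ and every $\alpha\in(0,1)$ there exists a spectrally negative real-valued L\'evy process $Z=\{Z_s,\ s\ge0\}$ such that the random variable $\mathbf{\Gamma}_t^{-\alpha}$ is distributed as the exponential functional of $Z$, that is, $$\mathbf{\Gamma}_t^{-\alpha}\ \stackrel{d}{=}\ \int_0^\infty e^{-Z_s}\,ds,$$ where $\mathbf{\Gamma}_t$ denotes a Gamma random variable with density $x\mapsto\frac{x^{t-1}e^{-x}}{\Gamma(t)}$ on $(0,\infty)$.
   Context: $\{\mathbf{\Gamma}_t,\ t\ge 0\}$ is the (standard) Gamma subordinator, so that for each $t>0$ the variable $\mathbf{\Gamma}_t$ has density $\frac{x^{t-1}e^{-x}}{\Gamma(t)}$ on $(0,\infty)$, with $\Gamma(\cdot)$ the Euler Gamma function. A L\'evy process is spectrally negative if it has no positive jumps; it is started at $Z_0=0$ and is not killed. The symbol $\stackrel{d}{=}$ denotes equality in distribution. *)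

theory Defs
  imports "HOL-Probability.Probability"
begin

definition gamma_density :: "real \<Rightarrow> real \<Rightarrow> real" where
  "gamma_density t x = (if 0 < x then x powr (t - 1) * exp (- x) / Gamma t else 0)"

text \<open>Paths are indexed by all reals; only their values at nonnegative times matter.\<close>

definition cadlag :: "(real \<Rightarrow> real) \<Rightarrow> bool" where
  "cadlag x \<longleftrightarrow>
     (\<forall>s\<ge>0. (x \<longlongrightarrow> x s) (at_right s)) \<and>
     (\<forall>s>0. \<exists>l. (x \<longlongrightarrow> l) (at_left s))"

definition jump :: "(real \<Rightarrow> real) \<Rightarrow> real \<Rightarrow> real" where
  "jump x s = x s - Lim (at_left s) x"

text \<open>
  An unkilled real-valued process started at the origin. All paths are required to be cadlag
  (not merely almost all), so that path integrals are measurable without completing \<open>M\<close>.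
\<close>

locale levy_process = prob_space M
  for M :: "'a measure" and Z :: "real \<Rightarrow> 'a \<Rightarrow> real" +
  assumes measurable_at: "\<And>s. 0 \<le> s \<Longrightarrow> random_variable borel (Z s)"
    and start_zero: "\<And>\<omega>. \<omega> \<in> space M \<Longrightarrow> Z 0 \<omega> = 0"
    and cadlag_paths: "\<And>\<omega>. \<omega> \<in> space M \<Longrightarrow> cadlag (\<lambda>s. Z s \<omega>)"
    and indep_increments:
      "\<And>(\<tau> :: nat \<Rightarrow> real) n. \<lbrakk>0 \<le> \<tau> 0; \<And>i. i < n \<Longrightarrow> \<tau> i \<le> \<tau> (Suc i)\<rbrakk> \<Longrightarrow>
         indep_vars (\<lambda>_. borel) (\<lambda>i \<omega>. Z (\<tau> (Suc i)) \<omega> - Z (\<tau> i) \<omega>) {..<n}"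
    and stationary_increments:
      "\<And>s h. \<lbrakk>0 \<le> s; 0 \<le> h\<rbrakk> \<Longrightarrow>
         distr M borel (\<lambda>\<omega>. Z (s + h) \<omega> - Z s \<omega>) = distr M borel (Z h)"

definition spectrally_negative_levy :: "'a measure \<Rightarrow> (real \<Rightarrow> 'a \<Rightarrow> real) \<Rightarrow> bool" where
  "spectrally_negative_levy M Z \<longleftrightarrow>
     levy_process M Z \<and> (AE \<omega> in M. \<forall>s>0. jump (\<lambda>u. Z u \<omega>) s \<le> 0)"

definition exp_functional :: "(real \<Rightarrow> 'a \<Rightarrow> real) \<Rightarrow> 'a \<Rightarrow> ennreal" where
  "exp_functional Z \<omega> = (\<integral>\<^sup>+ s\<in>{0..}. ennreal (exp (- Z s \<omega>)) \<partial>lborel)"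

end

theory Submission
  imports Defs "HOL-Real_Asymp.Real_Asymp"
begin

text \<open>
  Write \<open>\<phi> u = Gamma (t + \<alpha> + \<alpha> u) / Gamma (t + \<alpha> u)\<close> and let \<open>I\<close> be the exponential functional of a
  process \<open>Z\<close> with \<open>E exp (u Z s) = exp (s u \<phi> u)\<close> for \<open>u > 0\<close>. The theorem rests on the recursion
  \<open>E I^-(r+1) = \<phi> r E I^-r\<close>, which gives
  \<open>E I^-n = \<phi> 0 \<phi> 1 ... \<phi> (n-1) = Gamma (t + \<alpha> n) / Gamma t\<close>. The product telescopes because \<open>\<phi> j\<close>
  is the quotient of two consecutive values of \<open>Gamma (t + \<alpha> j)\<close>. These numbers are also the moments of
  \<open>G powr \<alpha>\<close> for a Gamma variable \<open>G\<close> of parameter \<open>t\<close>. As \<open>\<alpha> < 1\<close>, all exponential moments of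
  \<open>G powr \<alpha>\<close> are finite, so its law is determined by its moments and equals the law of \<open>1 / I\<close>
  (\<open>law_determined_by_moments\<close>).

  The process exists because \<open>u \<phi> u = u \<phi> 0 + \<integral> (exp (- u y) - 1 + u y) \<nu>(dy)\<close> for an explicit measure
  \<open>\<nu>\<close> on the positive reals. In the variable \<open>x = exp (- y / \<alpha>)\<close> this is a pair of integrations by
  parts that ends in two Beta integrals (\<open>ratio_density_integral\<close>). So \<open>Z\<close> must be a linear drift minus
  a compensated sum of jumps with intensity \<open>\<nu>\<close>. The jumps are grouped by size into layers. A layer is
  built on each unit block of time from a Poisson number of independent points, and the
  exponential formula for such a cell yields the joint transform of the increments
  (\<open>partial_increments\<close>), hence their independence and stationarity. An exponential maximal inequality
  and Borel-Cantelli make the layers uniformly summable on bounded time intervals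
  (\<open>layer_uniformly_small\<close>). The sum inherits right-continuity, left limits, the absence of upward jumps,
  and the laws of its increments (\<open>layers_levy_process\<close>, \<open>levy_existence\<close>).

  For the recursion put \<open>B v = \<integral>\<^bsub>v..T\<^esub> exp (- Z w) dw\<close>. The chain rule along a path gives
  \<open>B(s)^-r - B(0)^-r = r \<integral>\<^bsub>0..s\<^esub> B(v)^-(r+1) exp (- Z v) dv\<close>, and \<open>B v\<close> is \<open>exp (- Z v)\<close> times an independent
  copy of the functional over the horizon \<open>T - v\<close>. Taking expectations relates the moments of order
  \<open>- r\<close> and \<open>- (r + 1)\<close> at finite horizons (\<open>neg_moment_recursion\<close>), and \<open>T\<close> tending to infinity gives
  \<open>moment_recursion\<close>. Finiteness of \<open>I\<close> comes out of the same computation: at a finite horizon, letting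
  \<open>r\<close> tend to 0 shows that the expected reciprocal is at least \<open>\<phi> 0\<close>, whereas at the infinite horizon it
  equals \<open>\<phi> 0\<close> times the probability that \<open>I\<close> is finite.
\<close>

section \<open>Independence from factorising characteristic functions\<close>

text \<open>
  Adding a constant makes the bounded weight \<open>w\<close> positive, and a positive weight defines a tilted
  probability measure. The hypothesis says that \<open>Y\<close> has the same characteristic function under both
  measures; uniqueness then gives the same law, which is the claim for indicators.
\<close>

lemma (in prob_space) char_factor_real:
  fixes w :: "'a \<Rightarrow> real" and Y :: "'a \<Rightarrow> real"
  assumes w[measurable]: "w \<in> borel_measurable M" and bnd: "\<And>x. x \<in> space M \<Longrightarrow> \<bar>w x\<bar> \<le> c"
    and Y[measurable]: "random_variable borel Y"
    and fac: "\<And>b. (\<integral>x. of_real (w x) * iexp (b * Y x) \<partial>M) = of_real (\<integral>x. w x \<partial>M) * (\<integral>x. iexp (b * Y x) \<partial>M)"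
    and B[measurable]: "B \<in> sets borel"
  shows "(\<integral>x. w x * indicator B (Y x) \<partial>M) = (\<integral>x. w x \<partial>M) * prob (Y -` B \<inter> space M)"
proof -
  define h where "h x = w x + (\<bar>c\<bar> + 1)" for x
  have [measurable]: "h \<in> borel_measurable M" unfolding h_def by measurable
  have h1: "1 \<le> h x" "h x \<le> 2 * \<bar>c\<bar> + 1" if "x \<in> space M" for x
    using bnd[OF that] unfolding h_def by auto
  have intw: "integrable M w"
    by (rule integrable_const_bound[where B = c]) (auto intro!: AE_I2 bnd)
  have inth: "integrable M h"
    unfolding h_def using intw by simp
  define H where "H = (\<integral>x. h x \<partial>M)"
  have H_eq: "H = (\<integral>x. w x \<partial>M) + (\<bar>c\<bar> + 1)"
    unfolding H_def h_def using intw by (simp add: prob_space)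
  have H1: "H \<ge> 1"
  proof -
    have "(\<integral>x. 1 \<partial>M) \<le> (\<integral>x. h x \<partial>M)"
      using inth h1 by (intro integral_mono) auto
    then show ?thesis by (simp add: H_def prob_space)
  qed
  define g where "g x = h x / H" for x
  have [measurable]: "g \<in> borel_measurable M" unfolding g_def by measurable
  have g0: "0 \<le> g x" if "x \<in> space M" for x using h1[OF that] H1 by (simp add: g_def)
  have intg: "integrable M g" unfolding g_def using inth by simp
  have g1: "(\<integral>x. g x \<partial>M) = 1" unfolding g_def using H1 by (simp add: H_def)
  define N where "N = density M (\<lambda>x. ennreal (g x))"
  have [simp]: "sets N = sets M" "space N = space M" by (auto simp: N_def)
  have YN[measurable]: "Y \<in> borel_measurable N" by (simp add: N_def)
  have "emeasure N (space N) = 1"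
    unfolding N_def using nn_integral_eq_integral[OF intg] g0 g1
    by (subst emeasure_density) (auto simp: AE_I2 cong: nn_integral_cong)
  then interpret N: prob_space N by (intro prob_spaceI)
  have intiexp: "integrable M (\<lambda>x. iexp (b * Y x))" for b
    by (rule integrable_const_bound[where B = 1]) auto
  have intwi: "integrable M (\<lambda>x. of_real (w x) * iexp (b * Y x))" for b
    by (rule integrable_const_bound[where B = c]) (auto intro!: AE_I2 bnd simp: norm_mult)
  have "distr N borel Y = distr M borel Y"
  proof (rule Levy_uniqueness)
    show "real_distribution (distr N borel Y)" by (rule N.real_distribution_distr[OF YN])
    show "real_distribution (distr M borel Y)" by (rule real_distribution_distr[OF Y])
    show "char (distr N borel Y) = char (distr M borel Y)"
    proof
      fix b
      have "char (distr N borel Y) b = (\<integral>x. iexp (b * Y x) \<partial>N)"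
        unfolding char_def by (subst integral_distr) auto
      also have "\<dots> = (\<integral>x. g x *\<^sub>R iexp (b * Y x) \<partial>M)"
        unfolding N_def by (subst integral_density) (auto intro!: AE_I2 g0)
      also have "\<dots> = (\<integral>x. (of_real (w x) * iexp (b * Y x) + of_real (\<bar>c\<bar> + 1) * iexp (b * Y x)) / of_real H \<partial>M)"
        by (intro Bochner_Integration.integral_cong)
           (auto simp: g_def h_def scaleR_conv_of_real field_simps)
      also have "\<dots> = ((\<integral>x. of_real (w x) * iexp (b * Y x) \<partial>M) + of_real (\<bar>c\<bar> + 1) * (\<integral>x. iexp (b * Y x) \<partial>M)) / of_real H"
        using intwi intiexp by (subst integral_divide_zero, subst Bochner_Integration.integral_add) auto
      also have "\<dots> = (\<integral>x. iexp (b * Y x) \<partial>M)"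
        unfolding fac using H1 by (simp add: H_eq ring_distribs[symmetric] flip: of_real_add)
      also have "\<dots> = char (distr M borel Y) b"
        unfolding char_def by (subst integral_distr) auto
      finally show "char (distr N borel Y) b = char (distr M borel Y) b" .
    qed
  qed
  then have "measure (distr N borel Y) B = measure (distr M borel Y) B" by simp
  then have eqB: "measure N (Y -` B \<inter> space M) = prob (Y -` B \<inter> space M)"
    by (simp add: measure_distr)
  have "measure N (Y -` B \<inter> space M) = (\<integral>x. indicator (Y -` B \<inter> space M) x \<partial>N)"
    by simp
  also have "\<dots> = (\<integral>x. g x *\<^sub>R indicator (Y -` B \<inter> space M) x \<partial>M)"
    unfolding N_def by (subst integral_density) (auto intro!: AE_I2 g0)
  also have "\<dots> = (\<integral>x. (w x * indicator B (Y x) + (\<bar>c\<bar> + 1) * indicator (Y -` B \<inter> space M) x) / H \<partial>M)"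
    by (intro Bochner_Integration.integral_cong)
       (auto simp: g_def h_def indicator_def field_simps)
  also have "\<dots> = ((\<integral>x. w x * indicator B (Y x) \<partial>M) + (\<bar>c\<bar> + 1) * prob (Y -` B \<inter> space M)) / H"
  proof -
    have "integrable M (\<lambda>x. w x * indicator B (Y x))"
      by (rule integrable_const_bound[where B = "\<bar>c\<bar>"])
         (auto intro!: AE_I2 simp: abs_mult indicator_def dest: bnd)
    then show ?thesis
      by (subst integral_divide_zero, subst Bochner_Integration.integral_add)
         (auto intro!: integrable_mult_right simp: Int_absorb1 emeasure_eq_measure)
  qed
  finally show ?thesis using H1 unfolding eqB H_eq by (simp add: field_simps)
qed

text \<open>
  Conjugation, together with the change of sign of \<open>b\<close>, carries the hypothesis over to \<open>cnj W\<close>, hence to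
  the real and imaginary parts of \<open>W\<close>.
\<close>

lemma (in prob_space) char_factor_complex:
  fixes W :: "'a \<Rightarrow> complex" and Y :: "'a \<Rightarrow> real"
  assumes W[measurable]: "W \<in> borel_measurable M" and bnd: "\<And>x. x \<in> space M \<Longrightarrow> norm (W x) \<le> c"
    and Y[measurable]: "random_variable borel Y"
    and fac: "\<And>b. (\<integral>x. W x * iexp (b * Y x) \<partial>M) = (\<integral>x. W x \<partial>M) * (\<integral>x. iexp (b * Y x) \<partial>M)"
    and B[measurable]: "B \<in> sets borel"
  shows "(\<integral>x. W x * of_real (indicator B (Y x)) \<partial>M) = (\<integral>x. W x \<partial>M) * of_real (prob (Y -` B \<inter> space M))"
proof -
  have intW: "integrable M W"
    by (rule integrable_const_bound[where B = c]) (auto intro!: AE_I2 bnd)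
  have intWi: "integrable M (\<lambda>x. W x * iexp (b * Y x))" for b
    by (rule integrable_const_bound[where B = c]) (auto intro!: AE_I2 bnd simp: norm_mult)
  have intWB: "integrable M (\<lambda>x. W x * of_real (indicator B (Y x)))"
  proof (rule integrable_const_bound[where B = c])
    show "AE x in M. norm (W x * of_real (indicator B (Y x))) \<le> c"
      using bnd order_trans[OF norm_ge_zero bnd] by (auto intro!: AE_I2 simp: norm_mult indicator_def)
  qed measurable
  have fac': "(\<integral>x. cnj (W x) * iexp (b * Y x) \<partial>M) = cnj (\<integral>x. W x \<partial>M) * (\<integral>x. iexp (b * Y x) \<partial>M)" for b
  proof -
    have "(\<integral>x. cnj (W x) * iexp (b * Y x) \<partial>M) = (\<integral>x. cnj (W x * iexp ((-b) * Y x)) \<partial>M)"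
      by (intro Bochner_Integration.integral_cong) (auto simp: exp_cnj)
    also have "\<dots> = cnj (\<integral>x. W x * iexp ((-b) * Y x) \<partial>M)" by (rule Bochner_Integration.integral_cnj)
    also have "\<dots> = cnj (\<integral>x. W x \<partial>M) * cnj (\<integral>x. iexp ((-b) * Y x) \<partial>M)" unfolding fac by simp
    also have "cnj (\<integral>x. iexp ((-b) * Y x) \<partial>M) = (\<integral>x. iexp (b * Y x) \<partial>M)"
      unfolding Bochner_Integration.integral_cnj[symmetric] by (intro Bochner_Integration.integral_cong) (auto simp: exp_cnj)
    finally show ?thesis .
  qed
  have intWi': "integrable M (\<lambda>x. cnj (W x) * iexp (b * Y x))" for b
  proof -
    have "integrable M (\<lambda>x. cnj (W x * iexp ((-b) * Y x)))" using intWi[of "-b"] by (subst complex_integrable_cnj)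
    also have "(\<lambda>x. cnj (W x * iexp ((-b) * Y x))) = (\<lambda>x. cnj (W x) * iexp (b * Y x))" by (auto simp: exp_cnj)
    finally show ?thesis .
  qed
  have Re_part: "(\<integral>x. Re (W x) * indicator B (Y x) \<partial>M) = (\<integral>x. Re (W x) \<partial>M) * prob (Y -` B \<inter> space M)"
  proof (rule char_factor_real)
    show "\<bar>Re (W x)\<bar> \<le> c" if "x \<in> space M" for x using abs_Re_le_cmod[of "W x"] bnd[OF that] by linarith
    fix b
    have "(\<integral>x. of_real (Re (W x)) * iexp (b * Y x) \<partial>M)
        = (\<integral>x. (W x * iexp (b * Y x) + cnj (W x) * iexp (b * Y x)) / 2 \<partial>M)"
      by (intro Bochner_Integration.integral_cong) (auto simp: complex_add_cnj ring_distribs[symmetric])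
    also have "\<dots> = ((\<integral>x. W x \<partial>M) * (\<integral>x. iexp (b * Y x) \<partial>M) + cnj (\<integral>x. W x \<partial>M) * (\<integral>x. iexp (b * Y x) \<partial>M)) / 2"
      by (subst integral_divide_zero, subst Bochner_Integration.integral_add[OF intWi intWi'], simp only: fac fac')
    also have "\<dots> = of_real (Re (\<integral>x. W x \<partial>M)) * (\<integral>x. iexp (b * Y x) \<partial>M)"
      by (simp add: complex_add_cnj ring_distribs[symmetric])
    also have "Re (\<integral>x. W x \<partial>M) = (\<integral>x. Re (W x) \<partial>M)" using intW by (rule integral_Re[symmetric])
    finally show "(\<integral>x. of_real (Re (W x)) * iexp (b * Y x) \<partial>M) = of_real (\<integral>x. Re (W x) \<partial>M) * (\<integral>x. iexp (b * Y x) \<partial>M)" .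
  qed measurable
  have Im_part: "(\<integral>x. Im (W x) * indicator B (Y x) \<partial>M) = (\<integral>x. Im (W x) \<partial>M) * prob (Y -` B \<inter> space M)"
  proof (rule char_factor_real)
    show "\<bar>Im (W x)\<bar> \<le> c" if "x \<in> space M" for x using abs_Im_le_cmod[of "W x"] bnd[OF that] by linarith
    fix b
    have *: "of_real (Im z) * e = (z * e - cnj z * e) / (2 * \<i>)" for z e :: complex
    proof -
      have "z * e - cnj z * e = (2 * \<i>) * (of_real (Im z) * e)"
        by (simp only: left_diff_distrib[symmetric] complex_diff_cnj) simp
      then show ?thesis by (simp only:) simp
    qed
    have "(\<integral>x. of_real (Im (W x)) * iexp (b * Y x) \<partial>M)
        = (\<integral>x. (W x * iexp (b * Y x) - cnj (W x) * iexp (b * Y x)) / (2 * \<i>) \<partial>M)"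
      by (simp only: *[symmetric])
    also have "\<dots> = ((\<integral>x. W x \<partial>M) * (\<integral>x. iexp (b * Y x) \<partial>M) - cnj (\<integral>x. W x \<partial>M) * (\<integral>x. iexp (b * Y x) \<partial>M)) / (2 * \<i>)"
      by (subst integral_divide_zero, subst Bochner_Integration.integral_diff[OF intWi intWi'], simp only: fac fac')
    also have "\<dots> = of_real (Im (\<integral>x. W x \<partial>M)) * (\<integral>x. iexp (b * Y x) \<partial>M)"
      by (simp only: *[symmetric])
    also have "Im (\<integral>x. W x \<partial>M) = (\<integral>x. Im (W x) \<partial>M)" using intW by (rule integral_Im[symmetric])
    finally show "(\<integral>x. of_real (Im (W x)) * iexp (b * Y x) \<partial>M) = of_real (\<integral>x. Im (W x) \<partial>M) * (\<integral>x. iexp (b * Y x) \<partial>M)" .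
  qed measurable
  show ?thesis
    using Re_part Im_part intWB intW
    by (simp add: complex_eq_iff flip: integral_Re integral_Im)
qed

text \<open>
  The exponentials are replaced by indicators one index at a time. Each replacement is
  \<open>char_factor_complex\<close> with all other factors, exponentials and indicators alike, as the weight, so
  one-dimensional uniqueness suffices.
\<close>

lemma (in prob_space) indep_vars_of_char:
  fixes X :: "'i \<Rightarrow> 'a \<Rightarrow> real"
  assumes I: "finite I" and X: "\<And>i. i \<in> I \<Longrightarrow> random_variable borel (X i)"
    and fac: "\<And>\<theta>. (\<integral>x. (\<Prod>i\<in>I. iexp (\<theta> i * X i x)) \<partial>M) = (\<Prod>i\<in>I. \<integral>x. iexp (\<theta> i * X i x) \<partial>M)"
  shows "indep_vars (\<lambda>_. borel) X I"
proof (cases "I = {}")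
  case True then show ?thesis by (simp add: indep_vars_def2 indep_sets_def)
next
  case False
  have main: "(\<integral>x. (\<Prod>i\<in>I - S. iexp (\<theta> i * X i x)) * (\<Prod>i\<in>S. of_real (indicator (A i) (X i x))) \<partial>M)
      = (\<Prod>i\<in>I - S. \<integral>x. iexp (\<theta> i * X i x) \<partial>M) * (\<Prod>i\<in>S. of_real (prob (X i -` A i \<inter> space M)))"
    if "finite S" "S \<subseteq> I" "\<And>i. i \<in> I \<Longrightarrow> A i \<in> sets borel" for S \<theta> and A :: "'i \<Rightarrow> real set"
    using that
  proof (induction S arbitrary: \<theta> rule: finite_induct)
    case empty then show ?case using fac by simp
  next
    case (insert j S)
    then have j: "j \<in> I" "j \<notin> S" and SI: "S \<subseteq> I" by auto
    have Aj: "A i \<in> sets borel" if "i \<in> I" for i using insert.prems(2)[OF that] .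
    have eq: "I - S = insert j (I - insert j S)" using j by auto
    have fin: "finite (I - insert j S)" using I by auto
    define W where "W x = (\<Prod>i\<in>I - insert j S. iexp (\<theta> i * X i x)) * (\<Prod>i\<in>S. complex_of_real (indicator (A i) (X i x)))" for x
    have mi: "(\<lambda>x. complex_of_real (indicator (A i) (X i x))) \<in> borel_measurable M" if "i \<in> S" for i
    proof -
      have [measurable]: "A i \<in> sets borel" "X i \<in> borel_measurable M" using that SI Aj X by auto
      show ?thesis by measurable
    qed
    have me: "(\<lambda>x. iexp (\<theta> i * X i x)) \<in> borel_measurable M" if "i \<in> I" for i
    proof -
      have [measurable]: "X i \<in> borel_measurable M" using that X by auto
      show ?thesis by measurable
    qed
    have W[measurable]: "W \<in> borel_measurable M"
      unfolding W_def by (intro borel_measurable_times borel_measurable_prod mi me) auto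
    have Wb: "norm (W x) \<le> 1" for x
      unfolding W_def norm_mult
      by (intro mult_le_one) (auto simp: prod_norm[symmetric] intro!: prod_le_1 prod_nonneg)
    have IH: "(\<integral>x. W x * iexp (b * X j x) \<partial>M) = (\<integral>x. iexp (b * X j x) \<partial>M) *
        (\<Prod>i\<in>I - insert j S. \<integral>x. iexp (\<theta> i * X i x) \<partial>M) * (\<Prod>i\<in>S. of_real (prob (X i -` A i \<inter> space M)))" for b
    proof -
      have "(\<integral>x. W x * iexp (b * X j x) \<partial>M) =
         (\<integral>x. (\<Prod>i\<in>I - S. iexp ((\<theta>(j := b)) i * X i x)) * (\<Prod>i\<in>S. of_real (indicator (A i) (X i x))) \<partial>M)"
        unfolding eq W_def using fin
        by (intro Bochner_Integration.integral_cong refl) (auto simp: mult_ac intro!: prod.cong)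
      also have "\<dots> = (\<Prod>i\<in>I - S. \<integral>x. iexp ((\<theta>(j := b)) i * X i x) \<partial>M) * (\<Prod>i\<in>S. of_real (prob (X i -` A i \<inter> space M)))"
        by (rule insert.IH[OF SI]) (rule Aj)
      finally show ?thesis unfolding eq using fin by (auto simp: mult_ac intro!: prod.cong)
    qed
    have W0: "(\<integral>x. W x \<partial>M) = (\<Prod>i\<in>I - insert j S. \<integral>x. iexp (\<theta> i * X i x) \<partial>M) * (\<Prod>i\<in>S. of_real (prob (X i -` A i \<inter> space M)))"
      using IH[of 0] by (simp add: prob_space)
    have "(\<integral>x. W x * of_real (indicator (A j) (X j x)) \<partial>M) = (\<integral>x. W x \<partial>M) * of_real (prob (X j -` A j \<inter> space M))"
    proof (rule char_factor_complex[where c = 1])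
      show "(\<integral>x. W x * iexp (b * X j x) \<partial>M) = (\<integral>x. W x \<partial>M) * (\<integral>x. iexp (b * X j x) \<partial>M)" for b
        unfolding IH W0 by (simp only: mult_ac)
    qed (use Wb X[OF j(1)] Aj[OF j(1)] in auto)
    then show ?case unfolding W0 using insert.hyps by (simp add: W_def mult_ac)
  qed
  have "prob (\<Inter>j\<in>I. X j -` A j \<inter> space M) = (\<Prod>j\<in>I. prob (X j -` A j \<inter> space M))"
    if A: "\<And>i. i \<in> I \<Longrightarrow> A i \<in> sets borel" for A
  proof -
    have "(\<integral>x. (\<Prod>i\<in>I. complex_of_real (indicator (A i) (X i x))) \<partial>M) = (\<Prod>i\<in>I. of_real (prob (X i -` A i \<inter> space M)))"
      using main[of I A] I A by simp
    also have "(\<integral>x. (\<Prod>i\<in>I. complex_of_real (indicator (A i) (X i x))) \<partial>M)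
      = (\<integral>x. complex_of_real (indicator (\<Inter>j\<in>I. X j -` A j \<inter> space M) x) \<partial>M)"
      using I False by (intro Bochner_Integration.integral_cong refl)
        (auto simp: indicator_def of_real_prod[symmetric] simp del: of_real_prod)
    also have "\<dots> = of_real (prob (\<Inter>j\<in>I. X j -` A j \<inter> space M))"
    proof -
      have [measurable]: "(\<Inter>j\<in>I. X j -` A j \<inter> space M) \<in> sets M"
        using I False A X by (intro sets.finite_INT) (auto intro: measurable_sets)
      have "(\<Inter>j\<in>I. X j -` A j \<inter> space M) \<inter> space M = (\<Inter>j\<in>I. X j -` A j \<inter> space M)" using False by auto
      then show ?thesis by (simp add: integral_of_real)
    qed
    finally show ?thesis by (simp flip: of_real_prod)
  qed
  then show ?thesis
    using I False X
    by (subst indep_vars_finite[where E = "\<lambda>_. sets borel"])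
       (auto simp: Int_stable_def sets.sigma_sets_eq[where M="borel :: real measure", simplified] Pi_iff)
qed

lemma (in prob_space) indep_var_of_char:
  fixes X Y :: "'a \<Rightarrow> real"
  assumes [measurable]: "random_variable borel X" "random_variable borel Y"
    and fac: "\<And>a b. (\<integral>x. iexp (a * X x) * iexp (b * Y x) \<partial>M) = (\<integral>x. iexp (a * X x) \<partial>M) * (\<integral>x. iexp (b * Y x) \<partial>M)"
  shows "indep_var borel X borel Y"
proof -
  have "indep_vars (\<lambda>_. borel) (case_bool X Y) (UNIV :: bool set)"
  proof (rule indep_vars_of_char)
    fix \<theta> :: "bool \<Rightarrow> real"
    have "(\<integral>x. (\<Prod>i\<in>UNIV. iexp (\<theta> i * (case_bool X Y i) x)) \<partial>M)
        = (\<integral>x. iexp (\<theta> True * X x) * iexp (\<theta> False * Y x) \<partial>M)"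
      by (intro Bochner_Integration.integral_cong) (auto simp: UNIV_bool)
    also have "\<dots> = (\<Prod>i\<in>UNIV. \<integral>x. iexp (\<theta> i * (case_bool X Y i) x) \<partial>M)"
      unfolding fac by (simp add: UNIV_bool)
    finally show "(\<integral>x. (\<Prod>i\<in>UNIV. iexp (\<theta> i * (case_bool X Y i) x)) \<partial>M)
        = (\<Prod>i\<in>UNIV. \<integral>x. iexp (\<theta> i * (case_bool X Y i) x) \<partial>M)" .
  qed (auto split: bool.split)
  moreover have "(\<lambda>_::bool. borel) = case_bool borel borel" by (auto split: bool.split)
  ultimately show ?thesis by (metis indep_var_def)
qed

section \<open>Maximal inequality and limits of Levy processes\<close>

lemma (in prob_space) indep_var_nn_integral_mult:
  assumes ind: "indep_var S X T Y"
    and f[measurable]: "f \<in> borel_measurable S" and g[measurable]: "g \<in> borel_measurable T"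
  shows "(\<integral>\<^sup>+x. f (X x) * g (Y x) \<partial>M) = (\<integral>\<^sup>+x. f (X x) \<partial>M) * (\<integral>\<^sup>+x. g (Y x) \<partial>M)"
proof -
  have X[measurable]: "X \<in> measurable M S" and Y[measurable]: "Y \<in> measurable M T"
    using indep_var_rv1[OF ind] indep_var_rv2[OF ind] by auto
  interpret X: prob_space "distr M S X" by (rule prob_space_distr) fact
  interpret Y: prob_space "distr M T Y" by (rule prob_space_distr) fact
  interpret XY: pair_prob_space "distr M S X" "distr M T Y" ..
  have "(\<integral>\<^sup>+x. f (X x) * g (Y x) \<partial>M) = (\<integral>\<^sup>+p. f (fst p) * g (snd p) \<partial>distr M (S \<Otimes>\<^sub>M T) (\<lambda>x. (X x, Y x)))"
    by (subst nn_integral_distr) auto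
  also have "\<dots> = (\<integral>\<^sup>+p. f (fst p) * g (snd p) \<partial>(distr M S X \<Otimes>\<^sub>M distr M T Y))"
    using ind by (simp add: indep_var_distribution_eq)
  also have "\<dots> = (\<integral>\<^sup>+x. \<integral>\<^sup>+y. f x * g y \<partial>distr M T Y \<partial>distr M S X)"
    by (subst Y.nn_integral_fst[symmetric]) (auto simp: measurable_split_conv)
  also have "\<dots> = (\<integral>\<^sup>+x. f x \<partial>distr M S X) * (\<integral>\<^sup>+y. g y \<partial>distr M T Y)"
    by (subst nn_integral_cmult) (auto simp: nn_integral_multc)
  also have "\<dots> = (\<integral>\<^sup>+x. f (X x) \<partial>M) * (\<integral>\<^sup>+x. g (Y x) \<partial>M)"
    by (simp add: nn_integral_distr)
  finally show ?thesis .
qed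

context levy_process
begin

lemma nn_integral_increment:
  assumes "0 \<le> s" "0 \<le> h" and [measurable]: "f \<in> borel_measurable borel"
  shows "(\<integral>\<^sup>+\<omega>. f (Z (s + h) \<omega> - Z s \<omega>) \<partial>M) = (\<integral>\<^sup>+\<omega>. f (Z h \<omega>) \<partial>M)"
proof -
  have [measurable]: "Z h \<in> borel_measurable M" "Z s \<in> borel_measurable M" "Z (s + h) \<in> borel_measurable M"
    using assms by (auto intro: measurable_at)
  have "(\<integral>\<^sup>+\<omega>. f (Z (s + h) \<omega> - Z s \<omega>) \<partial>M) = (\<integral>\<^sup>+x. f x \<partial>distr M borel (\<lambda>\<omega>. Z (s + h) \<omega> - Z s \<omega>))"
    by (subst nn_integral_distr) auto
  also have "\<dots> = (\<integral>\<^sup>+x. f x \<partial>distr M borel (Z h))"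
    unfolding stationary_increments[OF assms(1,2)] ..
  also have "\<dots> = (\<integral>\<^sup>+\<omega>. f (Z h \<omega>) \<partial>M)" by (subst nn_integral_distr) auto
  finally show ?thesis .
qed

lemma sum_increments:
  assumes "\<omega> \<in> space M" "i \<le> j"
  shows "(\<Sum>l\<in>{i..<j}. Z (\<tau> (Suc l)) \<omega> - Z (\<tau> l) \<omega>) = Z (\<tau> j) \<omega> - Z (\<tau> i) \<omega>"
  using assms(2) by (rule sum_Suc_diff')

text \<open>
  First-passage argument for the submartingale \<open>exp (\<beta> Z)\<close>. The event is split according to the first grid
  time at which \<open>\<beta> Z\<close> reaches \<open>x\<close>; the increment after that time is independent of this piece and has an
  exponential moment of at least 1, because \<open>\<kappa>\<close> is nonnegative. The parameter \<open>\<beta>\<close> may have either sign,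
  which gives both tails.
\<close>

lemma maximal_inequality_grid:
  fixes \<beta> \<kappa> x T :: real and n :: nat
  assumes mgf: "\<And>s. 0 \<le> s \<Longrightarrow> (\<integral>\<^sup>+\<omega>. ennreal (exp (\<beta> * Z s \<omega>)) \<partial>M) = ennreal (exp (s * \<kappa>))"
    and \<kappa>: "0 \<le> \<kappa>" and T: "0 \<le> T" and n: "0 < n"
  shows "emeasure M {\<omega> \<in> space M. \<exists>i\<le>n. x \<le> \<beta> * Z (real i * T / real n) \<omega>} \<le> ennreal (exp (T * \<kappa> - x))"
proof -
  define \<tau> where "\<tau> i = real i * T / real n" for i :: nat
  have \<tau>0: "\<tau> 0 = 0" and \<tau>n: "\<tau> n = T" using n by (auto simp: \<tau>_def)
  have \<tau>_mono: "\<tau> i \<le> \<tau> j" if "i \<le> j" for i j using that T by (auto simp: \<tau>_def divide_right_mono mult_right_mono)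
  have \<tau>_nn: "0 \<le> \<tau> i" for i using T by (auto simp: \<tau>_def)
  have mZ[measurable]: "Z (\<tau> i) \<in> borel_measurable M" for i using \<tau>_nn by (rule measurable_at)
  define X where "X l \<omega> = Z (\<tau> (Suc l)) \<omega> - Z (\<tau> l) \<omega>" for l \<omega>
  have Xind: "indep_vars (\<lambda>_. borel) X {..<n}"
    unfolding X_def[abs_def] by (rule indep_increments) (auto simp: \<tau>0 intro: \<tau>_mono)
  have Zsum: "Z (\<tau> i) \<omega> = (\<Sum>l<i. X l \<omega>)" if "\<omega> \<in> space M" for i \<omega>
    using sum_increments[OF that, of 0 i \<tau>] start_zero[OF that] by (simp add: X_def \<tau>0 atLeast0LessThan)
  define A where "A j = {\<omega> \<in> space M. x \<le> \<beta> * Z (\<tau> j) \<omega> \<and> (\<forall>i<j. \<beta> * Z (\<tau> i) \<omega> < x)}" for j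
  have A[measurable]: "A j \<in> sets M" for j unfolding A_def by measurable
  have disj: "disjoint_family_on A {..n}"
    unfolding disjoint_family_on_def A_def by (force simp: neq_iff)
  have UN: "{\<omega> \<in> space M. \<exists>i\<le>n. x \<le> \<beta> * Z (real i * T / real n) \<omega>} = (\<Union>j\<in>{..n}. A j)"
  proof (intro set_eqI iffI)
    fix \<omega> assume *: "\<omega> \<in> {\<omega> \<in> space M. \<exists>i\<le>n. x \<le> \<beta> * Z (real i * T / real n) \<omega>}"
    define j where "j = (LEAST i. x \<le> \<beta> * Z (\<tau> i) \<omega>)"
    obtain i where i: "i \<le> n" "x \<le> \<beta> * Z (\<tau> i) \<omega>" using * unfolding \<tau>_def by auto
    have "x \<le> \<beta> * Z (\<tau> j) \<omega>" unfolding j_def by (rule LeastI) (rule i)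
    moreover have "j \<le> n" unfolding j_def using i Least_le[of "\<lambda>i. x \<le> \<beta> * Z (\<tau> i) \<omega>" i] by linarith
    moreover have "\<forall>l<j. \<beta> * Z (\<tau> l) \<omega> < x" unfolding j_def using not_less_Least not_le by blast
    ultimately show "\<omega> \<in> (\<Union>j\<in>{..n}. A j)" using * by (auto simp: A_def)
  qed (auto simp: A_def \<tau>_def)
  have step: "ennreal (exp x) * emeasure M (A j) \<le> (\<integral>\<^sup>+\<omega>. ennreal (exp (\<beta> * Z T \<omega>)) * indicator (A j) \<omega> \<partial>M)"
    if j: "j \<le> n" for j
  proof -
    have XR: "indep_var (PiM {..<j} (\<lambda>_. borel)) (\<lambda>\<omega>. restrict (\<lambda>i. X i \<omega>) {..<j})
        (PiM {j..<n} (\<lambda>_. borel)) (\<lambda>\<omega>. restrict (\<lambda>i. X i \<omega>) {j..<n})"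
      by (rule indep_var_restrict[OF Xind]) (use j in auto)
    define f where "f v = ennreal (exp x) * indicator {v. x \<le> \<beta> * (\<Sum>l<j. v l) \<and> (\<forall>i<j. \<beta> * (\<Sum>l<i. v l) < x)} v" for v :: "nat \<Rightarrow> real"
    define g where "g v = ennreal (exp (\<beta> * (\<Sum>l\<in>{j..<n}. v l)))" for v :: "nat \<Rightarrow> real"
    have ms: "(\<lambda>v. \<Sum>l<i. v l) \<in> borel_measurable (PiM {..<j} (\<lambda>_. borel :: real measure))" if "i \<le> j" for i
      using that by (intro borel_measurable_sum measurable_component_singleton) auto
    have [measurable]: "f \<in> borel_measurable (PiM {..<j} (\<lambda>_. borel))"
    proof -
      have "Measurable.pred (PiM {..<j} (\<lambda>_. borel :: real measure)) (\<lambda>v. x \<le> \<beta> * (\<Sum>l<j. v l) \<and> (\<forall>i\<in>{..<j}. \<beta> * (\<Sum>l<i. v l) < x))"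
      proof (intro pred_intros_logic pred_intros_finite)
        show "Measurable.pred (PiM {..<j} (\<lambda>_. borel :: real measure)) (\<lambda>v. x \<le> \<beta> * (\<Sum>l<j. v l))"
          using ms[of j] by measurable
        show "Measurable.pred (PiM {..<j} (\<lambda>_. borel :: real measure)) (\<lambda>v. \<beta> * (\<Sum>l<i. v l) < x)" if "i \<in> {..<j}" for i
        proof -
          have [measurable]: "(\<lambda>v. \<Sum>l<i. v l) \<in> borel_measurable (PiM {..<j} (\<lambda>_. borel :: real measure))"
            by (rule ms) (use that in auto)
          show ?thesis by measurable
        qed
      qed auto
      then have "(\<lambda>v. ennreal (exp x) * indicator {v. x \<le> \<beta> * (\<Sum>l<j. v l) \<and> (\<forall>i\<in>{..<j}. \<beta> * (\<Sum>l<i. v l) < x)} v) \<in> borel_measurable (PiM {..<j} (\<lambda>_. borel :: real measure))"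
        by measurable
      then show ?thesis unfolding f_def[abs_def] by (simp add: Ball_def)
    qed
    have [measurable]: "g \<in> borel_measurable (PiM {j..<n} (\<lambda>_. borel))"
      unfolding g_def[abs_def] by measurable
    have fX: "f (restrict (\<lambda>i. X i \<omega>) {..<j}) = ennreal (exp x) * indicator (A j) \<omega>" if "\<omega> \<in> space M" for \<omega>
    proof -
      have "(\<Sum>l<i. restrict (\<lambda>i. X i \<omega>) {..<j} l) = Z (\<tau> i) \<omega>" if "i \<le> j" for i
        unfolding Zsum[OF \<open>\<omega> \<in> space M\<close>] using that by (intro sum.cong) auto
      then show ?thesis using that unfolding f_def A_def by (auto simp: indicator_def)
    qed
    have gX: "g (restrict (\<lambda>i. X i \<omega>) {j..<n}) = ennreal (exp (\<beta> * (Z T \<omega> - Z (\<tau> j) \<omega>)))" if "\<omega> \<in> space M" for \<omega>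
      using sum_increments[OF that j, of \<tau>] unfolding g_def X_def \<tau>n[symmetric] by simp
    have Eg: "(\<integral>\<^sup>+\<omega>. ennreal (exp (\<beta> * (Z T \<omega> - Z (\<tau> j) \<omega>))) \<partial>M) = ennreal (exp ((T - \<tau> j) * \<kappa>))"
      using nn_integral_increment[of "\<tau> j" "T - \<tau> j" "\<lambda>y. ennreal (exp (\<beta> * y))"] \<tau>_nn[of j] \<tau>_mono[OF j] \<tau>n mgf[of "T - \<tau> j"]
      by simp
    have "ennreal (exp x) * emeasure M (A j) = (\<integral>\<^sup>+\<omega>. f (restrict (\<lambda>i. X i \<omega>) {..<j}) \<partial>M)"
      by (simp add: fX nn_integral_cmult_indicator cong: nn_integral_cong)
    also have "\<dots> \<le> (\<integral>\<^sup>+\<omega>. f (restrict (\<lambda>i. X i \<omega>) {..<j}) \<partial>M) * ennreal (exp ((T - \<tau> j) * \<kappa>))"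
    proof -
      have "1 \<le> ennreal (exp ((T - \<tau> j) * \<kappa>))" using \<kappa> \<tau>_mono[OF j] \<tau>n by (simp add: ennreal_ge_1)
      from mult_left_mono[OF this] show ?thesis by simp
    qed
    also have "\<dots> = (\<integral>\<^sup>+\<omega>. f (restrict (\<lambda>i. X i \<omega>) {..<j}) * g (restrict (\<lambda>i. X i \<omega>) {j..<n}) \<partial>M)"
      by (subst indep_var_nn_integral_mult[OF XR]) (auto simp: gX Eg cong: nn_integral_cong)
    also have "\<dots> \<le> (\<integral>\<^sup>+\<omega>. ennreal (exp (\<beta> * Z T \<omega>)) * indicator (A j) \<omega> \<partial>M)"
    proof (rule nn_integral_mono)
      fix \<omega> assume \<omega>: "\<omega> \<in> space M"
      show "f (restrict (\<lambda>i. X i \<omega>) {..<j}) * g (restrict (\<lambda>i. X i \<omega>) {j..<n}) \<le> ennreal (exp (\<beta> * Z T \<omega>)) * indicator (A j) \<omega>"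
        unfolding fX[OF \<omega>] gX[OF \<omega>]
        by (auto simp: indicator_def A_def ennreal_mult[symmetric] exp_add[symmetric] algebra_simps)
    qed
    finally show ?thesis .
  qed
  have "ennreal (exp x) * emeasure M (\<Union>j\<in>{..n}. A j) = (\<Sum>j\<le>n. ennreal (exp x) * emeasure M (A j))"
    using disj by (subst sum_distrib_left[symmetric], subst sum_emeasure) auto
  also have "\<dots> \<le> (\<Sum>j\<le>n. \<integral>\<^sup>+\<omega>. ennreal (exp (\<beta> * Z T \<omega>)) * indicator (A j) \<omega> \<partial>M)"
    by (intro sum_mono step) auto
  also have "\<dots> = (\<integral>\<^sup>+\<omega>. ennreal (exp (\<beta> * Z T \<omega>)) * indicator (\<Union>j\<in>{..n}. A j) \<omega> \<partial>M)"
    using mZ[of n] disj unfolding \<tau>n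
    by (subst nn_integral_sum[symmetric]) (auto simp: sum_distrib_left[symmetric] indicator_UN_disjoint)
  also have "\<dots> \<le> (\<integral>\<^sup>+\<omega>. ennreal (exp (\<beta> * Z T \<omega>)) \<partial>M)"
    by (intro nn_integral_mono) (auto simp: indicator_def)
  also have "\<dots> = ennreal (exp (T * \<kappa>))" using mgf T by simp
  finally have *: "ennreal (exp x) * emeasure M (\<Union>j\<in>{..n}. A j) \<le> ennreal (exp (T * \<kappa>))" .
  have "emeasure M (\<Union>j\<in>{..n}. A j) = ennreal (exp (-x)) * (ennreal (exp x) * emeasure M (\<Union>j\<in>{..n}. A j))"
    by (simp add: mult.assoc[symmetric] ennreal_mult[symmetric] exp_add[symmetric])
  also have "\<dots> \<le> ennreal (exp (-x)) * ennreal (exp (T * \<kappa>))" by (intro mult_left_mono *) auto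
  also have "\<dots> = ennreal (exp (T * \<kappa> - x))" by (simp add: ennreal_mult[symmetric] exp_add[symmetric])
  finally show ?thesis unfolding UN .
qed

text \<open>
  Along dyadic grids the exceptional events increase, so their union obeys the same bound, and
  right-continuity passes from the grid points to all times.
\<close>

lemma maximal_inequality:
  fixes \<beta> \<kappa> x T :: real
  assumes mgf: "\<And>s. 0 \<le> s \<Longrightarrow> (\<integral>\<^sup>+\<omega>. ennreal (exp (\<beta> * Z s \<omega>)) \<partial>M) = ennreal (exp (s * \<kappa>))"
    and \<kappa>: "0 \<le> \<kappa>" and T: "0 \<le> T"
  shows "\<exists>A\<in>sets M. emeasure M A \<le> ennreal (exp (T * \<kappa> - x)) \<and> (\<forall>\<omega>\<in>space M - A. \<forall>s\<in>{0..T}. \<beta> * Z s \<omega> \<le> x)"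
proof -
  define A where "A p = {\<omega> \<in> space M. \<exists>i\<le>2 ^ p. x \<le> \<beta> * Z (real i * T / real (2 ^ p)) \<omega>}" for p :: nat
  have A[measurable]: "A p \<in> sets M" for p
  proof -
    have [measurable]: "Z (real i * T / real (2 ^ p)) \<in> borel_measurable M" for i using T by (intro measurable_at) auto
    show ?thesis unfolding A_def by measurable
  qed
  have "incseq A"
  proof (rule incseq_SucI, rule subsetI)
    fix p \<omega> assume "\<omega> \<in> A p"
    then obtain i where i: "\<omega> \<in> space M" "i \<le> 2 ^ p" "x \<le> \<beta> * Z (real i * T / real (2 ^ p)) \<omega>" unfolding A_def by auto
    have "real (2 * i) * T / real (2 ^ Suc p) = real i * T / real (2 ^ p)" by simp
    then show "\<omega> \<in> A (Suc p)" unfolding A_def using i by (auto intro!: exI[of _ "2 * i"] simp del: of_nat_power)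
  qed
  then have "(\<lambda>p. emeasure M (A p)) \<longlonglongrightarrow> emeasure M (\<Union>p. A p)"
    by (intro Lim_emeasure_incseq) auto
  then have le: "emeasure M (\<Union>p. A p) \<le> ennreal (exp (T * \<kappa> - x))"
    by (rule LIMSEQ_le_const2) (auto simp: A_def intro!: exI[of _ 0] maximal_inequality_grid mgf \<kappa> T simp del: of_nat_power)
  have "\<beta> * Z s \<omega> \<le> x" if \<omega>: "\<omega> \<in> space M" "\<omega> \<notin> (\<Union>p. A p)" and s: "0 \<le> s" "s \<le> T" for s \<omega>
  proof (cases "s = T")
    case True
    have "\<omega> \<notin> A 0" using \<omega> by auto
    then have "\<not> x \<le> \<beta> * Z (real 1 * T / real (2 ^ 0)) \<omega>" using \<omega>(1) unfolding A_def by (auto simp del: of_nat_power)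
    then show ?thesis using True by simp
  next
    case False
    then have sT: "s < T" and T0: "0 < T" using s by auto
    define t where "t p = real (nat \<lfloor>s / T * 2 ^ p\<rfloor> + 1) * T / real (2 ^ p)" for p :: nat
    have fl: "real (nat \<lfloor>s / T * 2 ^ p\<rfloor>) = of_int \<lfloor>s / T * 2 ^ p\<rfloor>" for p :: nat using s T0 by simp
    have t1: "s < t p" for p
    proof -
      have "s / T * 2 ^ p < real (nat \<lfloor>s / T * 2 ^ p\<rfloor> + 1)" using fl[of p] by simp linarith
      then show ?thesis using T0 unfolding t_def by (simp add: field_simps)
    qed
    have t2: "t p \<le> s + T / 2 ^ p" for p
    proof -
      have "real (nat \<lfloor>s / T * 2 ^ p\<rfloor> + 1) \<le> s / T * 2 ^ p + 1" using fl[of p] by simp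
      then show ?thesis using T0 unfolding t_def by (simp add: field_simps)
    qed
    have t3: "nat \<lfloor>s / T * 2 ^ p\<rfloor> + 1 \<le> 2 ^ p" for p :: nat
    proof -
      have "s / T * 2 ^ p < 2 ^ p" using sT T0 s by (simp add: field_simps)
      then have "\<lfloor>s / T * 2 ^ p\<rfloor> < 2 ^ p" by (simp add: floor_less_iff)
      then show ?thesis using s T0 by (simp add: nat_less_iff Suc_le_eq)
    qed
    have "t \<longlonglongrightarrow> s"
    proof (rule tendsto_sandwich[of "\<lambda>_. s" _ _ "\<lambda>p. s + T / 2 ^ p"])
      show "(\<lambda>p. s + T / 2 ^ p) \<longlonglongrightarrow> s"
        using tendsto_add[OF tendsto_const LIMSEQ_divide_realpow_zero[of 2 T]] by simp
    qed (auto intro!: always_eventually less_imp_le t1 t2)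
    then have "filterlim t (at_right s) sequentially"
      by (rule tendsto_imp_filterlim_at_right) (auto intro!: always_eventually t1)
    moreover have "((\<lambda>s. Z s \<omega>) \<longlongrightarrow> Z s \<omega>) (at_right s)"
      using cadlag_paths[OF \<omega>(1)] s(1) by (auto simp: cadlag_def)
    ultimately have "(\<lambda>p. Z (t p) \<omega>) \<longlonglongrightarrow> Z s \<omega>" by (rule filterlim_compose[rotated])
    then have "(\<lambda>p. \<beta> * Z (t p) \<omega>) \<longlonglongrightarrow> \<beta> * Z s \<omega>" by (intro tendsto_intros)
    moreover have "\<beta> * Z (t p) \<omega> \<le> x" for p
    proof -
      have "\<omega> \<notin> A p" using \<omega> by auto
      then show ?thesis using t3[of p] \<omega>(1) unfolding A_def t_def by (force simp del: of_nat_power of_nat_add)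
    qed
    ultimately show ?thesis by (intro LIMSEQ_le_const2[of _ "\<beta> * Z s \<omega>" x]) auto
  qed
  then show ?thesis using le by (intro bexI[of _ "\<Union>p. A p"]) auto
qed

end

text \<open>
  Independence and stationarity of the increments are identities between characteristic functions,
  and these survive bounded convergence.
\<close>

lemma levy_process_limit:
  fixes Z :: "real \<Rightarrow> 'a \<Rightarrow> real" and Y :: "nat \<Rightarrow> real \<Rightarrow> 'a \<Rightarrow> real"
  assumes Y: "\<And>n. levy_process M (Y n)"
    and lim: "\<And>s. 0 \<le> s \<Longrightarrow> AE \<omega> in M. (\<lambda>n. Y n s \<omega>) \<longlonglongrightarrow> Z s \<omega>"
    and meas: "\<And>s. 0 \<le> s \<Longrightarrow> Z s \<in> borel_measurable M"
    and start: "\<And>\<omega>. \<omega> \<in> space M \<Longrightarrow> Z 0 \<omega> = 0"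
    and cad: "\<And>\<omega>. \<omega> \<in> space M \<Longrightarrow> cadlag (\<lambda>s. Z s \<omega>)"
  shows "levy_process M Z"
proof -
  interpret prob_space M using Y[of 0] by (simp add: levy_process_def)
  interpret Y: levy_process M "Y n" for n by (rule Y)
  have Ym: "Y n s \<in> borel_measurable M" if "0 \<le> s" for n s using that by (rule Y.measurable_at)
  have conv: "(\<lambda>n. \<integral>\<omega>. (\<Prod>l<N. iexp (\<theta> l * (Y n (\<tau> (Suc l)) \<omega> - Y n (\<tau> l) \<omega>))) \<partial>M)
     \<longlonglongrightarrow> (\<integral>\<omega>. (\<Prod>l<N. iexp (\<theta> l * (Z (\<tau> (Suc l)) \<omega> - Z (\<tau> l) \<omega>))) \<partial>M)"
    if \<tau>: "\<And>i. 0 \<le> \<tau> i" for N :: nat and \<tau> \<theta> :: "nat \<Rightarrow> real"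
  proof (rule integral_dominated_convergence[where w = "\<lambda>_. 1"])
    have [measurable]: "Z (\<tau> i) \<in> borel_measurable M" "Y n (\<tau> i) \<in> borel_measurable M" for i n
      using \<tau> by (auto intro: meas Ym)
    show "(\<lambda>\<omega>. \<Prod>l<N. iexp (\<theta> l * (Z (\<tau> (Suc l)) \<omega> - Z (\<tau> l) \<omega>))) \<in> borel_measurable M" by measurable
    show "(\<lambda>\<omega>. \<Prod>l<N. iexp (\<theta> l * (Y n (\<tau> (Suc l)) \<omega> - Y n (\<tau> l) \<omega>))) \<in> borel_measurable M" for n by measurable
    have "AE \<omega> in M. \<forall>i. (\<lambda>n. Y n (\<tau> i) \<omega>) \<longlonglongrightarrow> Z (\<tau> i) \<omega>"
      unfolding AE_all_countable using \<tau> lim by auto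
    then show "AE \<omega> in M. (\<lambda>n. \<Prod>l<N. iexp (\<theta> l * (Y n (\<tau> (Suc l)) \<omega> - Y n (\<tau> l) \<omega>)))
        \<longlonglongrightarrow> (\<Prod>l<N. iexp (\<theta> l * (Z (\<tau> (Suc l)) \<omega> - Z (\<tau> l) \<omega>)))"
      by eventually_elim (auto intro!: tendsto_intros)
  qed (auto simp: prod_norm[symmetric])
  have conv1: "(\<lambda>n. \<integral>\<omega>. iexp (\<theta> * (Y n b \<omega> - Y n a \<omega>)) \<partial>M) \<longlonglongrightarrow> (\<integral>\<omega>. iexp (\<theta> * (Z b \<omega> - Z a \<omega>)) \<partial>M)"
    if "0 \<le> a" "0 \<le> b" for a b \<theta> :: real
  proof -
    have "(\<lambda>n. \<integral>\<omega>. (\<Prod>l<(1::nat). iexp (\<theta> * (Y n ((\<lambda>i. if i = 0 then a else b) (Suc l)) \<omega> - Y n ((\<lambda>i. if i = 0 then a else b) l) \<omega>))) \<partial>M)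
     \<longlonglongrightarrow> (\<integral>\<omega>. (\<Prod>l<(1::nat). iexp (\<theta> * (Z ((\<lambda>i. if i = 0 then a else b) (Suc l)) \<omega> - Z ((\<lambda>i. if i = 0 then a else b) l) \<omega>))) \<partial>M)"
      by (rule conv) (use that in auto)
    then show ?thesis by (simp add: lessThan_Suc)
  qed
  show ?thesis
  proof (intro levy_process.intro levy_process_axioms.intro)
    show "prob_space M" by (rule prob_space_axioms)
    show "Z s \<in> borel_measurable M" if "0 \<le> s" for s using that by (rule meas)
    show "Z 0 \<omega> = 0" if "\<omega> \<in> space M" for \<omega> using that by (rule start)
    show "cadlag (\<lambda>s. Z s \<omega>)" if "\<omega> \<in> space M" for \<omega> using that by (rule cad)
  next
    fix \<tau>0 :: "nat \<Rightarrow> real" and N assume \<tau>0: "0 \<le> \<tau>0 0" "\<And>i. i < N \<Longrightarrow> \<tau>0 i \<le> \<tau>0 (Suc i)"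
    have \<tau>0_nn: "0 \<le> \<tau>0 i" if "i \<le> N" for i using that
      by (induction i) (auto intro: \<tau>0(1) order_trans[OF _ \<tau>0(2)])
    define \<tau> where "\<tau> i = (if i \<le> N then \<tau>0 i else 0)" for i
    have \<tau>: "0 \<le> \<tau> i" for i using \<tau>0_nn by (auto simp: \<tau>_def)
    have [measurable]: "Z (\<tau> i) \<in> borel_measurable M" "Y n (\<tau> i) \<in> borel_measurable M" for i n
      using \<tau> by (auto intro: meas Ym)
    have "indep_vars (\<lambda>_. borel) (\<lambda>i \<omega>. Z (\<tau> (Suc i)) \<omega> - Z (\<tau> i) \<omega>) {..<N}"
    proof (rule indep_vars_of_char)
      fix \<theta> :: "nat \<Rightarrow> real"
      have fac: "(\<integral>\<omega>. (\<Prod>l<N. iexp (\<theta> l * (Y n (\<tau> (Suc l)) \<omega> - Y n (\<tau> l) \<omega>))) \<partial>M)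
          = (\<Prod>l<N. \<integral>\<omega>. iexp (\<theta> l * (Y n (\<tau> (Suc l)) \<omega> - Y n (\<tau> l) \<omega>)) \<partial>M)" for n
      proof (rule indep_vars_lebesgue_integral)
        have "indep_vars (\<lambda>_. borel) (\<lambda>i \<omega>. Y n (\<tau> (Suc i)) \<omega> - Y n (\<tau> i) \<omega>) {..<N}" for n
          by (rule Y.indep_increments) (use \<tau>0 in \<open>auto simp: \<tau>_def\<close>)
        from indep_vars_compose2[OF this, of "\<lambda>l x. iexp (\<theta> l * x)" "\<lambda>_. borel"]
        show "indep_vars (\<lambda>_. borel) (\<lambda>l \<omega>. iexp (\<theta> l * (Y n (\<tau> (Suc l)) \<omega> - Y n (\<tau> l) \<omega>))) {..<N}"
          by auto
        show "integrable M (\<lambda>\<omega>. iexp (\<theta> l * (Y n (\<tau> (Suc l)) \<omega> - Y n (\<tau> l) \<omega>)))" for l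
          by (rule integrable_const_bound[where B = 1]) auto
      qed auto
      have "(\<lambda>n. \<integral>\<omega>. (\<Prod>l<N. iexp (\<theta> l * (Y n (\<tau> (Suc l)) \<omega> - Y n (\<tau> l) \<omega>))) \<partial>M)
         \<longlonglongrightarrow> (\<Prod>l<N. \<integral>\<omega>. iexp (\<theta> l * (Z (\<tau> (Suc l)) \<omega> - Z (\<tau> l) \<omega>)) \<partial>M)"
        unfolding fac by (intro tendsto_prod conv1 \<tau>)
      then show "(\<integral>\<omega>. (\<Prod>l<N. iexp (\<theta> l * (Z (\<tau> (Suc l)) \<omega> - Z (\<tau> l) \<omega>))) \<partial>M)
          = (\<Prod>l<N. \<integral>\<omega>. iexp (\<theta> l * (Z (\<tau> (Suc l)) \<omega> - Z (\<tau> l) \<omega>)) \<partial>M)"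
        using conv[OF \<tau>] by (rule LIMSEQ_unique[rotated])
    qed auto
    then show "indep_vars (\<lambda>_. borel) (\<lambda>i \<omega>. Z (\<tau>0 (Suc i)) \<omega> - Z (\<tau>0 i) \<omega>) {..<N}"
      by (rule indep_vars_cong[THEN iffD1, rotated -1]) (auto simp: \<tau>_def)
  next
    fix s h :: real assume sh: "0 \<le> s" "0 \<le> h"
    have [measurable]: "Z s \<in> borel_measurable M" "Z h \<in> borel_measurable M" "Z (s + h) \<in> borel_measurable M"
      "Y n s \<in> borel_measurable M" "Y n h \<in> borel_measurable M" "Y n (s + h) \<in> borel_measurable M" for n
      using sh by (auto intro: meas Ym)
    show "distr M borel (\<lambda>\<omega>. Z (s + h) \<omega> - Z s \<omega>) = distr M borel (Z h)"
    proof (rule Levy_uniqueness)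
      show "char (distr M borel (\<lambda>\<omega>. Z (s + h) \<omega> - Z s \<omega>)) = char (distr M borel (Z h))"
      proof
        fix \<theta>
        have eq: "(\<integral>\<omega>. iexp (\<theta> * (Y n (s + h) \<omega> - Y n s \<omega>)) \<partial>M) = (\<integral>\<omega>. iexp (\<theta> * (Y n h \<omega> - Y n 0 \<omega>)) \<partial>M)" for n
        proof -
          have "(\<integral>\<omega>. iexp (\<theta> * (Y n (s + h) \<omega> - Y n s \<omega>)) \<partial>M) = char (distr M borel (\<lambda>\<omega>. Y n (s + h) \<omega> - Y n s \<omega>)) \<theta>"
            unfolding char_def by (subst integral_distr) auto
          also have "\<dots> = char (distr M borel (Y n h)) \<theta>" using Y.stationary_increments[OF sh] by simp
          also have "\<dots> = (\<integral>\<omega>. iexp (\<theta> * (Y n h \<omega> - Y n 0 \<omega>)) \<partial>M)"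
            unfolding char_def by (subst integral_distr) (auto simp: Y.start_zero cong: Bochner_Integration.integral_cong)
          finally show ?thesis .
        qed
        have "(\<lambda>n. \<integral>\<omega>. iexp (\<theta> * (Y n (s + h) \<omega> - Y n s \<omega>)) \<partial>M) \<longlonglongrightarrow> (\<integral>\<omega>. iexp (\<theta> * (Z h \<omega> - Z 0 \<omega>)) \<partial>M)"
          unfolding eq using sh by (intro conv1) auto
        then have "(\<integral>\<omega>. iexp (\<theta> * (Z (s + h) \<omega> - Z s \<omega>)) \<partial>M) = (\<integral>\<omega>. iexp (\<theta> * (Z h \<omega> - Z 0 \<omega>)) \<partial>M)"
          using conv1[of s "s + h" \<theta>] sh by (auto intro: LIMSEQ_unique)
        then show "char (distr M borel (\<lambda>\<omega>. Z (s + h) \<omega> - Z s \<omega>)) \<theta> = char (distr M borel (Z h)) \<theta>"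
          unfolding char_def by (subst (1 2) integral_distr) (auto simp: start cong: Bochner_Integration.integral_cong)
      qed
    qed auto
  qed
qed

text \<open>
  The second-moment bound is a form of uniform integrability: truncation at level \<open>L\<close> changes each
  expectation by at most \<open>C / L\<close>.
\<close>

lemma (in prob_space) nn_integral_limit_of_square_bounded:
  fixes X :: "nat \<Rightarrow> 'a \<Rightarrow> real"
  assumes X[measurable]: "\<And>n. X n \<in> borel_measurable M" and Y[measurable]: "Y \<in> borel_measurable M"
    and nn: "\<And>n \<omega>. 0 \<le> X n \<omega>" "\<And>\<omega>. 0 \<le> Y \<omega>"
    and lim: "AE \<omega> in M. (\<lambda>n. X n \<omega>) \<longlonglongrightarrow> Y \<omega>"
    and sq: "\<And>n. (\<integral>\<^sup>+\<omega>. ennreal ((X n \<omega>)\<^sup>2) \<partial>M) \<le> ennreal C" and C: "0 \<le> C"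
    and E: "\<And>n. (\<integral>\<^sup>+\<omega>. ennreal (X n \<omega>) \<partial>M) = ennreal (e n)" "e \<longlonglongrightarrow> l" "\<And>n. 0 \<le> e n"
  shows "(\<integral>\<^sup>+\<omega>. ennreal (Y \<omega>) \<partial>M) = ennreal l"
proof -
  have intX: "integrable M (X n)" for n by (rule integrableI_nonneg) (auto simp: nn E)
  have eX: "(\<integral>\<omega>. X n \<omega> \<partial>M) = e n" for n using nn E by (subst integral_eq_nn_integral) auto
  have intX2: "integrable M (\<lambda>\<omega>. (X n \<omega>)\<^sup>2)" for n by (rule integrableI_nonneg) (use sq[of n] in \<open>auto intro: order_le_less_trans\<close>)
  have eX2: "(\<integral>\<omega>. (X n \<omega>)\<^sup>2 \<partial>M) \<le> C" for n
    using sq[of n] C nn_integral_eq_integral[OF intX2[of n]] by (simp add: ennreal_le_iff)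
  have l0: "0 \<le> l" using E by (intro LIMSEQ_le_const[of e l]) auto
  have "(\<integral>\<^sup>+\<omega>. ennreal (Y \<omega>) \<partial>M) = (\<integral>\<^sup>+\<omega>. liminf (\<lambda>n. ennreal (X n \<omega>)) \<partial>M)"
  proof (rule nn_integral_cong_AE)
    show "AE \<omega> in M. ennreal (Y \<omega>) = liminf (\<lambda>n. ennreal (X n \<omega>))"
      using lim by eventually_elim (auto intro!: lim_imp_Liminf[symmetric] tendsto_ennrealI)
  qed
  also have "\<dots> \<le> liminf (\<lambda>n. \<integral>\<^sup>+\<omega>. ennreal (X n \<omega>) \<partial>M)" by (rule nn_integral_liminf) auto
  also have "\<dots> = ennreal l" unfolding E(1) using E(2) by (intro lim_imp_Liminf tendsto_ennrealI) auto
  finally have le: "(\<integral>\<^sup>+\<omega>. ennreal (Y \<omega>) \<partial>M) \<le> ennreal l" .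
  then have intY: "integrable M Y" by (intro integrableI_nonneg) (auto simp: nn intro: order_le_less_trans)
  have ge: "l - C / L \<le> (\<integral>\<omega>. Y \<omega> \<partial>M)" if L: "0 < L" for L :: real
  proof -
    have intm: "integrable M (\<lambda>\<omega>. min (X n \<omega>) L)" for n
      by (rule integrable_const_bound[where B = L]) (use L nn in \<open>auto intro!: AE_I2 simp: min_def\<close>)
    have "(\<lambda>n. \<integral>\<omega>. min (X n \<omega>) L \<partial>M) \<longlonglongrightarrow> (\<integral>\<omega>. min (Y \<omega>) L \<partial>M)"
    proof (rule integral_dominated_convergence[where w = "\<lambda>_. L"])
      show "AE \<omega> in M. (\<lambda>n. min (X n \<omega>) L) \<longlonglongrightarrow> min (Y \<omega>) L"
        using lim by eventually_elim (auto intro!: tendsto_intros)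
    qed (use L nn in \<open>auto intro!: AE_I2 simp: min_def\<close>)
    moreover have "e n - C / L \<le> (\<integral>\<omega>. min (X n \<omega>) L \<partial>M)" for n
    proof -
      have "e n - (\<integral>\<omega>. min (X n \<omega>) L \<partial>M) = (\<integral>\<omega>. X n \<omega> - min (X n \<omega>) L \<partial>M)"
        using intX intm by (simp add: eX)
      also have "\<dots> \<le> (\<integral>\<omega>. (X n \<omega>)\<^sup>2 / L \<partial>M)"
      proof (rule integral_mono)
        show "X n \<omega> - min (X n \<omega>) L \<le> (X n \<omega>)\<^sup>2 / L" for \<omega>
        proof (cases "X n \<omega> \<le> L")
          case True then show ?thesis using L nn(1)[of n \<omega>] by (simp add: min_def)
        next
          case False
          then have "X n \<omega> * L \<le> X n \<omega> * X n \<omega>" using nn(1)[of n \<omega>] by (intro mult_left_mono) auto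
          then have "X n \<omega> \<le> (X n \<omega>)\<^sup>2 / L" using L by (simp add: field_simps power2_eq_square)
          then show ?thesis using False L by (simp add: min_def)
        qed
      qed (use intX intm intX2 in auto)
      also have "\<dots> \<le> C / L" using eX2[of n] L by (simp add: divide_right_mono)
      finally show ?thesis by simp
    qed
    ultimately have "l - C / L \<le> (\<integral>\<omega>. min (Y \<omega>) L \<partial>M)"
      using E(2) by (intro LIMSEQ_le[of "\<lambda>n. e n - C / L" "l - C / L"]) (auto intro!: tendsto_intros)
    also have "\<dots> \<le> (\<integral>\<omega>. Y \<omega> \<partial>M)"
    proof (rule integral_mono)
      show "integrable M (\<lambda>\<omega>. min (Y \<omega>) L)"
        by (rule integrable_const_bound[where B = L]) (use L nn in \<open>auto intro!: AE_I2 simp: min_def\<close>)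
    qed (use intY in auto)
    finally show ?thesis .
  qed
  have "((\<lambda>L. l - C / L) \<longlongrightarrow> l - 0) at_top"
    by (intro tendsto_intros tendsto_divide_0[OF tendsto_const]) (simp add: filterlim_at_top_imp_at_infinity filterlim_ident)
  then have "l - 0 \<le> (\<integral>\<omega>. Y \<omega> \<partial>M)"
    by (rule tendsto_upperbound) (auto intro!: ge eventually_mono[OF eventually_gt_at_top[of 0]])
  then have "ennreal l \<le> (\<integral>\<^sup>+\<omega>. ennreal (Y \<omega>) \<partial>M)"
    using nn_integral_eq_integral[OF intY] nn by (simp add: ennreal_leI)
  with le show ?thesis by (rule antisym)
qed

section \<open>The exponential formula for a Poisson cell\<close>

text \<open>
  The identity on the interval of uniform times, and positive everywhere. No point is ever placed
  at time 0, so every path, and not just almost every path, starts at 0.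
\<close>

definition positive_time :: "real \<Rightarrow> real" where
  "positive_time u = (if u \<le> 0 then 1 else u)"

lemma measurable_positive_time[measurable]: "positive_time \<in> borel_measurable borel"
  unfolding positive_time_def[abs_def] by measurable

lemma positive_time_pos: "0 < positive_time u"
  by (simp add: positive_time_def)

definition mark_measure :: "real measure \<Rightarrow> (real \<times> real) measure" where
  "mark_measure \<rho> = uniform_measure lborel {0<..1} \<Otimes>\<^sub>M \<rho>"

text \<open>
  A cell describes one layer during one unit block of time: a Poisson number of points, and an infinite
  supply of independent marks (time within the block, jump size), of which only that many are used.
\<close>

definition cell_measure :: "real \<Rightarrow> real measure \<Rightarrow> (nat \<times> (nat \<Rightarrow> real \<times> real)) measure" where
  "cell_measure c \<rho> = measure_pmf (poisson_pmf c) \<Otimes>\<^sub>M PiM UNIV (\<lambda>_. mark_measure \<rho>)"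

lemma integral_prod_coordinates:
  fixes g :: "'i \<Rightarrow> 'b \<Rightarrow> complex"
  assumes D: "\<And>i. prob_space (D i)" and J: "finite J" and g: "\<And>i. i \<in> J \<Longrightarrow> integrable (D i) (g i)"
  shows "integrable (PiM UNIV D) (\<lambda>\<omega>. \<Prod>i\<in>J. g i (\<omega> i))"
    and "(\<integral>\<omega>. (\<Prod>i\<in>J. g i (\<omega> i)) \<partial>PiM UNIV D) = (\<Prod>i\<in>J. \<integral>x. g i x \<partial>D i)"
proof -
  interpret D: prob_space "D i" for i by (rule D)
  interpret product_prob_space D UNIV by standard
  have g'[measurable]: "g i \<in> borel_measurable (D i)" if "i \<in> J" for i using g[OF that] by simp
  have eq: "distr (PiM UNIV D) (PiM J D) (\<lambda>x. restrict x J) = PiM J D"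
    using J by (intro distr_PiM_restrict_finite) auto
  have m: "(\<lambda>x. restrict x J) \<in> measurable (PiM UNIV D) (PiM J D)" by (rule measurable_restrict_subset) auto
  have m2: "(\<lambda>\<omega>. \<Prod>i\<in>J. g i (\<omega> i)) \<in> borel_measurable (PiM J D)"
    by (intro borel_measurable_prod measurable_compose[OF measurable_component_singleton]) auto
  have "integrable (distr (PiM UNIV D) (PiM J D) (\<lambda>x. restrict x J)) (\<lambda>\<omega>. \<Prod>i\<in>J. g i (\<omega> i))"
    unfolding eq using J g by (rule product_integrable_prod)
  then show "integrable (PiM UNIV D) (\<lambda>\<omega>. \<Prod>i\<in>J. g i (\<omega> i))"
    using m m2 by (subst (asm) integrable_distr_eq) auto
  have "(\<Prod>i\<in>J. \<integral>x. g i x \<partial>D i) = (\<integral>\<omega>. (\<Prod>i\<in>J. g i (\<omega> i)) \<partial>distr (PiM UNIV D) (PiM J D) (\<lambda>x. restrict x J))"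
    unfolding eq using J g by (rule product_integral_prod[symmetric])
  also have "\<dots> = (\<integral>\<omega>. (\<Prod>i\<in>J. g i (\<omega> i)) \<partial>PiM UNIV D)"
    using m m2 by (subst integral_distr) auto
  finally show "(\<integral>\<omega>. (\<Prod>i\<in>J. g i (\<omega> i)) \<partial>PiM UNIV D) = (\<Prod>i\<in>J. \<integral>x. g i x \<partial>D i)" ..
qed

lemma poisson_generating_function:
  fixes a :: "'b :: {real_normed_field, banach, second_countable_topology}"
  assumes c: "0 < c"
  shows "integrable (measure_pmf (poisson_pmf c)) (\<lambda>n. a ^ n)"
    and "(\<integral>n. a ^ n \<partial>measure_pmf (poisson_pmf c)) = exp (of_real c * (a - 1))"
proof -
  have s: "(\<lambda>n. (c ^ n / fact n * exp (-c)) *\<^sub>R b ^ n) sums (exp (of_real c * (b - 1)))"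
    for b :: "'c :: {real_normed_field, banach}"
  proof -
    have "(\<lambda>n. of_real (exp (-c)) * ((of_real c * b) ^ n /\<^sub>R fact n)) sums (of_real (exp (-c)) * exp (of_real c * b))"
      by (intro sums_mult exp_converges)
    also have "of_real (exp (-c)) * exp (of_real c * b) = exp (of_real c * (b - 1))"
    proof -
      have "of_real (exp (-c)) = exp (of_real (-c) :: 'c)" by (rule exp_of_real[symmetric])
      then have "of_real (exp (-c)) * exp (of_real c * b) = exp (of_real (-c) + of_real c * b)" by (simp only: exp_add_commuting[OF mult.commute])
      then show ?thesis by (simp add: right_diff_distrib)
    qed
    also have "(\<lambda>n. of_real (exp (-c)) * ((of_real c * b) ^ n /\<^sub>R fact n)) = (\<lambda>n. (c ^ n / fact n * exp (-c)) *\<^sub>R b ^ n)"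
      by (intro ext) (simp add: scaleR_conv_of_real power_mult_distrib field_simps)
    finally show ?thesis .
  qed
  have "summable (\<lambda>n. norm ((c ^ n / fact n * exp (-c)) *\<^sub>R a ^ n))"
    using sums_summable[OF s[of "norm a"]] c by (simp add: norm_power)
  then have i: "integrable (count_space UNIV) (\<lambda>n. (c ^ n / fact n * exp (-c)) *\<^sub>R a ^ n)"
    by (simp add: integrable_count_space_nat_iff)
  show "integrable (measure_pmf (poisson_pmf c)) (\<lambda>n. a ^ n)"
    unfolding measure_pmf_eq_density using c i by (subst integrable_density) auto
  have "(\<integral>n. a ^ n \<partial>measure_pmf (poisson_pmf c)) = (\<integral>n. (c ^ n / fact n * exp (-c)) *\<^sub>R a ^ n \<partial>count_space UNIV)"
    unfolding measure_pmf_eq_density using c by (subst integral_density) auto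
  also have "\<dots> = exp (of_real c * (a - 1))"
    using sums_integral_count_space_nat[OF i] s[of a] by (rule sums_unique2)
  finally show "(\<integral>n. a ^ n \<partial>measure_pmf (poisson_pmf c)) = exp (of_real c * (a - 1))" .
qed

lemma prob_space_uniform01: "prob_space (uniform_measure lborel {0<..1::real})"
  by (rule prob_space_uniform_measure) auto

lemma prob_space_pair: "prob_space A \<Longrightarrow> prob_space B \<Longrightarrow> prob_space (A \<Otimes>\<^sub>M B)"
proof -
  assume "prob_space A" "prob_space B"
  then interpret A: prob_space A + B: prob_space B by auto
  interpret pair_prob_space A B ..
  show ?thesis by (rule P.prob_space_axioms)
qed

lemma prob_space_mark: "prob_space \<rho> \<Longrightarrow> prob_space (mark_measure \<rho>)"
  unfolding mark_measure_def by (intro prob_space_pair prob_space_uniform01)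

lemma prob_space_marks: "prob_space \<rho> \<Longrightarrow> prob_space (PiM (UNIV :: nat set) (\<lambda>_. mark_measure \<rho>))"
  by (intro prob_space_PiM prob_space_mark)

lemma prob_space_cell: "prob_space \<rho> \<Longrightarrow> prob_space (cell_measure c \<rho>)"
  unfolding cell_measure_def by (intro prob_space_pair prob_space_marks prob_space_measure_pmf)

lemma sets_mark: "sets \<rho> = sets borel \<Longrightarrow> sets (mark_measure \<rho>) = sets (borel \<Otimes>\<^sub>M borel)"
  unfolding mark_measure_def by (intro sets_pair_measure_cong) auto

lemma measurable_cell:
  assumes "\<And>n. (\<lambda>\<xi>. F (n, \<xi>)) \<in> borel_measurable (PiM UNIV (\<lambda>_. mark_measure \<rho>))"
  shows "F \<in> borel_measurable (cell_measure c \<rho>)"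
proof -
  have "F \<in> borel_measurable (count_space UNIV \<Otimes>\<^sub>M PiM UNIV (\<lambda>_. mark_measure \<rho>))"
    by (rule measurable_pair_measure_countable1) (use assms in auto)
  also have "borel_measurable (count_space UNIV \<Otimes>\<^sub>M PiM UNIV (\<lambda>_. mark_measure \<rho>)) = borel_measurable (cell_measure c \<rho>)"
    unfolding cell_measure_def by (intro measurable_cong_sets sets_pair_measure_cong) auto
  finally show ?thesis .
qed

text \<open>
  For a fixed number \<open>n\<close> of points the expectation is the \<open>n\<close>-th power of \<open>\<integral> f\<close>, and averaging over \<open>n\<close>
  evaluates the Poisson generating function at \<open>\<integral> f\<close>.
\<close>

lemma cell_exponential_formula:
  fixes f :: "real \<times> real \<Rightarrow> complex"
  assumes \<rho>: "prob_space \<rho>" and c: "0 < c" and f: "integrable (mark_measure \<rho>) f"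
  shows "integrable (cell_measure c \<rho>) (\<lambda>p. \<Prod>i<fst p. f (snd p i))"
    and "(\<integral>p. (\<Prod>i<fst p. f (snd p i)) \<partial>cell_measure c \<rho>) = exp (of_real c * ((\<integral>x. f x \<partial>mark_measure \<rho>) - 1))"
proof -
  let ?P = "measure_pmf (poisson_pmf c)" and ?Q = "PiM (UNIV :: nat set) (\<lambda>_. mark_measure \<rho>)"
  interpret Q: prob_space ?Q by (rule prob_space_marks[OF \<rho>])
  interpret P: prob_space ?P by (rule prob_space_measure_pmf)
  interpret PQ: pair_sigma_finite ?P ?Q ..
  have fm[measurable]: "f \<in> borel_measurable (mark_measure \<rho>)" using f by simp
  have fn: "integrable (mark_measure \<rho>) (\<lambda>x. complex_of_real (norm (f x)))" using f by (simp add: integrable_of_real)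
  have m: "(\<lambda>p. \<Prod>i<fst p. f (snd p i)) \<in> borel_measurable (cell_measure c \<rho>)"
    by (rule measurable_cell) (auto intro!: borel_measurable_prod measurable_compose[OF measurable_component_singleton])
  have int: "integrable ?Q (\<lambda>\<xi>. \<Prod>i<n. f (\<xi> i))" for n
    by (rule integral_prod_coordinates(1)) (use f \<rho> in \<open>auto intro: prob_space_mark\<close>)
  have eq: "(\<integral>\<xi>. (\<Prod>i<n. f (\<xi> i)) \<partial>?Q) = (\<integral>x. f x \<partial>mark_measure \<rho>) ^ n" for n
    by (subst integral_prod_coordinates(2)) (use f \<rho> in \<open>auto intro: prob_space_mark\<close>)
  have eqn: "(\<integral>\<xi>. norm (\<Prod>i<n. f (\<xi> i)) \<partial>?Q) = (\<integral>x. norm (f x) \<partial>mark_measure \<rho>) ^ n" for n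
  proof -
    have "complex_of_real (\<integral>\<xi>. norm (\<Prod>i<n. f (\<xi> i)) \<partial>?Q) = (\<integral>\<xi>. (\<Prod>i<n. complex_of_real (norm (f (\<xi> i)))) \<partial>?Q)"
      by (simp add: prod_norm[symmetric] flip: integral_complex_of_real)
    also have "\<dots> = (\<Prod>i<n. \<integral>x. complex_of_real (norm (f x)) \<partial>mark_measure \<rho>)"
      by (rule integral_prod_coordinates(2)) (use fn \<rho> in \<open>auto intro: prob_space_mark\<close>)
    also have "\<dots> = complex_of_real ((\<integral>x. norm (f x) \<partial>mark_measure \<rho>) ^ n)" by simp
    finally show ?thesis by (simp only: of_real_eq_iff)
  qed
  show int2: "integrable (cell_measure c \<rho>) (\<lambda>p. \<Prod>i<fst p. f (snd p i))"
    unfolding cell_measure_def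
  proof (rule PQ.Fubini_integrable)
    show "integrable ?P (\<lambda>n. \<integral>\<xi>. norm (\<Prod>i<fst (n, \<xi>). f (snd (n, \<xi>) i)) \<partial>?Q)"
      using c by (simp add: eqn poisson_generating_function)
    show "AE n in ?P. integrable ?Q (\<lambda>\<xi>. \<Prod>i<fst (n, \<xi>). f (snd (n, \<xi>) i))"
      using int by simp
  qed (use m in \<open>simp add: cell_measure_def\<close>)
  have "(\<integral>p. (\<Prod>i<fst p. f (snd p i)) \<partial>cell_measure c \<rho>) = (\<integral>n. (\<integral>\<xi>. (\<Prod>i<n. f (\<xi> i)) \<partial>?Q) \<partial>?P)"
    using int2 unfolding cell_measure_def by (subst PQ.integral_fst'[symmetric]) auto
  also have "\<dots> = exp (of_real c * ((\<integral>x. f x \<partial>mark_measure \<rho>) - 1))"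
    unfolding eq using c by (rule poisson_generating_function)
  finally show "(\<integral>p. (\<Prod>i<fst p. f (snd p i)) \<partial>cell_measure c \<rho>) = exp (of_real c * ((\<integral>x. f x \<partial>mark_measure \<rho>) - 1))" .
qed

lemma integral_mark_product:
  fixes g h :: "real \<Rightarrow> complex"
  assumes \<rho>: "prob_space \<rho>" and g: "integrable (uniform_measure lborel {0<..1}) g" and h: "integrable \<rho> h"
  shows "integrable (mark_measure \<rho>) (\<lambda>p. g (fst p) * h (snd p))"
    and "(\<integral>p. g (fst p) * h (snd p) \<partial>mark_measure \<rho>) = (\<integral>u. g u \<partial>uniform_measure lborel {0<..1}) * (\<integral>y. h y \<partial>\<rho>)"
proof -
  let ?U = "uniform_measure lborel {0<..1::real}"
  interpret U: prob_space ?U by (rule prob_space_uniform01)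
  interpret R: prob_space \<rho> by (rule \<rho>)
  interpret PQ: pair_sigma_finite ?U \<rho> ..
  have [measurable]: "g \<in> borel_measurable ?U" "h \<in> borel_measurable \<rho>" using g h by auto
  show int: "integrable (mark_measure \<rho>) (\<lambda>p. g (fst p) * h (snd p))"
    unfolding mark_measure_def
  proof (rule PQ.Fubini_integrable)
    show "integrable ?U (\<lambda>x. \<integral>y. norm (g (fst (x, y)) * h (snd (x, y))) \<partial>\<rho>)"
      using g h by (simp add: norm_mult)
    show "AE x in ?U. integrable \<rho> (\<lambda>y. g (fst (x, y)) * h (snd (x, y)))"
      using h by simp
  qed measurable
  show "(\<integral>p. g (fst p) * h (snd p) \<partial>mark_measure \<rho>) = (\<integral>u. g u \<partial>?U) * (\<integral>y. h y \<partial>\<rho>)"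
    using int unfolding mark_measure_def by (subst PQ.integral_fst'[symmetric]) auto
qed

text \<open>
  The length of the part of the block from \<open>j\<close> to \<open>j + 1\<close> that precedes \<open>t\<close>.
\<close>

definition overlap :: "nat \<Rightarrow> real \<Rightarrow> real" where
  "overlap j t = max 0 (min 1 (t - real j))"

lemma uniform01_le:
  "(\<integral>u. of_bool (real j + positive_time u \<le> t) \<partial>uniform_measure lborel {0<..1}) = overlap j t"
proof -
  interpret U: prob_space "uniform_measure lborel {0<..1::real}" by (rule prob_space_uniform01)
  have "(\<integral>u. of_bool (real j + positive_time u \<le> t) \<partial>uniform_measure lborel {0<..1}) =
     (\<integral>u. indicator {u. real j + positive_time u \<le> t} u \<partial>uniform_measure lborel {0<..1::real})"
    by (intro Bochner_Integration.integral_cong) (auto simp: indicator_def)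
  also have "\<dots> = measure (uniform_measure lborel {0<..1}) {u. real j + positive_time u \<le> t}"
    by simp
  also have "\<dots> = measure lborel ({0<..1} \<inter> {u. real j + positive_time u \<le> t}) / measure lborel {0<..1::real}"
    by (rule measure_uniform_measure) auto
  also have "{0<..1} \<inter> {u. real j + positive_time u \<le> t} = {0<..min 1 (t - real j)}" by (auto simp: positive_time_def)
  finally show ?thesis by (simp add: overlap_def max_def min_def)
qed

lemma sum_overlap:
  assumes "0 \<le> t" "t \<le> real J + 1"
  shows "(\<Sum>j\<le>J. overlap j t) = t"
proof -
  have "overlap j t = min t (real (Suc j)) - min t (real j)" for j
    using assms(1) by (auto simp: overlap_def min_def max_def)
  then have "(\<Sum>j\<le>J. overlap j t) = (\<Sum>j<Suc J. min t (real (Suc j)) - min t (real j))"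
    by (simp add: lessThan_Suc_atMost)
  also have "\<dots> = min t (real (Suc J)) - min t (real 0)" by (rule sum_lessThan_telescope)
  finally show ?thesis using assms by simp
qed

lemma integrable_uniform01_of_bool:
  "integrable (uniform_measure lborel {0<..1::real}) (\<lambda>u. complex_of_real (of_bool (real j + positive_time u \<le> t)))"
proof -
  interpret U: prob_space "uniform_measure lborel {0<..1::real}" by (rule prob_space_uniform01)
  show ?thesis by (rule U.integrable_const_bound[where B = 1]) auto
qed

section \<open>Compensated layers of jumps\<close>

text \<open>
  Layer \<open>k\<close> has jumps of law \<open>\<rho> k\<close> at rate \<open>c k\<close>. The jumps enter through \<open>max 0\<close>, so that no outcome
  produces a jump of the wrong sign.
\<close>

locale jump_layers =
  fixes c :: "nat \<Rightarrow> real" and \<rho> :: "nat \<Rightarrow> real measure"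
  assumes c_pos: "\<And>k. 0 < c k"
    and prob_\<rho>: "\<And>k. prob_space (\<rho> k)"
    and sets_\<rho>[simp, measurable_cong]: "\<And>k. sets (\<rho> k) = sets borel"
    and mean_\<rho>: "\<And>k. integrable (\<rho> k) (\<lambda>y. max 0 y)"
begin

definition \<Omega> :: "(nat \<times> nat \<Rightarrow> nat \<times> (nat \<Rightarrow> real \<times> real)) measure" where
  "\<Omega> = PiM UNIV (\<lambda>p. cell_measure (c (fst p)) (\<rho> (fst p)))"

lemma prob_\<Omega>: "prob_space \<Omega>"
  unfolding \<Omega>_def by (intro prob_space_PiM prob_space_cell prob_\<rho>)

definition cell_sum :: "nat \<Rightarrow> real \<Rightarrow> nat \<times> (nat \<Rightarrow> real \<times> real) \<Rightarrow> real" where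
  "cell_sum j s p = (\<Sum>i<fst p. if real j + positive_time (fst (snd p i)) \<le> s then max 0 (snd (snd p i)) else 0)"

text \<open>
  The blocks that begin after time \<open>s\<close> contain no point before \<open>s\<close>, so a finite sum over blocks is enough.
\<close>

definition jumps :: "nat \<Rightarrow> real \<Rightarrow> (nat \<times> nat \<Rightarrow> nat \<times> (nat \<Rightarrow> real \<times> real)) \<Rightarrow> real" where
  "jumps k s \<omega> = (\<Sum>j\<le>nat \<lfloor>s\<rfloor>. cell_sum j s (\<omega> (k, j)))"

definition mean :: "nat \<Rightarrow> real" where "mean k = c k * (\<integral>y. max 0 y \<partial>\<rho> k)"

definition layer :: "nat \<Rightarrow> real \<Rightarrow> (nat \<times> nat \<Rightarrow> nat \<times> (nat \<Rightarrow> real \<times> real)) \<Rightarrow> real" where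
  "layer k s \<omega> = mean k * s - jumps k s \<omega>"

definition partial :: "real \<Rightarrow> nat set \<Rightarrow> real \<Rightarrow> (nat \<times> nat \<Rightarrow> nat \<times> (nat \<Rightarrow> real \<times> real)) \<Rightarrow> real" where
  "partial b F s \<omega> = b * s + (\<Sum>k\<in>F. layer k s \<omega>)"

text \<open>
  The complex argument covers two uses: imaginary \<open>z\<close> determines the law of the increments, and real \<open>z\<close>
  gives the Laplace transform, where \<open>cexponent\<close> reduces to \<open>exponent\<close>.
\<close>

definition cexponent :: "nat \<Rightarrow> complex \<Rightarrow> complex" where
  "cexponent k z = of_real (c k) * ((\<integral>y. exp (- z * of_real (max 0 y)) - 1 \<partial>\<rho> k) + z * of_real (\<integral>y. max 0 y \<partial>\<rho> k))"

definition exponent :: "nat \<Rightarrow> real \<Rightarrow> real" where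
  "exponent k u = c k * (\<integral>y. exp (- u * max 0 y) - 1 + u * max 0 y \<partial>\<rho> k)"

lemma cell_sum_eq_0: "s < real j \<Longrightarrow> cell_sum j s p = 0"
  unfolding cell_sum_def
proof (rule sum.neutral, rule ballI)
  fix i assume "s < real j"
  then show "(if real j + positive_time (fst (snd p i)) \<le> s then max 0 (snd (snd p i)) else 0) = 0"
    using positive_time_pos[of "fst (snd p i)"] by auto
qed

lemma jumps_eq:
  assumes "0 \<le> s" "s \<le> real J"
  shows "jumps k s \<omega> = (\<Sum>j\<le>J. cell_sum j s (\<omega> (k, j)))"
  unfolding jumps_def
proof (rule sum.mono_neutral_left)
  show "{..nat \<lfloor>s\<rfloor>} \<subseteq> {..J}" using assms by (auto simp: nat_le_iff floor_le_iff)
  show "\<forall>i\<in>{..J} - {..nat \<lfloor>s\<rfloor>}. cell_sum i s (\<omega> (k, i)) = 0"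
    using assms by (auto intro!: cell_sum_eq_0) linarith
qed simp

lemma measurable_cell_sum[measurable]: "(\<lambda>\<omega>. cell_sum j s (\<omega> (k, j))) \<in> borel_measurable \<Omega>"
proof -
  have g: "(\<lambda>q. if real j + positive_time (fst q) \<le> s then max 0 (snd q) else 0) \<in> borel_measurable (mark_measure (\<rho> k))"
    unfolding measurable_cong_sets[OF sets_mark[OF sets_\<rho>] refl] by measurable
  have "cell_sum j s \<in> borel_measurable (cell_measure (c k) (\<rho> k))"
    unfolding cell_sum_def[abs_def]
  proof (rule measurable_cell)
    fix n :: nat
    have "(\<lambda>\<xi>. if real j + positive_time (fst (\<xi> i)) \<le> s then max 0 (snd (\<xi> i)) else 0) \<in> borel_measurable (PiM UNIV (\<lambda>_. mark_measure (\<rho> k)))"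
      for i :: nat by (rule measurable_compose[OF _ g]) simp
    then show "(\<lambda>\<xi>. \<Sum>i<fst (n, \<xi>). if real j + positive_time (fst (snd (n, \<xi>) i)) \<le> s then max 0 (snd (snd (n, \<xi>) i)) else 0)
        \<in> borel_measurable (PiM UNIV (\<lambda>_. mark_measure (\<rho> k)))"
      unfolding fst_conv snd_conv by (rule borel_measurable_sum)
  qed
  then show ?thesis unfolding \<Omega>_def
    by (intro measurable_compose[OF measurable_component_singleton]) auto
qed

lemma measurable_layer[measurable]: "layer k s \<in> borel_measurable \<Omega>"
  unfolding layer_def[abs_def] jumps_def[abs_def] by measurable

lemma measurable_partial[measurable]: "partial b F s \<in> borel_measurable \<Omega>"
  unfolding partial_def[abs_def] by measurable

text \<open>
  The intervals between consecutive times \<open>\<tau> l\<close> are disjoint, so for a given mark at most one term of the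
  exponent is nonzero. Therefore \<open>f - 1\<close> is a sum of products of a function of the time and a function
  of the jump.
\<close>

lemma mark_integral:
  fixes z :: "nat \<Rightarrow> complex" and \<tau> :: "nat \<Rightarrow> real" and j :: nat
  assumes \<tau>: "\<And>i. i < N \<Longrightarrow> \<tau> i \<le> \<tau> (Suc i)"
    and z: "\<And>l. l < N \<Longrightarrow> integrable (\<rho> k) (\<lambda>y. exp (- z l * of_real (max 0 y)))"
  defines "f \<equiv> \<lambda>q :: real \<times> real. exp (- (\<Sum>l<N. z l * of_real ((if real j + positive_time (fst q) \<le> \<tau> (Suc l) then max 0 (snd q) else 0)
        - (if real j + positive_time (fst q) \<le> \<tau> l then max 0 (snd q) else 0))))"
  shows "integrable (mark_measure (\<rho> k)) f"
    and "(\<integral>q. f q \<partial>mark_measure (\<rho> k)) = 1 +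
       (\<Sum>l<N. of_real (overlap j (\<tau> (Suc l)) - overlap j (\<tau> l)) * (\<integral>y. exp (- z l * of_real (max 0 y)) - 1 \<partial>\<rho> k))"
proof -
  interpret M: prob_space "mark_measure (\<rho> k)" by (rule prob_space_mark[OF prob_\<rho>])
  interpret R: prob_space "\<rho> k" by (rule prob_\<rho>)
  interpret U: prob_space "uniform_measure lborel {0<..1::real}" by (rule prob_space_uniform01)
  have mono: "\<tau> i \<le> \<tau> i'" if "i \<le> i'" "i' \<le> N" for i i'
    using that by (induction i' rule: dec_induct) (auto intro: order_trans[OF _ \<tau>])
  define g where "g l u = complex_of_real (of_bool (real j + positive_time u \<le> \<tau> (Suc l))) - complex_of_real (of_bool (real j + positive_time u \<le> \<tau> l))" for l u
  define h where "h l y = exp (- z l * of_real (max 0 y)) - 1" for l y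
  have f_eq: "f = (\<lambda>q. 1 + (\<Sum>l<N. g l (fst q) * h l (snd q)))"
  proof
    fix q :: "real \<times> real"
    define T where "T = real j + positive_time (fst q)"
    define y where "y = max 0 (snd q)"
    show "f q = 1 + (\<Sum>l<N. g l (fst q) * h l (snd q))"
    proof (cases "\<exists>l<N. \<tau> l < T \<and> T \<le> \<tau> (Suc l)")
      case True
      then obtain l where l: "l < N" "\<tau> l < T" "T \<le> \<tau> (Suc l)" by auto
      have off: "(T \<le> \<tau> (Suc m)) = (T \<le> \<tau> m)" if "m < N" "m \<noteq> l" for m
      proof (cases "m < l")
        case True
        then show ?thesis using mono[of m l] mono[of "Suc m" l] l by auto
      next
        case False
        then show ?thesis using mono[of "Suc l" m] mono[of m "Suc m"] l that by auto
      qed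
      have "(\<Sum>m<N. z m * of_real ((if T \<le> \<tau> (Suc m) then y else 0) - (if T \<le> \<tau> m then y else 0)))
         = (\<Sum>m<N. if m = l then z l * of_real y else 0)"
        using l by (intro sum.cong refl) (auto simp: off)
      also have "\<dots> = z l * of_real y" using l by simp
      finally have 1: "f q = exp (- (z l * of_real y))" unfolding f_def T_def y_def by simp
      have "(\<Sum>m<N. g m (fst q) * h m (snd q)) = (\<Sum>m<N. if m = l then h l (snd q) else 0)"
        using l by (intro sum.cong refl) (auto simp: g_def off T_def[symmetric])
      also have "\<dots> = h l (snd q)" using l by simp
      finally show ?thesis using 1 by (simp add: h_def y_def)
    next
      case False
      have off: "(T \<le> \<tau> (Suc m)) = (T \<le> \<tau> m)" if "m < N" for m
        using False \<tau>[OF that] that by (meson leI order_trans)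
      show ?thesis unfolding f_def g_def T_def[symmetric] by (simp add: off)
    qed
  qed
  have ig: "integrable (uniform_measure lborel {0<..1}) (g l)" for l
    unfolding g_def[abs_def] by (intro Bochner_Integration.integrable_diff integrable_uniform01_of_bool)
  have Ig: "(\<integral>u. g l u \<partial>uniform_measure lborel {0<..1}) = of_real (overlap j (\<tau> (Suc l)) - overlap j (\<tau> l))" for l
    unfolding g_def
    by (subst Bochner_Integration.integral_diff[OF integrable_uniform01_of_bool integrable_uniform01_of_bool])
       (simp only: integral_complex_of_real uniform01_le of_real_diff)
  have ih: "integrable (\<rho> k) (h l)" if "l < N" for l
    unfolding h_def[abs_def] using z[OF that] by (intro Bochner_Integration.integrable_diff) auto
  have igh: "integrable (mark_measure (\<rho> k)) (\<lambda>q. g l (fst q) * h l (snd q))" if "l < N" for l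
    by (rule integral_mark_product(1)[OF prob_\<rho> ig ih[OF that]])
  show "integrable (mark_measure (\<rho> k)) f"
    unfolding f_eq using igh by (intro Bochner_Integration.integrable_add Bochner_Integration.integrable_sum) auto
  have "(\<integral>q. f q \<partial>mark_measure (\<rho> k)) = 1 + (\<Sum>l<N. (\<integral>q. g l (fst q) * h l (snd q) \<partial>mark_measure (\<rho> k)))"
    unfolding f_eq using igh by (subst Bochner_Integration.integral_add) (auto simp: Bochner_Integration.integral_sum M.prob_space intro!: Bochner_Integration.integrable_sum)
  also have "\<dots> = 1 + (\<Sum>l<N. of_real (overlap j (\<tau> (Suc l)) - overlap j (\<tau> l)) * (\<integral>y. h l y \<partial>\<rho> k))"
    by (intro arg_cong2[where f = "(+)"] refl sum.cong)
       (use integral_mark_product(2)[OF prob_\<rho> ig ih] Ig in auto)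
  finally show "(\<integral>q. f q \<partial>mark_measure (\<rho> k)) = 1 +
       (\<Sum>l<N. of_real (overlap j (\<tau> (Suc l)) - overlap j (\<tau> l)) * (\<integral>y. exp (- z l * of_real (max 0 y)) - 1 \<partial>\<rho> k))"
    unfolding h_def .
qed

text \<open>
  The exponential of a linear combination of increments is a product over cells, so its expectation is
  a product of cell formulas. The overlaps of the successive blocks with the interval from \<open>\<tau> l\<close> to
  \<open>\<tau> (Suc l)\<close> add up to the length of that interval, which turns the product into one factor per
  increment.
\<close>

lemma partial_increments:
  fixes z :: "nat \<Rightarrow> complex" and \<tau> :: "nat \<Rightarrow> real"
  assumes \<tau>0: "0 \<le> \<tau> 0" and \<tau>: "\<And>i. i < N \<Longrightarrow> \<tau> i \<le> \<tau> (Suc i)" and F: "finite F"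
    and z: "\<And>k l. k \<in> F \<Longrightarrow> l < N \<Longrightarrow> integrable (\<rho> k) (\<lambda>y. exp (- z l * of_real (max 0 y)))"
  shows "integrable \<Omega> (\<lambda>\<omega>. exp (\<Sum>l<N. z l * of_real (partial b F (\<tau> (Suc l)) \<omega> - partial b F (\<tau> l) \<omega>)))"
    and "(\<integral>\<omega>. exp (\<Sum>l<N. z l * of_real (partial b F (\<tau> (Suc l)) \<omega> - partial b F (\<tau> l) \<omega>)) \<partial>\<Omega>)
      = (\<Prod>l<N. exp (of_real (\<tau> (Suc l) - \<tau> l) * (z l * of_real b + (\<Sum>k\<in>F. cexponent k (z l)))))"
proof -
  have mono: "\<tau> i \<le> \<tau> i'" if "i \<le> i'" "i' \<le> N" for i i'
    using that by (induction i' rule: dec_induct) (auto intro: order_trans[OF _ \<tau>])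
  have nn: "0 \<le> \<tau> i" if "i \<le> N" for i using mono[of 0 i] that \<tau>0 by simp
  obtain J :: nat where J: "\<tau> N \<le> real J" using real_arch_simple by blast
  have le: "\<tau> i \<le> real J" if "i \<le> N" for i using mono[OF that] J by simp
  define f where "f j q = exp (- (\<Sum>l<N. z l * of_real ((if real j + positive_time (fst q) \<le> \<tau> (Suc l) then max 0 (snd q) else 0)
        - (if real j + positive_time (fst q) \<le> \<tau> l then max 0 (snd q) else 0))))" for j and q :: "real \<times> real"
  define G where "G p x = (\<Prod>i<fst x. f (snd p) (snd x i))" for p :: "nat \<times> nat" and x :: "nat \<times> (nat \<Rightarrow> real \<times> real)"
  define ch where "ch k w = (\<integral>y. exp (- w * of_real (max 0 y)) - 1 \<partial>\<rho> k)" for k and w :: complex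
  have cell: "(\<Sum>l<N. z l * of_real (cell_sum j (\<tau> (Suc l)) x - cell_sum j (\<tau> l) x))
     = (\<Sum>i<fst x. \<Sum>l<N. z l * of_real ((if real j + positive_time (fst (snd x i)) \<le> \<tau> (Suc l) then max 0 (snd (snd x i)) else 0)
        - (if real j + positive_time (fst (snd x i)) \<le> \<tau> l then max 0 (snd (snd x i)) else 0)))" for j x
    unfolding cell_sum_def sum_subtractf[symmetric] of_real_sum sum_distrib_left by (rule sum.swap)
  have Gcell: "G (k, j) x = exp (- (\<Sum>l<N. z l * of_real (cell_sum j (\<tau> (Suc l)) x - cell_sum j (\<tau> l) x)))" for k j x
    unfolding G_def f_def cell by (simp add: exp_sum sum_negf[symmetric])
  define d where "d = (\<Sum>l<N. z l * of_real ((b + (\<Sum>k\<in>F. mean k)) * (\<tau> (Suc l) - \<tau> l)))"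
  have inc: "partial b F (\<tau> (Suc l)) \<omega> - partial b F (\<tau> l) \<omega> = (b + (\<Sum>k\<in>F. mean k)) * (\<tau> (Suc l) - \<tau> l)
      - (\<Sum>k\<in>F. \<Sum>j\<le>J. cell_sum j (\<tau> (Suc l)) (\<omega> (k, j)) - cell_sum j (\<tau> l) (\<omega> (k, j)))" if "l < N" for l \<omega>
    using that nn[of l] nn[of "Suc l"] le[of l] le[of "Suc l"]
    by (simp add: partial_def layer_def jumps_eq[of _ J] sum_subtractf sum_distrib_right sum_distrib_left algebra_simps)
  have expo: "exp (\<Sum>l<N. z l * of_real (partial b F (\<tau> (Suc l)) \<omega> - partial b F (\<tau> l) \<omega>))
     = exp d * (\<Prod>p\<in>F \<times> {..J}. G p (\<omega> p))" for \<omega>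
  proof -
    have "(\<Sum>l<N. z l * of_real (partial b F (\<tau> (Suc l)) \<omega> - partial b F (\<tau> l) \<omega>))
      = d - (\<Sum>l<N. \<Sum>k\<in>F. \<Sum>j\<le>J. z l * of_real (cell_sum j (\<tau> (Suc l)) (\<omega> (k, j)) - cell_sum j (\<tau> l) (\<omega> (k, j))))"
      unfolding d_def sum_subtractf[symmetric]
      by (intro sum.cong refl) (simp add: inc right_diff_distrib sum_distrib_left sum_subtractf)
    also have "\<dots> = d + (\<Sum>k\<in>F. \<Sum>j\<le>J. - (\<Sum>l<N. z l * of_real (cell_sum j (\<tau> (Suc l)) (\<omega> (k, j)) - cell_sum j (\<tau> l) (\<omega> (k, j)))))"
      by (simp add: sum_negf sum.swap[of _ "{..<N}" F] sum.swap[of _ "{..<N}" "{..J}"])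
    also have "exp \<dots> = exp d * (\<Prod>k\<in>F. \<Prod>j\<le>J. G (k, j) (\<omega> (k, j)))"
      using F by (simp add: exp_add exp_sum Gcell)
    finally show ?thesis by (simp add: prod.cartesian_product)
  qed
  have fi: "integrable (mark_measure (\<rho> k)) (f j)" if "k \<in> F" for k j
    unfolding f_def by (rule mark_integral(1)) (use \<tau> z[OF that] in auto)
  have fI: "(\<integral>q. f j q \<partial>mark_measure (\<rho> k)) - 1 = (\<Sum>l<N. of_real (overlap j (\<tau> (Suc l)) - overlap j (\<tau> l)) * ch k (z l))"
    if "k \<in> F" for k j
    unfolding f_def ch_def by (subst mark_integral(2)) (use \<tau> z[OF that] in auto)
  have Gi: "integrable (cell_measure (c (fst p)) (\<rho> (fst p))) (G p)" if "p \<in> F \<times> {..J}" for p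
    unfolding G_def by (rule cell_exponential_formula(1)) (use that fi prob_\<rho> c_pos in auto)
  have GI: "(\<integral>x. G p x \<partial>cell_measure (c (fst p)) (\<rho> (fst p)))
     = exp (of_real (c (fst p)) * (\<Sum>l<N. of_real (overlap (snd p) (\<tau> (Suc l)) - overlap (snd p) (\<tau> l)) * ch (fst p) (z l)))"
    if "p \<in> F \<times> {..J}" for p
    unfolding G_def by (subst cell_exponential_formula(2)) (use that fi prob_\<rho> c_pos fI in auto)
  have i1: "integrable \<Omega> (\<lambda>\<omega>. \<Prod>p\<in>F \<times> {..J}. G p (\<omega> p))"
    unfolding \<Omega>_def by (rule integral_prod_coordinates(1)) (use F Gi prob_\<rho> in \<open>auto intro: prob_space_cell\<close>)
  then show "integrable \<Omega> (\<lambda>\<omega>. exp (\<Sum>l<N. z l * of_real (partial b F (\<tau> (Suc l)) \<omega> - partial b F (\<tau> l) \<omega>)))"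
    unfolding expo by simp
  have "(\<integral>\<omega>. exp (\<Sum>l<N. z l * of_real (partial b F (\<tau> (Suc l)) \<omega> - partial b F (\<tau> l) \<omega>)) \<partial>\<Omega>)
     = exp d * (\<integral>\<omega>. (\<Prod>p\<in>F \<times> {..J}. G p (\<omega> p)) \<partial>\<Omega>)"
    unfolding expo by simp
  also have "(\<integral>\<omega>. (\<Prod>p\<in>F \<times> {..J}. G p (\<omega> p)) \<partial>\<Omega>) = (\<Prod>p\<in>F \<times> {..J}. \<integral>x. G p x \<partial>cell_measure (c (fst p)) (\<rho> (fst p)))"
    unfolding \<Omega>_def by (rule integral_prod_coordinates(2)) (use F Gi prob_\<rho> in \<open>auto intro: prob_space_cell\<close>)
  also have "\<dots> = (\<Prod>p\<in>F \<times> {..J}. exp (of_real (c (fst p)) * (\<Sum>l<N. of_real (overlap (snd p) (\<tau> (Suc l)) - overlap (snd p) (\<tau> l)) * ch (fst p) (z l))))"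
    by (rule prod.cong[OF refl GI])
  also have "\<dots> = exp (\<Sum>k\<in>F. \<Sum>j\<le>J. of_real (c k) * (\<Sum>l<N. of_real (overlap j (\<tau> (Suc l)) - overlap j (\<tau> l)) * ch k (z l)))"
    using F by (simp add: exp_sum prod.cartesian_product case_prod_beta)
  also have "(\<Sum>k\<in>F. \<Sum>j\<le>J. of_real (c k) * (\<Sum>l<N. of_real (overlap j (\<tau> (Suc l)) - overlap j (\<tau> l)) * ch k (z l)))
     = (\<Sum>k\<in>F. \<Sum>l<N. of_real (c k) * of_real (\<tau> (Suc l) - \<tau> l) * ch k (z l))"
  proof (rule sum.cong[OF refl])
    fix k
    have "(\<Sum>j\<le>J. of_real (c k) * (\<Sum>l<N. of_real (overlap j (\<tau> (Suc l)) - overlap j (\<tau> l)) * ch k (z l)))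
      = (\<Sum>l<N. of_real (c k) * of_real (\<Sum>j\<le>J. overlap j (\<tau> (Suc l)) - overlap j (\<tau> l)) * ch k (z l))"
      unfolding sum_distrib_left of_real_sum sum_distrib_right by (subst sum.swap) (simp add: mult.assoc)
    also have "\<dots> = (\<Sum>l<N. of_real (c k) * of_real (\<tau> (Suc l) - \<tau> l) * ch k (z l))"
    proof (rule sum.cong[OF refl])
      fix l assume "l \<in> {..<N}"
      then have "(\<Sum>j\<le>J. overlap j (\<tau> (Suc l)) - overlap j (\<tau> l)) = \<tau> (Suc l) - \<tau> l"
        using nn[of l] nn[of "Suc l"] le[of l] le[of "Suc l"] by (simp add: sum_subtractf sum_overlap)
      then show "of_real (c k) * of_real (\<Sum>j\<le>J. overlap j (\<tau> (Suc l)) - overlap j (\<tau> l)) * ch k (z l)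
          = of_real (c k) * of_real (\<tau> (Suc l) - \<tau> l) * ch k (z l)" by simp
    qed
    finally show "(\<Sum>j\<le>J. of_real (c k) * (\<Sum>l<N. of_real (overlap j (\<tau> (Suc l)) - overlap j (\<tau> l)) * ch k (z l)))
      = (\<Sum>l<N. of_real (c k) * of_real (\<tau> (Suc l) - \<tau> l) * ch k (z l))" .
  qed
  also have "exp d * exp (\<Sum>k\<in>F. \<Sum>l<N. of_real (c k) * of_real (\<tau> (Suc l) - \<tau> l) * ch k (z l))
     = exp (\<Sum>l<N. of_real (\<tau> (Suc l) - \<tau> l) * (z l * of_real b + (\<Sum>k\<in>F. cexponent k (z l))))"
  proof -
    have "d + (\<Sum>k\<in>F. \<Sum>l<N. of_real (c k) * of_real (\<tau> (Suc l) - \<tau> l) * ch k (z l))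
      = (\<Sum>l<N. of_real (\<tau> (Suc l) - \<tau> l) * (z l * of_real b + (\<Sum>k\<in>F. cexponent k (z l))))"
      unfolding d_def sum.swap[of "\<lambda>k l. of_real (c k) * of_real (\<tau> (Suc l) - \<tau> l) * ch k (z l)" "{..<N}" F] sum.distrib[symmetric]
    proof (intro sum.cong refl)
      fix l
      have "cexponent k (z l) = of_real (c k) * ch k (z l) + z l * of_real (mean k)" for k
        by (simp add: cexponent_def mean_def ch_def algebra_simps)
      then show "z l * of_real ((b + (\<Sum>k\<in>F. mean k)) * (\<tau> (Suc l) - \<tau> l)) + (\<Sum>k\<in>F. of_real (c k) * of_real (\<tau> (Suc l) - \<tau> l) * ch k (z l))
         = of_real (\<tau> (Suc l) - \<tau> l) * (z l * of_real b + (\<Sum>k\<in>F. cexponent k (z l)))"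
        by (simp only: sum.distrib of_real_mult of_real_add of_real_sum distrib_left distrib_right sum_distrib_left sum_distrib_right) (simp add: mult_ac)
    qed
    then show ?thesis by (simp only: exp_add[symmetric])
  qed
  finally show "(\<integral>\<omega>. exp (\<Sum>l<N. z l * of_real (partial b F (\<tau> (Suc l)) \<omega> - partial b F (\<tau> l) \<omega>)) \<partial>\<Omega>)
      = (\<Prod>l<N. exp (of_real (\<tau> (Suc l) - \<tau> l) * (z l * of_real b + (\<Sum>k\<in>F. cexponent k (z l)))))"
    by (simp add: exp_sum)
qed

end

section \<open>Summing the layers\<close>

text \<open>
  Regularity of paths in the form that passes through locally uniform limits: the absence of upward
  jumps appears as an inequality between a value and the left limit.
\<close>

definition cadlag_down :: "(real \<Rightarrow> real) \<Rightarrow> bool" where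
  "cadlag_down x \<longleftrightarrow>
     (\<forall>s\<ge>0. (x \<longlongrightarrow> x s) (at_right s)) \<and>
     (\<forall>s>0. \<exists>l\<ge>x s. (x \<longlongrightarrow> l) (at_left s))"

lemma cadlag_down_imp_cadlag: "cadlag_down x \<Longrightarrow> cadlag x"
  unfolding cadlag_down_def cadlag_def by blast

lemma cadlag_down_imp_jump: "cadlag_down x \<Longrightarrow> 0 < s \<Longrightarrow> jump x s \<le> 0"
  unfolding cadlag_down_def jump_def by (auto simp: tendsto_Lim)

lemma cadlag_down_add:
  assumes "cadlag_down x" "cadlag_down y"
  shows "cadlag_down (\<lambda>s. x s + y s)"
  unfolding cadlag_down_def
proof (intro conjI allI impI)
  fix s :: real assume "0 \<le> s"
  then show "((\<lambda>s. x s + y s) \<longlongrightarrow> x s + y s) (at_right s)"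
    using assms unfolding cadlag_down_def by (intro tendsto_add) auto
next
  fix s :: real assume "0 < s"
  then obtain l l' where "l \<ge> x s" "(x \<longlongrightarrow> l) (at_left s)" "l' \<ge> y s" "(y \<longlongrightarrow> l') (at_left s)"
    using assms unfolding cadlag_down_def by metis
  then show "\<exists>l\<ge>x s + y s. ((\<lambda>s. x s + y s) \<longlongrightarrow> l) (at_left s)"
    by (intro exI[of _ "l + l'"]) (auto intro!: tendsto_add)
qed

lemma cadlag_down_continuous: "continuous_on UNIV x \<Longrightarrow> cadlag_down x"
  unfolding cadlag_down_def
  by (metis continuous_on_eq_continuous_at filterlim_at_split isCont_def open_UNIV order_refl UNIV_I)

lemma cadlag_down_sum:
  "(\<And>i. i \<in> I \<Longrightarrow> cadlag_down (x i)) \<Longrightarrow> cadlag_down (\<lambda>s. \<Sum>i\<in>I. x i s)"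
  by (induction I rule: infinite_finite_induct) (auto intro: cadlag_down_add cadlag_down_continuous)

lemma cadlag_down_step:
  assumes "0 \<le> b"
  shows "cadlag_down (\<lambda>s. - (if a \<le> s then b else 0))"
  unfolding cadlag_down_def
proof (intro conjI allI impI)
  fix s :: real
  have "eventually (\<lambda>r. - (if a \<le> s then b else 0) = - (if a \<le> r then b else 0)) (at_right s)"
  proof (cases "a \<le> s")
    case True
    then show ?thesis by (intro eventually_at_rightI[of s "s + 1"]) auto
  next
    case False
    then show ?thesis by (intro eventually_at_rightI[of s a]) auto
  qed
  then show "((\<lambda>s. - (if a \<le> s then b else 0)) \<longlongrightarrow> - (if a \<le> s then b else 0)) (at_right s)"
    by (rule Lim_transform_eventually[OF tendsto_const])
next
  fix s :: real
  have "eventually (\<lambda>r. - (if a < s then b else 0) = - (if a \<le> r then b else 0)) (at_left s)"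
  proof (cases "a < s")
    case True
    then show ?thesis by (intro eventually_at_leftI[of a s]) auto
  next
    case False
    then show ?thesis by (intro eventually_at_leftI[of "s - 1" s]) auto
  qed
  then have "((\<lambda>s. - (if a \<le> s then b else 0)) \<longlongrightarrow> - (if a < s then b else 0)) (at_left s)"
    by (rule Lim_transform_eventually[OF tendsto_const])
  then show "\<exists>l\<ge>- (if a \<le> s then b else 0). ((\<lambda>s. - (if a \<le> s then b else 0)) \<longlongrightarrow> l) (at_left s)"
    using assms by (intro exI[of _ "- (if a < s then b else 0)"]) auto
qed

lemma cadlag_down_local:
  assumes "\<And>J :: nat. \<exists>y. cadlag_down y \<and> (\<forall>s. 0 \<le> s \<longrightarrow> s \<le> real J \<longrightarrow> x s = y s)"
  shows "cadlag_down x"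
  unfolding cadlag_down_def
proof (intro conjI allI impI)
  fix s :: real assume s: "0 \<le> s"
  obtain J :: nat where J: "s < real J" using reals_Archimedean2 by blast
  obtain y where y: "cadlag_down y" "\<And>s. 0 \<le> s \<Longrightarrow> s \<le> real J \<Longrightarrow> x s = y s" using assms[of J] by blast
  have "eventually (\<lambda>r. y r = x r) (at_right s)"
    using s J y(2) by (intro eventually_at_rightI[of s "real J"]) auto
  moreover have "(y \<longlongrightarrow> x s) (at_right s)" using y s J unfolding cadlag_down_def by auto
  ultimately show "(x \<longlongrightarrow> x s) (at_right s)" by (rule Lim_transform_eventually[rotated])
next
  fix s :: real assume s: "0 < s"
  obtain J :: nat where J: "s < real J" using reals_Archimedean2 by blast
  obtain y where y: "cadlag_down y" "\<And>s. 0 \<le> s \<Longrightarrow> s \<le> real J \<Longrightarrow> x s = y s" using assms[of J] by blast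
  have ev: "eventually (\<lambda>r. y r = x r) (at_left s)"
    using s J y(2) by (intro eventually_at_leftI[of 0 s]) auto
  obtain l where l: "l \<ge> y s" "(y \<longlongrightarrow> l) (at_left s)" using y s unfolding cadlag_down_def by auto
  have "x s = y s" using y(2) s J by auto
  then show "\<exists>l\<ge>x s. (x \<longlongrightarrow> l) (at_left s)"
    using l Lim_transform_eventually[OF l(2) ev] by (intro exI[of _ l]) auto
qed

text \<open>
  Uniformity allows the interchange of limits. The left limits of the approximations form a Cauchy
  sequence, and its limit is the left limit of \<open>x\<close>.
\<close>

lemma cadlag_down_uniform_limit:
  assumes f: "\<And>n :: nat. cadlag_down (f n)" and ul: "\<And>J :: nat. uniform_limit {0..real J} f x sequentially"
  shows "cadlag_down x"
  unfolding cadlag_down_def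
proof (intro conjI allI impI)
  fix s :: real assume s: "0 \<le> s"
  obtain J :: nat where J: "s < real J" using reals_Archimedean2 by blast
  show "(x \<longlongrightarrow> x s) (at_right s)"
  proof (rule swap_uniform_limit'[OF _ _ ul[of J]])
    show "\<forall>\<^sub>F n in sequentially. (f n \<longlongrightarrow> f n s) (at_right s)"
      using f s unfolding cadlag_down_def by auto
    show "(\<lambda>n. f n s) \<longlonglongrightarrow> x s" using tendsto_uniform_limitI[OF ul[of J], of s] s J by auto
    show "\<forall>\<^sub>F r in at_right s. r \<in> {0..real J}" using s J by (intro eventually_at_rightI[of s "real J"]) auto
  qed simp
next
  fix s :: real assume s: "0 < s"
  obtain J :: nat where J: "s < real J" using reals_Archimedean2 by blast
  have "\<forall>n. \<exists>l. l \<ge> f n s \<and> (f n \<longlongrightarrow> l) (at_left s)"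
    using f s unfolding cadlag_down_def by blast
  from choice[OF this] have "\<exists>l. \<forall>n. l n \<ge> f n s \<and> (f n \<longlongrightarrow> l n) (at_left s)" .
  then obtain l where l: "\<And>n. l n \<ge> f n s" "\<And>n. (f n \<longlongrightarrow> l n) (at_left s)" by blast
  have ev: "\<forall>\<^sub>F r in at_left s. r \<in> {0..real J}" using s J by (intro eventually_at_leftI[of 0 s]) auto
  have "uniformly_convergent_on {0..real J} f" using ul[of J] unfolding uniformly_convergent_on_def by blast
  then have uc: "uniformly_Cauchy_on {0..real J} f" by (rule uniformly_convergent_Cauchy)
  have "Cauchy l"
  proof (rule metric_CauchyI)
    fix e :: real assume e: "0 < e"
    then obtain K where K: "\<And>r m n. r \<in> {0..real J} \<Longrightarrow> m \<ge> K \<Longrightarrow> n \<ge> K \<Longrightarrow> dist (f m r) (f n r) < e / 2"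
      using uc unfolding uniformly_Cauchy_on_def by (metis half_gt_zero)
    have "dist (l m) (l n) \<le> e / 2" if "m \<ge> K" "n \<ge> K" for m n
    proof (rule tendsto_upperbound[of "\<lambda>r. dist (f m r) (f n r)" _ "at_left s"])
      show "((\<lambda>r. dist (f m r) (f n r)) \<longlongrightarrow> dist (l m) (l n)) (at_left s)" by (intro tendsto_dist l)
      show "\<forall>\<^sub>F r in at_left s. dist (f m r) (f n r) \<le> e / 2"
        using ev by eventually_elim (use K that in \<open>auto intro: less_imp_le\<close>)
    qed simp
    then show "\<exists>K. \<forall>m\<ge>K. \<forall>n\<ge>K. dist (l m) (l n) < e" using e by (intro exI[of _ K]) force
  qed
  then obtain L where L: "l \<longlonglongrightarrow> L" by (metis Cauchy_convergent convergent_def)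
  have "(x \<longlongrightarrow> L) (at_left s)"
    by (rule swap_uniform_limit'[OF _ L ul[of J] ev]) (use l in auto)
  moreover have "x s \<le> L"
  proof (rule LIMSEQ_le[OF _ L])
    show "(\<lambda>n. f n s) \<longlonglongrightarrow> x s" using tendsto_uniform_limitI[OF ul[of J], of s] s J by auto
    show "\<exists>N. \<forall>n\<ge>N. f n s \<le> l n" using l by auto
  qed
  ultimately show "\<exists>l\<ge>x s. (x \<longlongrightarrow> l) (at_left s)" by blast
qed

context jump_layers
begin

lemma partial_0: "partial b F 0 \<omega> = 0"
proof -
  have "cell_sum 0 0 p = 0" for p
    unfolding cell_sum_def
  proof (rule sum.neutral, rule ballI)
    fix i show "(if real 0 + positive_time (fst (snd p i)) \<le> 0 then max 0 (snd (snd p i)) else 0) = 0"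
      using positive_time_pos[of "fst (snd p i)"] by auto
  qed
  then show ?thesis by (simp add: partial_def layer_def jumps_def)
qed

lemma layer_cadlag_down: "cadlag_down (\<lambda>s. layer k s \<omega>)"
proof (rule cadlag_down_local)
  fix J :: nat
  define y where "y s = mean k * s + (\<Sum>j\<le>J. \<Sum>i<fst (\<omega> (k, j)).
     - (if real j + positive_time (fst (snd (\<omega> (k, j)) i)) \<le> s then max 0 (snd (snd (\<omega> (k, j)) i)) else 0))" for s
  have "cadlag_down y"
    unfolding y_def[abs_def]
    by (intro cadlag_down_add cadlag_down_sum cadlag_down_step cadlag_down_continuous continuous_intros) auto
  moreover have "layer k s \<omega> = y s" if "0 \<le> s" "s \<le> real J" for s
    unfolding y_def layer_def jumps_eq[OF that] cell_sum_def by (simp add: sum_negf)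
  ultimately show "\<exists>y. cadlag_down y \<and> (\<forall>s. 0 \<le> s \<longrightarrow> s \<le> real J \<longrightarrow> layer k s \<omega> = y s)" by blast
qed

lemma partial_cadlag_down: "cadlag_down (\<lambda>s. partial b F s \<omega>)"
  unfolding partial_def
  by (intro cadlag_down_add cadlag_down_sum layer_cadlag_down cadlag_down_continuous continuous_intros)

lemma integrable_iexp_neg: "integrable (\<rho> k) (\<lambda>y. exp (- (\<i> * of_real \<theta>) * of_real (max 0 y)))"
proof -
  interpret prob_space "\<rho> k" by (rule prob_\<rho>)
  have *: "- (\<i> * complex_of_real \<theta>) * of_real (max 0 y) = \<i> * of_real (- \<theta> * max 0 y)" for y :: real by simp
  show ?thesis unfolding * by (rule integrable_const_bound[where B = 1]) auto
qed

lemma partial_char_increment: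
  assumes F: "finite F" and "0 \<le> s" "0 \<le> h"
  shows "(\<integral>\<omega>. iexp (\<theta> * (partial b F (s + h) \<omega> - partial b F s \<omega>)) \<partial>\<Omega>)
     = exp (of_real h * (\<i> * of_real \<theta> * of_real b + (\<Sum>k\<in>F. cexponent k (\<i> * of_real \<theta>))))"
  using partial_increments(2)[of "\<lambda>i. if i = 0 then s else s + h" "Suc 0" F "\<lambda>_. \<i> * of_real \<theta>" b] assms integrable_iexp_neg
  by (simp add: lessThan_Suc mult.assoc)

lemma partial_levy:
  assumes F: "finite F"
  shows "levy_process \<Omega> (partial b F)"
proof (intro levy_process.intro levy_process_axioms.intro)
  interpret prob_space \<Omega> by (rule prob_\<Omega>)
  show "prob_space \<Omega>" by (rule prob_\<Omega>)
  show "partial b F s \<in> borel_measurable \<Omega>" for s by (rule measurable_partial)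
  show "partial b F 0 \<omega> = 0" for \<omega> by (rule partial_0)
  show "cadlag (\<lambda>s. partial b F s \<omega>)" for \<omega> by (rule cadlag_down_imp_cadlag[OF partial_cadlag_down])
  show "prob_space.indep_vars \<Omega> (\<lambda>_. borel) (\<lambda>i \<omega>. partial b F (\<tau> (Suc i)) \<omega> - partial b F (\<tau> i) \<omega>) {..<N}"
    if \<tau>0: "0 \<le> \<tau> 0" and \<tau>: "\<And>i. i < N \<Longrightarrow> \<tau> i \<le> \<tau> (Suc i)" for \<tau> :: "nat \<Rightarrow> real" and N
  proof (rule indep_vars_of_char)
    fix \<theta> :: "nat \<Rightarrow> real"
    have \<tau>_nn: "0 \<le> \<tau> i" if "i \<le> N" for i using that
      by (induction i) (auto intro: \<tau>0 order_trans[OF _ \<tau>])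
    have "(\<integral>\<omega>. (\<Prod>i<N. iexp (\<theta> i * (partial b F (\<tau> (Suc i)) \<omega> - partial b F (\<tau> i) \<omega>))) \<partial>\<Omega>)
       = (\<integral>\<omega>. exp (\<Sum>i<N. (\<i> * of_real (\<theta> i)) * of_real (partial b F (\<tau> (Suc i)) \<omega> - partial b F (\<tau> i) \<omega>)) \<partial>\<Omega>)"
      by (simp add: exp_sum mult.assoc)
    also have "\<dots> = (\<Prod>l<N. exp (of_real (\<tau> (Suc l) - \<tau> l) * (\<i> * of_real (\<theta> l) * of_real b + (\<Sum>k\<in>F. cexponent k (\<i> * of_real (\<theta> l))))))"
      by (rule partial_increments(2)) (use \<tau>0 \<tau> F integrable_iexp_neg in auto)
    also have "\<dots> = (\<Prod>i<N. \<integral>\<omega>. iexp (\<theta> i * (partial b F (\<tau> (Suc i)) \<omega> - partial b F (\<tau> i) \<omega>)) \<partial>\<Omega>)"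
    proof (rule prod.cong[OF refl])
      fix l assume "l \<in> {..<N}"
      then show "exp (of_real (\<tau> (Suc l) - \<tau> l) * (\<i> * of_real (\<theta> l) * of_real b + (\<Sum>k\<in>F. cexponent k (\<i> * of_real (\<theta> l)))))
         = (\<integral>\<omega>. iexp (\<theta> l * (partial b F (\<tau> (Suc l)) \<omega> - partial b F (\<tau> l) \<omega>)) \<partial>\<Omega>)"
        using partial_char_increment[OF F, of "\<tau> l" "\<tau> (Suc l) - \<tau> l" "\<theta> l" b] \<tau>[of l] \<tau>_nn[of l] by simp
    qed
    finally show "(\<integral>\<omega>. (\<Prod>i<N. iexp (\<theta> i * (partial b F (\<tau> (Suc i)) \<omega> - partial b F (\<tau> i) \<omega>))) \<partial>\<Omega>)
      = (\<Prod>i<N. \<integral>\<omega>. iexp (\<theta> i * (partial b F (\<tau> (Suc i)) \<omega> - partial b F (\<tau> i) \<omega>)) \<partial>\<Omega>)" .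
  qed auto
  show "distr \<Omega> borel (\<lambda>\<omega>. partial b F (s + h) \<omega> - partial b F s \<omega>) = distr \<Omega> borel (partial b F h)"
    if sh: "0 \<le> s" "0 \<le> h" for s h
  proof (rule Levy_uniqueness)
    show "char (distr \<Omega> borel (\<lambda>\<omega>. partial b F (s + h) \<omega> - partial b F s \<omega>)) = char (distr \<Omega> borel (partial b F h))"
    proof
      fix \<theta>
      show "char (distr \<Omega> borel (\<lambda>\<omega>. partial b F (s + h) \<omega> - partial b F s \<omega>)) \<theta> = char (distr \<Omega> borel (partial b F h)) \<theta>"
        using partial_char_increment[OF F sh] partial_char_increment[OF F order_refl sh(2)]
        unfolding char_def by (subst (1 2) integral_distr) (auto simp: partial_0)
    qed
  qed auto
qed

lemma cexponent_of_real:
  assumes "integrable (\<rho> k) (\<lambda>y. exp (- u * max 0 y))"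
  shows "cexponent k (of_real u) = of_real (exponent k u)"
proof -
  interpret prob_space "\<rho> k" by (rule prob_\<rho>)
  have i: "integrable (\<rho> k) (\<lambda>y. exp (- u * max 0 y) - 1)" using assms by simp
  have e: "exp (- complex_of_real u * of_real (max 0 y)) - 1 = of_real (exp (- u * max 0 y) - 1)" for y
    using exp_of_real[of "- u * max 0 y", where 'a = complex] by simp
  have "(\<integral>y. exp (- u * max 0 y) - 1 + u * max 0 y \<partial>\<rho> k) = (\<integral>y. exp (- u * max 0 y) - 1 \<partial>\<rho> k) + u * (\<integral>y. max 0 y \<partial>\<rho> k)"
    using i mean_\<rho>[of k] by (subst Bochner_Integration.integral_add) auto
  then show ?thesis unfolding cexponent_def exponent_def e integral_complex_of_real by simp
qed

lemma partial_mgf: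
  assumes F: "finite F" and s: "0 \<le> s" and u: "\<And>k. k \<in> F \<Longrightarrow> integrable (\<rho> k) (\<lambda>y. exp (- u * max 0 y))"
  shows "(\<integral>\<^sup>+\<omega>. ennreal (exp (u * partial b F s \<omega>)) \<partial>\<Omega>) = ennreal (exp (s * (u * b + (\<Sum>k\<in>F. exponent k u))))"
proof -
  have e: "exp (- complex_of_real u * of_real (max 0 y)) = of_real (exp (- u * max 0 y))" for y
    using exp_of_real[of "- u * max 0 y", where 'a = complex] by simp
  have z: "integrable (\<rho> k) (\<lambda>y. exp (- complex_of_real u * of_real (max 0 y)))" if "k \<in> F" for k
    unfolding e using u[OF that] by (rule integrable_of_real)
  have e2: "exp (complex_of_real u * of_real r) = of_real (exp (u * r))" for r
    using exp_of_real[of "u * r", where 'a = complex] by simp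
  have I: "integrable \<Omega> (\<lambda>\<omega>. complex_of_real (exp (u * partial b F s \<omega>)))"
    using partial_increments(1)[of "\<lambda>i. if i = 0 then 0 else s" "Suc 0" F "\<lambda>_. of_real u" b] s F z
    by (simp add: lessThan_Suc partial_0 e2)
  have "complex_of_real (\<integral>\<omega>. exp (u * partial b F s \<omega>) \<partial>\<Omega>) = exp (of_real s * (of_real u * of_real b + (\<Sum>k\<in>F. cexponent k (of_real u))))"
    using partial_increments(2)[of "\<lambda>i. if i = 0 then 0 else s" "Suc 0" F "\<lambda>_. of_real u" b] s F z
    by (simp add: lessThan_Suc partial_0 e2)
  also have "(\<Sum>k\<in>F. cexponent k (of_real u)) = of_real (\<Sum>k\<in>F. exponent k u)"
    unfolding of_real_sum by (intro sum.cong refl cexponent_of_real u)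
  also have "exp (of_real s * (of_real u * of_real b + complex_of_real (\<Sum>k\<in>F. exponent k u))) = of_real (exp (s * (u * b + (\<Sum>k\<in>F. exponent k u))))"
    by (simp only: of_real_mult[symmetric] of_real_add[symmetric] exp_of_real)
  finally have "(\<integral>\<omega>. exp (u * partial b F s \<omega>) \<partial>\<Omega>) = exp (s * (u * b + (\<Sum>k\<in>F. exponent k u)))"
    by (simp only: of_real_eq_iff)
  then show ?thesis
    using integrable_Re[OF I] nn_integral_eq_integral[of \<Omega> "\<lambda>\<omega>. exp (u * partial b F s \<omega>)"] by simp
qed

lemma exponent_nonneg: "0 \<le> exponent k u"
proof -
  have "0 \<le> exp (- u * max 0 y) - 1 + u * max 0 y" for y
    using exp_ge_add_one_self[of "- u * max 0 y"] by linarith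
  then show ?thesis
    unfolding exponent_def using c_pos[of k] by (intro mult_nonneg_nonneg integral_nonneg_AE AE_I2) auto
qed

lemma integrable_exp_neg: "0 \<le> u \<Longrightarrow> integrable (\<rho> k) (\<lambda>y. exp (- u * max 0 y))"
proof -
  interpret prob_space "\<rho> k" by (rule prob_\<rho>)
  assume "0 \<le> u" then show ?thesis by (intro integrable_const_bound[where B = 1]) auto
qed

text \<open>
  The maximal inequality is applied with slopes \<open>4 ^ k\<close> and \<open>- (4 ^ k)\<close> at level \<open>2 ^ k\<close>. Since the exponents are
  at most 1 there, the supremum over times up to \<open>J\<close> exceeds \<open>(1/2) ^ k\<close> with probability at most
  \<open>2 exp (J - 2 ^ k)\<close>, which is summable.
\<close>

lemma layer_uniformly_small:
  assumes int: "\<And>k. 0 < k \<Longrightarrow> integrable (\<rho> k) (\<lambda>y. exp (4 ^ k * max 0 y))"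
    and small: "\<And>k. 0 < k \<Longrightarrow> exponent k (4 ^ k) \<le> 1" "\<And>k. 0 < k \<Longrightarrow> exponent k (- (4 ^ k)) \<le> 1"
  shows "AE \<omega> in \<Omega>. \<forall>J :: nat. \<forall>\<^sub>F k in sequentially. \<forall>s\<in>{0..real J}. \<bar>layer k s \<omega>\<bar> \<le> (1/2) ^ k"
proof -
  interpret prob_space \<Omega> by (rule prob_\<Omega>)
  have "AE \<omega> in \<Omega>. \<forall>\<^sub>F k in sequentially. \<forall>s\<in>{0..real J}. \<bar>layer k s \<omega>\<bar> \<le> (1/2) ^ k" for J :: nat
  proof -
    have one: "\<exists>A\<in>sets \<Omega>. emeasure \<Omega> A \<le> ennreal (exp (real J - 2 ^ k)) \<and> (\<forall>\<omega>\<in>space \<Omega> - A. \<forall>s\<in>{0..real J}. u * layer k s \<omega> \<le> 2 ^ k)"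
      if k: "0 < k" and u: "integrable (\<rho> k) (\<lambda>y. exp (- u * max 0 y))" "exponent k u \<le> 1" for k u
    proof -
      interpret L: levy_process \<Omega> "partial 0 {k}" by (rule partial_levy) simp
      have "\<exists>A\<in>sets \<Omega>. emeasure \<Omega> A \<le> ennreal (exp (real J * exponent k u - 2 ^ k)) \<and>
         (\<forall>\<omega>\<in>space \<Omega> - A. \<forall>s\<in>{0..real J}. u * partial 0 {k} s \<omega> \<le> 2 ^ k)"
        by (rule L.maximal_inequality) (use u exponent_nonneg in \<open>auto simp: partial_mgf[where F = "{k}" and b = 0, simplified]\<close>)
      moreover have "ennreal (exp (real J * exponent k u - 2 ^ k)) \<le> ennreal (exp (real J - 2 ^ k))"
        using u(2) mult_left_mono[of "exponent k u" 1 "real J"] by (intro ennreal_leI) simp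
      ultimately show ?thesis
        by (elim bexE, intro bexI) (auto simp: partial_def simp del: ennreal_le_iff exp_le_cancel_iff elim: order_trans)
    qed
    have "\<exists>A. \<forall>k. A k \<in> sets \<Omega> \<and> (0 < k \<longrightarrow> emeasure \<Omega> (A k) \<le> ennreal (2 * exp (real J - 2 ^ k)) \<and>
        (\<forall>\<omega>\<in>space \<Omega> - A k. \<forall>s\<in>{0..real J}. \<bar>layer k s \<omega>\<bar> \<le> (1/2) ^ k))"
    proof (rule choice, rule allI)
      fix k
      show "\<exists>A. A \<in> sets \<Omega> \<and> (0 < k \<longrightarrow> emeasure \<Omega> A \<le> ennreal (2 * exp (real J - 2 ^ k)) \<and>
        (\<forall>\<omega>\<in>space \<Omega> - A. \<forall>s\<in>{0..real J}. \<bar>layer k s \<omega>\<bar> \<le> (1/2) ^ k))"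
      proof (cases "0 < k")
        case True
        obtain A where A: "A \<in> sets \<Omega>" "emeasure \<Omega> A \<le> ennreal (exp (real J - 2 ^ k))"
          "\<forall>\<omega>\<in>space \<Omega> - A. \<forall>s\<in>{0..real J}. 4 ^ k * layer k s \<omega> \<le> 2 ^ k"
          using one[OF True integrable_exp_neg small(1)[OF True]] by auto
        obtain B where B: "B \<in> sets \<Omega>" "emeasure \<Omega> B \<le> ennreal (exp (real J - 2 ^ k))"
          "\<forall>\<omega>\<in>space \<Omega> - B. \<forall>s\<in>{0..real J}. - (4 ^ k) * layer k s \<omega> \<le> 2 ^ k"
          using one[OF True _ small(2)[OF True]] int[OF True] by auto
        have "emeasure \<Omega> (A \<union> B) \<le> emeasure \<Omega> A + emeasure \<Omega> B" using A B by (intro emeasure_subadditive) auto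
        also have "\<dots> \<le> ennreal (exp (real J - 2 ^ k)) + ennreal (exp (real J - 2 ^ k))" by (intro add_mono A B)
        also have "\<dots> = ennreal (2 * exp (real J - 2 ^ k))" by (simp flip: ennreal_plus)
        finally have AB: "emeasure \<Omega> (A \<union> B) \<le> ennreal (2 * exp (real J - 2 ^ k))" .
        have "\<bar>layer k s \<omega>\<bar> \<le> (1/2) ^ k" if "\<omega> \<in> space \<Omega> - (A \<union> B)" "s \<in> {0..real J}" for \<omega> s
        proof -
          have "4 ^ k * layer k s \<omega> \<le> 2 ^ k" "4 ^ k * (- layer k s \<omega>) \<le> 2 ^ k" using A(3) B(3) that by auto
          then have "4 ^ k * \<bar>layer k s \<omega>\<bar> \<le> 2 ^ k" by (auto simp: abs_if)
          moreover have "(4 :: real) ^ k = 2 ^ k * 2 ^ k" by (simp flip: power_mult_distrib)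
          ultimately show ?thesis by (simp add: field_simps power_divide)
        qed
        then show ?thesis using A B AB by (intro exI[of _ "A \<union> B"]) auto
      qed (auto intro: exI[of _ "{}"])
    qed
    then obtain A where A: "\<And>k. A k \<in> sets \<Omega>" "\<And>k. 0 < k \<Longrightarrow> emeasure \<Omega> (A k) \<le> ennreal (2 * exp (real J - 2 ^ k))"
       "\<And>k \<omega> s. 0 < k \<Longrightarrow> \<omega> \<in> space \<Omega> - A k \<Longrightarrow> s \<in> {0..real J} \<Longrightarrow> \<bar>layer k s \<omega>\<bar> \<le> (1/2) ^ k"
      by metis
    have "AE \<omega> in \<Omega>. \<forall>\<^sub>F k in sequentially. \<omega> \<in> space \<Omega> - A k"
    proof (rule borel_cantelli_AE1)
      show "summable (\<lambda>k. measure \<Omega> (A k))"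
      proof (rule summable_comparison_test_ev)
        have "\<bar>measure \<Omega> (A k)\<bar> \<le> 2 * exp (real J) * exp (-1) ^ k" if k: "0 < k" for k
        proof -
          have "measure \<Omega> (A k) \<le> 2 * exp (real J - 2 ^ k)" using A(2)[OF k] by (simp add: emeasure_eq_measure)
          also have "\<dots> \<le> 2 * exp (real J - real k)"
            using of_nat_less_two_power[of k, where 'a = real] by simp
          also have "\<dots> = 2 * exp (real J) * exp (-1) ^ k" by (simp add: exp_diff exp_of_nat_mult[symmetric] exp_minus divide_inverse power_inverse)
          finally show ?thesis by simp
        qed
        then show "\<forall>\<^sub>F k in sequentially. norm (measure \<Omega> (A k)) \<le> 2 * exp (real J) * exp (-1) ^ k"
          by (auto simp: eventually_sequentially intro!: exI[of _ 1])
        show "summable (\<lambda>k. 2 * exp (real J) * exp (-1) ^ k)"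
          by (intro summable_mult summable_geometric) simp
      qed
    qed (use A in \<open>auto simp: less_top[symmetric]\<close>)
    then show ?thesis
    proof eventually_elim
      case (elim \<omega>)
      then show ?case using eventually_gt_at_top[of 0] by eventually_elim (use A(3) in auto)
    qed
  qed
  then show ?thesis by (simp add: AE_all_countable)
qed

text \<open>
  On the null set where the layers fail to be uniformly summable the path is set to 0, because every
  path has to be regular. The Laplace transform passes to the limit since the second moment of
  \<open>exp (u Z)\<close> is the transform at \<open>2 u\<close>, which is bounded along the partial sums.
\<close>

theorem layers_levy_process:
  assumes int: "\<And>k. 0 < k \<Longrightarrow> integrable (\<rho> k) (\<lambda>y. exp (4 ^ k * max 0 y))"
    and small: "\<And>k. 0 < k \<Longrightarrow> exponent k (4 ^ k) \<le> 1" "\<And>k. 0 < k \<Longrightarrow> exponent k (- (4 ^ k)) \<le> 1"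
    and sums: "\<And>u. 0 < u \<Longrightarrow> (\<lambda>k. exponent k u) sums \<psi> u"
  shows "\<exists>Z. levy_process \<Omega> Z \<and> (\<forall>\<omega>\<in>space \<Omega>. cadlag_down (\<lambda>s. Z s \<omega>)) \<and>
     (\<forall>u>0. \<forall>s\<ge>0. (\<integral>\<^sup>+\<omega>. ennreal (exp (u * Z s \<omega>)) \<partial>\<Omega>) = ennreal (exp (s * (u * b + \<psi> u))))"
proof -
  interpret prob_space \<Omega> by (rule prob_\<Omega>)
  obtain B where B: "B \<in> null_sets \<Omega>"
    and good': "\<And>\<omega>. \<omega> \<in> space \<Omega> - B \<Longrightarrow> \<forall>J :: nat. \<forall>\<^sub>F k in sequentially. \<forall>s\<in>{0..real J}. \<bar>layer k s \<omega>\<bar> \<le> (1/2) ^ k"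
    using AE_E3[OF layer_uniformly_small[OF int small]] by blast
  have good: "\<forall>\<^sub>F k in sequentially. \<forall>s\<in>{0..real J}. \<bar>layer k s \<omega>\<bar> \<le> (1/2) ^ k"
    if "\<omega> \<in> space \<Omega>" "\<omega> \<notin> B" for \<omega> J using good'[of \<omega>] that by blast
  have [measurable]: "B \<in> sets \<Omega>" using B by auto
  define Z where "Z s \<omega> = (if \<omega> \<in> B then 0 else b * s + (\<Sum>k. layer k s \<omega>))" for s \<omega>
  have ul: "uniform_limit {0..real J} (\<lambda>n s. partial b {..<n} s \<omega>) (\<lambda>s. Z s \<omega>) sequentially"
    if "\<omega> \<in> space \<Omega>" "\<omega> \<notin> B" for \<omega> J
  proof -
    have "uniform_limit {0..real J} (\<lambda>n s. \<Sum>k<n. layer k s \<omega>) (\<lambda>s. \<Sum>k. layer k s \<omega>) sequentially"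
      by (rule Weierstrass_m_test_ev[where M = "\<lambda>k. (1/2) ^ k"]) (use good[OF that] in auto)
    then show ?thesis unfolding partial_def Z_def using that(2) by (auto intro!: uniform_limit_intros)
  qed
  have cad: "cadlag_down (\<lambda>s. Z s \<omega>)" if "\<omega> \<in> space \<Omega>" for \<omega>
  proof (cases "\<omega> \<in> B")
    case True
    then show ?thesis by (auto simp: Z_def intro!: cadlag_down_continuous)
  next
    case False
    show ?thesis by (rule cadlag_down_uniform_limit[OF partial_cadlag_down ul[OF that False]])
  qed
  have lim: "AE \<omega> in \<Omega>. (\<lambda>n. partial b {..<n} s \<omega>) \<longlonglongrightarrow> Z s \<omega>" if s: "0 \<le> s" for s
  proof -
    obtain J :: nat where J: "s \<le> real J" using real_arch_simple by blast
    have "AE \<omega> in \<Omega>. \<omega> \<notin> B" using B by (rule AE_not_in)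
    then show ?thesis using AE_space
      by eventually_elim (use tendsto_uniform_limitI[OF ul] s J in auto)
  qed
  have mZ[measurable]: "Z s \<in> borel_measurable \<Omega>" for s unfolding Z_def[abs_def] by measurable
  have levy: "levy_process \<Omega> Z"
  proof (rule levy_process_limit[OF partial_levy lim mZ])
    show "Z 0 \<omega> = 0" if "\<omega> \<in> space \<Omega>" for \<omega>
      using partial_0[of 0 "{_}" \<omega>] by (auto simp: Z_def partial_def)
    show "cadlag (\<lambda>s. Z s \<omega>)" if "\<omega> \<in> space \<Omega>" for \<omega> by (rule cadlag_down_imp_cadlag[OF cad[OF that]])
  qed auto
  have "(\<integral>\<^sup>+\<omega>. ennreal (exp (u * Z s \<omega>)) \<partial>\<Omega>) = ennreal (exp (s * (u * b + \<psi> u)))" if u: "0 < u" and s: "0 \<le> s" for u s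
  proof (rule nn_integral_limit_of_square_bounded[where X = "\<lambda>n \<omega>. exp (u * partial b {..<n} s \<omega>)"
        and e = "\<lambda>n. exp (s * (u * b + (\<Sum>k<n. exponent k u)))" and C = "exp (s * (2 * u * b + \<psi> (2 * u)))"])
    show "AE \<omega> in \<Omega>. (\<lambda>n. exp (u * partial b {..<n} s \<omega>)) \<longlonglongrightarrow> exp (u * Z s \<omega>)"
      using lim[OF s] by eventually_elim (auto intro!: tendsto_intros)
    show "(\<integral>\<^sup>+\<omega>. ennreal ((exp (u * partial b {..<n} s \<omega>))\<^sup>2) \<partial>\<Omega>) \<le> ennreal (exp (s * (2 * u * b + \<psi> (2 * u))))" for n
    proof -
      have "(\<integral>\<^sup>+\<omega>. ennreal ((exp (u * partial b {..<n} s \<omega>))\<^sup>2) \<partial>\<Omega>) = (\<integral>\<^sup>+\<omega>. ennreal (exp ((2 * u) * partial b {..<n} s \<omega>)) \<partial>\<Omega>)"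
        by (simp only: exp_double[symmetric] mult.assoc)
      also have "\<dots> = ennreal (exp (s * (2 * u * b + (\<Sum>k<n. exponent k (2 * u)))))"
        by (rule partial_mgf) (use u s integrable_exp_neg in auto)
      also have "\<dots> \<le> ennreal (exp (s * (2 * u * b + \<psi> (2 * u))))"
      proof -
        have "(\<Sum>k<n. exponent k (2 * u)) \<le> (\<Sum>k. exponent k (2 * u))"
          by (rule sum_le_suminf) (use sums[of "2 * u"] u exponent_nonneg in \<open>auto simp: sums_iff\<close>)
        also have "\<dots> = \<psi> (2 * u)" using sums[of "2 * u"] u by (simp add: sums_iff)
        finally show ?thesis using s by (intro ennreal_leI) (simp add: mult_left_mono)
      qed
      finally show ?thesis .
    qed
    show "(\<integral>\<^sup>+\<omega>. ennreal (exp (u * partial b {..<n} s \<omega>)) \<partial>\<Omega>) = ennreal (exp (s * (u * b + (\<Sum>k<n. exponent k u))))" for n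
      by (rule partial_mgf) (use u s integrable_exp_neg in auto)
    show "(\<lambda>n. exp (s * (u * b + (\<Sum>k<n. exponent k u)))) \<longlonglongrightarrow> exp (s * (u * b + \<psi> u))"
      using sums[OF u] unfolding sums_def by (intro tendsto_intros)
  qed auto
  then show ?thesis using levy cad by blast
qed

end

section \<open>Splitting a jump measure into layers\<close>

lemma exp_bound_quadratic:
  fixes x :: real
  assumes "\<bar>x\<bar> \<le> 1"
  shows "exp x - 1 - x \<le> x\<^sup>2"
proof (cases "0 \<le> x")
  case True
  then show ?thesis using exp_bound[of x] assms by simp
next
  case False
  define y where "y = - x"
  have y: "0 < y" using False by (simp add: y_def)
  have "exp x = 1 / exp y" by (simp add: y_def exp_minus field_simps)
  also have "\<dots> \<le> 1 / (1 + y)" using exp_ge_add_one_self[of y] y by (intro divide_left_mono) auto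
  also have "\<dots> \<le> 1 - y + y\<^sup>2"
  proof -
    have "1 \<le> (1 - y + y\<^sup>2) * (1 + y)" using y by (simp add: algebra_simps power2_eq_square)
    then show ?thesis using y by (simp add: pos_divide_le_eq)
  qed
  finally show ?thesis by (simp add: y_def)
qed

lemma quadratic_le_exp:
  fixes y :: real
  assumes "0 \<le> y" "y \<le> 1"
  shows "y\<^sup>2 \<le> 4 * (exp (- y) - 1 + y)"
proof -
  define g where "g y = 4 * (exp (- y) - 1 + y) - y\<^sup>2" for y :: real
  have "g 0 \<le> g y"
  proof (rule DERIV_nonneg_imp_nondecreasing[OF assms(1)])
    fix x :: real assume x: "0 \<le> x" "x \<le> y"
    have "exp (- x) \<le> 1 / (1 + x)" using exp_ge_add_one_self[of x] x by (simp add: exp_minus field_simps)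
    also have "\<dots> \<le> 1 - x / 2"
    proof -
      have "0 \<le> x * (1 - x)" using x assms by simp
      then have "1 \<le> (1 - x / 2) * (1 + x)" by (simp add: algebra_simps)
      then show ?thesis using x by (simp add: pos_divide_le_eq)
    qed
    finally have "0 \<le> 4 * (1 - exp (- x)) - 2 * x" by simp
    moreover have "(g has_real_derivative 4 * (1 - exp (- x)) - 2 * x) (at x)"
      unfolding g_def[abs_def] by (auto intro!: derivative_eq_intros)
    ultimately show "\<exists>d. (g has_real_derivative d) (at x) \<and> 0 \<le> d" by blast
  qed
  then show ?thesis by (simp add: g_def)
qed

text \<open>
  Finiteness at \<open>u = 1\<close> contains all the integrability that is needed: \<open>exp (- y) - 1 + y\<close> is comparable to
  \<open>y\<^sup>2\<close> near 0, is bounded below away from 0, and is at least \<open>y - 1\<close>.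
\<close>

locale small_jump_measure =
  fixes \<nu> :: "real measure" and \<psi> :: "real \<Rightarrow> real"
  assumes sets_\<nu>[simp, measurable_cong]: "sets \<nu> = sets borel"
    and pos: "AE y in \<nu>. 0 < y"
    and \<psi>: "\<And>u. 0 < u \<Longrightarrow> (\<integral>\<^sup>+y. ennreal (exp (- u * y) - 1 + u * y) \<partial>\<nu>) = ennreal (\<psi> u)"
    and \<psi>_nonneg: "\<And>u. 0 < u \<Longrightarrow> 0 \<le> \<psi> u"
begin

definition compensated :: "real \<Rightarrow> real \<Rightarrow> real" where "compensated u y = exp (- u * y) - 1 + u * y"

lemma compensated_nonneg: "0 \<le> compensated u y"
  using exp_ge_add_one_self[of "- u * y"] unfolding compensated_def by linarith

lemma compensated_measurable[measurable]: "compensated u \<in> borel_measurable borel"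
  unfolding compensated_def[abs_def] by measurable

lemma compensated_0: "compensated u 0 = 0" by (simp add: compensated_def)

lemma compensated_finite: "(\<integral>\<^sup>+y. ennreal (compensated 1 y) \<partial>\<nu>) < \<infinity>"
  using \<psi>[of 1] by (simp add: compensated_def)

lemma compensated_mono:
  assumes "0 \<le> a" "a \<le> y"
  shows "compensated 1 a \<le> compensated 1 y"
proof (rule DERIV_nonneg_imp_nondecreasing[OF assms(2)])
  fix x :: real assume "a \<le> x" "x \<le> y"
  then have "0 \<le> 1 - exp (- x)" using assms by simp
  moreover have "(compensated 1 has_real_derivative 1 - exp (- x)) (at x)"
    unfolding compensated_def[abs_def] by (auto intro!: derivative_eq_intros)
  ultimately show "\<exists>d. (compensated 1 has_real_derivative d) (at x) \<and> 0 \<le> d" by blast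
qed

lemma compensated_pos: "0 < a \<Longrightarrow> 0 < compensated 1 a"
  using exp_minus_greater[of a] unfolding compensated_def by simp

lemma tail_finite:
  assumes a: "0 < a"
  shows "emeasure \<nu> {a<..} < \<infinity>"
proof -
  have "ennreal (compensated 1 a) * emeasure \<nu> {a<..} = (\<integral>\<^sup>+y. ennreal (compensated 1 a) * indicator {a<..} y \<partial>\<nu>)"
    by (rule nn_integral_cmult_indicator[symmetric]) simp
  also have "\<dots> \<le> (\<integral>\<^sup>+y. ennreal (compensated 1 y) \<partial>\<nu>)"
    by (intro nn_integral_mono) (use compensated_mono[of a] a in \<open>auto simp: indicator_def ennreal_leI\<close>)
  also have "\<dots> < \<infinity>" by (rule compensated_finite)
  finally show ?thesis using compensated_pos[OF a] by (auto simp: ennreal_mult_less_top)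
qed

text \<open>
  The bound \<open>(1/4) (1/16) ^ k\<close> is what \<open>exponent_small\<close> requires at the slopes \<open>4 ^ k\<close> and \<open>- (4 ^ k)\<close>, and jumps of size at
  most \<open>(1/4) ^ k\<close> keep the argument of the exponential within the unit interval there.
\<close>

lemma small_interval:
  "\<exists>a>0. a \<le> (1/4) ^ k \<and> (\<integral>\<^sup>+y. ennreal (compensated 1 y) * indicator {0<..a} y \<partial>\<nu>) \<le> ennreal ((1/4) * (1/16) ^ k)"
proof -
  define a where "a n = (1/4) ^ k / real (Suc n)" for n
  have a_pos: "0 < a n" for n by (simp add: a_def)
  have a_le: "a n \<le> (1/4) ^ k" for n
  proof -
    have "(1/4) ^ k / real (Suc n) \<le> (1/4) ^ k / (1::real)" by (rule divide_left_mono) auto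
    then show ?thesis unfolding a_def by (simp only: div_by_1)
  qed
  have a_lim: "a \<longlonglongrightarrow> 0"
  proof -
    have "(\<lambda>n. (1/4) ^ k * inverse (real (Suc n))) \<longlonglongrightarrow> (1/4) ^ k * 0"
      by (intro tendsto_mult tendsto_const LIMSEQ_inverse_real_of_nat)
    moreover have "a = (\<lambda>n. (1/4) ^ k * inverse (real (Suc n)))"
      by (rule ext) (simp only: a_def divide_inverse)
    ultimately show ?thesis by (simp only: mult_zero_right)
  qed
  have "(\<lambda>n. \<integral>\<^sup>+y. ennreal (compensated 1 y) * indicator {0<..a n} y \<partial>\<nu>) \<longlonglongrightarrow> (\<integral>\<^sup>+y. 0 \<partial>\<nu>)"
  proof (rule nn_integral_dominated_convergence[where w = "\<lambda>y. ennreal (compensated 1 y)"])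
    show "AE y in \<nu>. (\<lambda>n. ennreal (compensated 1 y) * indicator {0<..a n} y) \<longlonglongrightarrow> 0"
      using pos
    proof eventually_elim
      case (elim y)
      have "\<forall>\<^sub>F n in sequentially. a n < y" using a_lim elim by (rule order_tendstoD(2))
      then have "\<forall>\<^sub>F n in sequentially. ennreal (compensated 1 y) * indicator {0<..a n} y = 0"
        by eventually_elim (auto simp: indicator_def)
      then show ?case by (rule tendsto_eventually)
    qed
  qed (use compensated_finite in \<open>auto simp: indicator_def\<close>)
  then have "\<forall>\<^sub>F n in sequentially. (\<integral>\<^sup>+y. ennreal (compensated 1 y) * indicator {0<..a n} y \<partial>\<nu>) < ennreal ((1/4) * (1/16) ^ k)"
    by (rule order_tendstoD(2)) simp
  then obtain n where "(\<integral>\<^sup>+y. ennreal (compensated 1 y) * indicator {0<..a n} y \<partial>\<nu>) < ennreal ((1/4) * (1/16) ^ k)"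
    unfolding eventually_sequentially by blast
  then have "(\<integral>\<^sup>+y. ennreal (compensated 1 y) * indicator {0<..a n} y \<partial>\<nu>) \<le> ennreal ((1/4) * (1/16) ^ k)" by (rule less_imp_le)
  with a_pos a_le show ?thesis by blast
qed

definition threshold :: "nat \<Rightarrow> real" where
  "threshold k = (SOME a. 0 < a \<and> a \<le> (1/4) ^ k \<and> (\<integral>\<^sup>+y. ennreal (compensated 1 y) * indicator {0<..a} y \<partial>\<nu>) \<le> ennreal ((1/4) * (1/16) ^ k))"

text \<open>
  The running minimum makes the thresholds decrease, so that consecutive radii cut out disjoint shells.
\<close>

definition radius :: "nat \<Rightarrow> real" where "radius k = Min (threshold ` {..k})"

lemma threshold:
  "0 < threshold k" "threshold k \<le> (1/4) ^ k"
  "(\<integral>\<^sup>+y. ennreal (compensated 1 y) * indicator {0<..threshold k} y \<partial>\<nu>) \<le> ennreal ((1/4) * (1/16) ^ k)"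
  using someI_ex[OF small_interval[of k]] unfolding threshold_def[symmetric] by auto

lemma radius_pos: "0 < radius k"
  unfolding radius_def using threshold(1) by (subst Min_gr_iff) auto

lemma radius_le_threshold: "radius k \<le> threshold k"
  unfolding radius_def by (intro Min_le) auto

lemma radius_antimono: "i \<le> j \<Longrightarrow> radius j \<le> radius i"
  unfolding radius_def by (intro Min_antimono) auto

lemma radius_lim: "radius \<longlonglongrightarrow> 0"
proof (rule tendsto_sandwich[of "\<lambda>_. 0" _ _ "\<lambda>k. (1/4) ^ k"])
  show "\<forall>\<^sub>F k in sequentially. radius k \<le> (1/4) ^ k"
    using radius_le_threshold threshold(2) by (auto intro!: always_eventually intro: order_trans)
  show "(\<lambda>k. (1/4) ^ k :: real) \<longlonglongrightarrow> 0" by (rule LIMSEQ_power_zero) simp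
qed (use radius_pos in \<open>auto intro!: always_eventually less_imp_le\<close>)

definition shell :: "nat \<Rightarrow> real set" where
  "shell k = (if k = 0 then {radius 1<..} else {radius (Suc k)<..radius k})"

lemma shell_sets[measurable]: "shell k \<in> sets borel" by (simp add: shell_def)

lemma shell_subset: "shell k \<subseteq> {radius (Suc k)<..}" by (auto simp: shell_def)

lemma shell_small: "0 < k \<Longrightarrow> y \<in> shell k \<Longrightarrow> 0 < y \<and> y \<le> threshold k"
  using radius_pos[of "Suc k"] radius_le_threshold[of k] by (auto simp: shell_def)

lemma shell_finite: "emeasure \<nu> (shell k) < \<infinity>"
proof -
  have "emeasure \<nu> (shell k) \<le> emeasure \<nu> {radius (Suc k)<..}" by (rule emeasure_mono[OF shell_subset]) simp
  also have "\<dots> < \<infinity>" by (rule tail_finite[OF radius_pos])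
  finally show ?thesis .
qed

lemma shell_disjoint: "disjoint_family shell"
proof -
  have "shell i \<inter> shell j = {}" if "i < j" for i j
  proof -
    have "radius j \<le> radius (Suc i)" using that by (intro radius_antimono) simp
    then show ?thesis using that by (auto simp: shell_def)
  qed
  then show ?thesis unfolding disjoint_family_on_def by (metis Int_commute linorder_neqE_nat)
qed

lemma shell_cover:
  assumes "0 < y"
  shows "\<exists>k. y \<in> shell k"
proof -
  have "\<forall>\<^sub>F k in sequentially. radius k < y" using radius_lim assms by (rule order_tendstoD(2))
  then obtain N where N: "\<And>k. N \<le> k \<Longrightarrow> radius k < y" by (auto simp: eventually_sequentially)
  define k where "k = (LEAST k. radius (Suc k) < y)"
  have 1: "radius (Suc k) < y" unfolding k_def by (rule LeastI[of _ N]) (rule N, simp)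
  have "y \<in> shell k"
  proof (cases k)
    case 0
    then show ?thesis using 1 by (simp add: shell_def)
  next
    case (Suc j)
    then have "\<not> radius (Suc j) < y" unfolding k_def by (metis lessI not_less_Least)
    then show ?thesis using 1 Suc by (simp add: shell_def)
  qed
  then show ?thesis ..
qed

text \<open>
  A shell without mass is given jumps of size 0 at rate 1, which contribute nothing to the exponent.
\<close>

definition weight :: "nat \<Rightarrow> real" where
  "weight k = (if emeasure \<nu> (shell k) = 0 then 1 else measure \<nu> (shell k))"

definition law :: "nat \<Rightarrow> real measure" where
  "law k = (if emeasure \<nu> (shell k) = 0 then return borel 0 else uniform_measure \<nu> (shell k))"

lemma emeasure_D: "emeasure \<nu> (shell k) = ennreal (measure \<nu> (shell k))"
  using shell_finite[of k] by (intro emeasure_eq_ennreal_measure) auto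

lemma weight_pos: "0 < weight k"
  unfolding weight_def using emeasure_D[of k] by (auto simp: zero_less_measure_iff)

lemma law_sets: "sets (law k) = sets borel"
  by (simp add: law_def)

lemma law_prob: "prob_space (law k)"
  unfolding law_def using shell_finite[of k]
  by (auto intro!: prob_space_return prob_space_uniform_measure)

lemma law_integral:
  assumes [measurable]: "g \<in> borel_measurable borel" and g0: "g 0 = 0"
  shows "ennreal (weight k) * (\<integral>\<^sup>+y. g y \<partial>law k) = (\<integral>\<^sup>+y. g y * indicator (shell k) y \<partial>\<nu>)"
proof (cases "emeasure \<nu> (shell k) = 0")
  case True
  then have "shell k \<in> null_sets \<nu>" by (intro null_setsI) auto
  then have "(\<integral>\<^sup>+y. g y * indicator (shell k) y \<partial>\<nu>) = 0" by (rule nn_integral_null_set)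
  then show ?thesis using True by (simp add: law_def nn_integral_return g0)
next
  case False
  have "(\<integral>\<^sup>+y. g y \<partial>law k) = (\<integral>\<^sup>+y. g y * indicator (shell k) y \<partial>\<nu>) / emeasure \<nu> (shell k)"
    using False unfolding law_def by (simp add: nn_integral_uniform_measure)
  moreover have "ennreal (weight k) = emeasure \<nu> (shell k)" using False by (simp add: weight_def emeasure_D)
  moreover have "emeasure \<nu> (shell k) * (x / emeasure \<nu> (shell k)) = x" for x
    unfolding ennreal_times_divide mult.commute[of "emeasure \<nu> (shell k)"]
    by (rule mult_divide_eq_ennreal) (use False shell_finite[of k] in auto)
  ultimately show ?thesis by (simp only:)
qed

lemma law_AE:
  assumes "P 0" and "AE y in \<nu>. y \<in> shell k \<longrightarrow> P y" and [measurable]: "Measurable.pred borel P"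
  shows "AE y in law k. P y"
  using assms unfolding law_def by (auto simp: AE_return intro!: AE_uniform_measureI)

lemma mean_integrable: "integrable (law k) (\<lambda>y. max 0 y)"
proof (rule integrableI_nonneg)
  show "(\<lambda>y. max 0 y) \<in> borel_measurable (law k)" by (subst measurable_cong_sets[OF law_sets refl]) simp
  have "ennreal (weight k) * (\<integral>\<^sup>+y. ennreal (max 0 y) \<partial>law k) = (\<integral>\<^sup>+y. ennreal (max 0 y) * indicator (shell k) y \<partial>\<nu>)"
    by (rule law_integral) auto
  also have "\<dots> \<le> (\<integral>\<^sup>+y. ennreal (compensated 1 y) + indicator (shell k) y \<partial>\<nu>)"
  proof (rule nn_integral_mono)
    fix y
    have "y \<le> compensated 1 y + 1" unfolding compensated_def by simp
    then have "max 0 y \<le> compensated 1 y + 1" using compensated_nonneg[of 1 y] by simp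
    then have "ennreal (max 0 y) \<le> ennreal (compensated 1 y + 1)" by (rule ennreal_leI)
    also have "\<dots> = ennreal (compensated 1 y) + 1" using compensated_nonneg[of 1 y] by (simp add: ennreal_plus)
    finally have "ennreal (max 0 y) \<le> ennreal (compensated 1 y) + 1" .
    then show "ennreal (max 0 y) * indicator (shell k) y \<le> ennreal (compensated 1 y) + indicator (shell k) y" by (auto simp: indicator_def)
  qed
  also have "\<dots> = (\<integral>\<^sup>+y. ennreal (compensated 1 y) \<partial>\<nu>) + emeasure \<nu> (shell k)" by (subst nn_integral_add) auto
  also have "\<dots> < \<infinity>" using compensated_finite shell_finite[of k] by simp
  finally have "ennreal (weight k) * (\<integral>\<^sup>+y. ennreal (max 0 y) \<partial>law k) < \<infinity>" .
  then show "(\<integral>\<^sup>+y. ennreal (max 0 y) \<partial>law k) < \<infinity>"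
    using weight_pos[of k] unfolding infinity_ennreal_def ennreal_mult_less_top by auto
qed simp

sublocale jump_layers weight law
  by (rule jump_layers.intro) (rule weight_pos law_prob law_sets mean_integrable)+

lemma exponent_eq:
  assumes "(\<integral>\<^sup>+y. ennreal (compensated u (max 0 y)) * indicator (shell k) y \<partial>\<nu>) < \<infinity>"
  shows "ennreal (exponent k u) = (\<integral>\<^sup>+y. ennreal (compensated u (max 0 y)) * indicator (shell k) y \<partial>\<nu>)"
proof -
  have *: "ennreal (weight k) * (\<integral>\<^sup>+y. ennreal (compensated u (max 0 y)) \<partial>law k) = (\<integral>\<^sup>+y. ennreal (compensated u (max 0 y)) * indicator (shell k) y \<partial>\<nu>)"
    by (rule law_integral) (auto simp: compensated_0)
  then have fin: "(\<integral>\<^sup>+y. ennreal (compensated u (max 0 y)) \<partial>law k) < \<infinity>"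
    using assms weight_pos[of k] by (auto simp: ennreal_mult_less_top simp flip: *)
  have "exponent k u = weight k * (\<integral>y. compensated u (max 0 y) \<partial>law k)" by (simp add: exponent_def compensated_def)
  also have "(\<integral>y. compensated u (max 0 y) \<partial>law k) = enn2real (\<integral>\<^sup>+y. ennreal (compensated u (max 0 y)) \<partial>law k)"
    by (rule integral_eq_nn_integral) (auto simp: compensated_nonneg)
  finally show ?thesis using fin weight_pos[of k] by (simp add: ennreal_mult less_top flip: *)
qed

text \<open>
  On the shell \<open>k\<close> the product \<open>u y\<close> is at most 1 in absolute value, so the integrand is at most
  \<open>u\<^sup>2 y\<^sup>2 = 16 ^ k y\<^sup>2\<close>, which in turn is at most \<open>4 * 16 ^ k\<close> times the integrand at \<open>u = 1\<close>.
\<close>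

lemma exponent_small:
  assumes k: "0 < k" and u: "\<bar>u\<bar> = 4 ^ k"
  shows "exponent k u \<le> 1"
proof -
  have "(\<integral>\<^sup>+y. ennreal (compensated u (max 0 y)) * indicator (shell k) y \<partial>\<nu>)
     \<le> (\<integral>\<^sup>+y. ennreal (4 * 16 ^ k) * (ennreal (compensated 1 y) * indicator {0<..threshold k} y) \<partial>\<nu>)"
  proof (rule nn_integral_mono)
    fix y
    show "ennreal (compensated u (max 0 y)) * indicator (shell k) y \<le> ennreal (4 * 16 ^ k) * (ennreal (compensated 1 y) * indicator {0<..threshold k} y)"
    proof (cases "y \<in> shell k")
      case True
      have y: "0 < y" "y \<le> threshold k" using shell_small[OF k True] by auto
      have y4: "y \<le> (1/4) ^ k" using y threshold(2)[of k] by simp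
      have "(1/4) ^ k \<le> (1::real)" by (rule power_le_one) auto
      then have y1: "y \<le> 1" using y4 by simp
      have "\<bar>u * y\<bar> \<le> 4 ^ k * (1/4) ^ k" unfolding abs_mult u using y y4 by (intro mult_mono) auto
      also have "(4::real) ^ k * (1/4) ^ k = 1" by (simp flip: power_mult_distrib)
      finally have "compensated u y \<le> (u * y)\<^sup>2" using exp_bound_quadratic[of "- u * y"] by (simp add: compensated_def abs_mult)
      also have "(u * y)\<^sup>2 = \<bar>u\<bar>\<^sup>2 * y\<^sup>2" by (simp add: power_mult_distrib)
      also have "\<bar>u\<bar>\<^sup>2 = 16 ^ k" unfolding u by (simp add: power2_eq_square flip: power_mult_distrib)
      also have "16 ^ k * y\<^sup>2 \<le> 16 ^ k * (4 * compensated 1 y)" using quadratic_le_exp[of y] y y1 by (simp add: compensated_def)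
      finally have "compensated u y \<le> 4 * 16 ^ k * compensated 1 y" by simp
      then show ?thesis using True y compensated_nonneg[of 1 y] by (simp add: max_def ennreal_mult[symmetric] ennreal_leI)
    qed simp
  qed
  also have "\<dots> = ennreal (4 * 16 ^ k) * (\<integral>\<^sup>+y. ennreal (compensated 1 y) * indicator {0<..threshold k} y \<partial>\<nu>)"
    by (rule nn_integral_cmult) measurable
  also have "\<dots> \<le> ennreal (4 * 16 ^ k) * ennreal ((1/4) * (1/16) ^ k)" by (intro mult_left_mono threshold(3)) simp
  also have "\<dots> = ennreal ((4 * 16 ^ k) * ((1/4) * (1/16) ^ k))" by (rule ennreal_mult[symmetric]) auto
  also have "(4 * 16 ^ k) * ((1/4) * (1/16) ^ k) = (1::real)"
    by (simp flip: power_mult_distrib)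
  finally have le: "(\<integral>\<^sup>+y. ennreal (compensated u (max 0 y)) * indicator (shell k) y \<partial>\<nu>) \<le> 1" by simp
  then have "ennreal (exponent k u) \<le> 1" by (subst exponent_eq) (auto intro: order_le_less_trans)
  then show ?thesis by (simp add: ennreal_le_1)
qed

lemma exp_integrable:
  assumes k: "0 < k"
  shows "integrable (law k) (\<lambda>y. exp (4 ^ k * max 0 y))"
proof -
  interpret prob_space "law k" by (rule law_prob)
  have "AE y in law k. 4 ^ k * max 0 y \<le> 1"
  proof (rule law_AE)
    show "AE y in \<nu>. y \<in> shell k \<longrightarrow> 4 ^ k * max 0 y \<le> 1"
    proof (rule AE_I2, rule impI)
      fix y assume "y \<in> shell k"
      then have y: "0 < y" "y \<le> (1/4) ^ k" using shell_small[OF k, of y] threshold(2)[of k] by auto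
      then have "4 ^ k * y \<le> 4 ^ k * (1/4) ^ k" by (intro mult_left_mono) auto
      also have "(4::real) ^ k * (1/4) ^ k = 1" by (simp flip: power_mult_distrib)
      finally show "4 ^ k * max 0 y \<le> 1" using y by (simp add: max_def)
    qed
  qed auto
  then show ?thesis by (intro integrable_const_bound[where B = "exp 1"]) auto
qed

lemma exponent_sums:
  assumes u: "0 < u"
  shows "(\<lambda>k. exponent k u) sums \<psi> u"
proof -
  have tot: "(\<integral>\<^sup>+y. ennreal (compensated u (max 0 y)) \<partial>\<nu>) = ennreal (\<psi> u)"
    unfolding \<psi>[OF u, symmetric] by (rule nn_integral_cong_AE) (use pos in eventually_elim, auto simp: compensated_def max_def)
  have fin: "(\<integral>\<^sup>+y. ennreal (compensated u (max 0 y)) * indicator (shell k) y \<partial>\<nu>) < \<infinity>" for k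
  proof -
    have "(\<integral>\<^sup>+y. ennreal (compensated u (max 0 y)) * indicator (shell k) y \<partial>\<nu>) \<le> (\<integral>\<^sup>+y. ennreal (compensated u (max 0 y)) \<partial>\<nu>)"
      by (intro nn_integral_mono) (auto simp: indicator_def)
    then show ?thesis unfolding tot by (auto intro: order_le_less_trans)
  qed
  have "(\<Sum>k. ennreal (exponent k u)) = (\<Sum>k. \<integral>\<^sup>+y. ennreal (compensated u (max 0 y)) * indicator (shell k) y \<partial>\<nu>)"
    by (simp add: exponent_eq[OF fin])
  also have "\<dots> = (\<integral>\<^sup>+y. (\<Sum>k. ennreal (compensated u (max 0 y)) * indicator (shell k) y) \<partial>\<nu>)"
    by (rule nn_integral_suminf[symmetric]) measurable
  also have "\<dots> = (\<integral>\<^sup>+y. ennreal (compensated u (max 0 y)) \<partial>\<nu>)"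
  proof (rule nn_integral_cong_AE)
    show "AE y in \<nu>. (\<Sum>k. ennreal (compensated u (max 0 y)) * indicator (shell k) y) = ennreal (compensated u (max 0 y))"
      using pos
    proof eventually_elim
      case (elim y)
      then obtain k where "y \<in> shell k" using shell_cover by blast
      then show ?case by (rule suminf_cmult_indicator[OF shell_disjoint])
    qed
  qed
  finally have "(\<lambda>k. ennreal (exponent k u)) sums ennreal (\<psi> u)" unfolding tot using summableI by (metis summable_sums)
  then show ?thesis by (subst (asm) sums_ennreal) (auto simp: exponent_nonneg \<psi>_nonneg u)
qed

text \<open>
  The Levy-Ito construction for downward jumps: the layers of the shells are independent, and their
  exponents sum to \<open>\<psi>\<close> because the shells partition the positive half-line.
\<close>

theorem levy_existence:
  "\<exists>Z. levy_process \<Omega> Z \<and> (\<forall>\<omega>\<in>space \<Omega>. cadlag_down (\<lambda>s. Z s \<omega>)) \<and>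
     (\<forall>u>0. \<forall>s\<ge>0. (\<integral>\<^sup>+\<omega>. ennreal (exp (u * Z s \<omega>)) \<partial>\<Omega>) = ennreal (exp (s * (u * b + \<psi> u))))"
  by (rule layers_levy_process) (use exp_integrable exponent_small exponent_sums in auto)

end

section \<open>Tail integrals of right-continuous functions\<close>

text \<open>
  Around each time the path is bounded by its one-sided limits; compactness of the interval does the rest.
\<close>

lemma cadlag_bounded:
  assumes x: "cadlag x"
  shows "\<exists>B. \<forall>s\<in>{0..T}. \<bar>x s\<bar> \<le> B"
proof -
  have loc: "\<exists>U b. open U \<and> s \<in> U \<and> (\<forall>r\<in>U \<inter> {0..}. \<bar>x r\<bar> \<le> b)" if s: "0 \<le> s" for s
  proof -
    have "eventually (\<lambda>r. dist (x r) (x s) < 1) (at_right s)"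
      using x s unfolding cadlag_def by (intro tendstoD) auto
    then obtain c where c: "c > s" "\<And>r. s < r \<Longrightarrow> r < c \<Longrightarrow> \<bar>x r - x s\<bar> < 1"
      unfolding eventually_at_right_field dist_real_def by blast
    show ?thesis
    proof (cases "s = 0")
      case True
      have "\<bar>x r\<bar> \<le> \<bar>x s\<bar> + 1" if "r \<in> {..<c} \<inter> {0..}" for r
        using c(2)[of r] that True by (cases "r = s") auto
      then show ?thesis using c(1) True by (intro exI[of _ "{..<c}"] exI[of _ "\<bar>x s\<bar> + 1"]) auto
    next
      case False
      then have "0 < s" using s by simp
      then obtain l where "(x \<longlongrightarrow> l) (at_left s)" using x unfolding cadlag_def by blast
      then have "eventually (\<lambda>r. dist (x r) l < 1) (at_left s)" by (rule tendstoD) simp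
      then obtain d where d: "d < s" "\<And>r. d < r \<Longrightarrow> r < s \<Longrightarrow> \<bar>x r - l\<bar> < 1"
        unfolding eventually_at_left_field dist_real_def by blast
      have "\<bar>x r\<bar> \<le> max \<bar>x s\<bar> \<bar>l\<bar> + 1" if "r \<in> {d<..<c}" for r
        using c(2)[of r] d(2)[of r] that by (cases r s rule: linorder_cases) auto
      then show ?thesis using c(1) d(1) by (intro exI[of _ "{d<..<c}"] exI[of _ "max \<bar>x s\<bar> \<bar>l\<bar> + 1"]) auto
    qed
  qed
  then have "\<forall>s\<in>{0..T}. \<exists>p. open (fst p) \<and> s \<in> fst p \<and> (\<forall>r\<in>fst p \<inter> {0..}. \<bar>x r\<bar> \<le> snd p)" by force
  from bchoice[OF this] obtain p where p: "\<And>s. s \<in> {0..T} \<Longrightarrow> open (fst (p s))" "\<And>s. s \<in> {0..T} \<Longrightarrow> s \<in> fst (p s)"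
    "\<And>s r. s \<in> {0..T} \<Longrightarrow> r \<in> fst (p s) \<inter> {0..} \<Longrightarrow> \<bar>x r\<bar> \<le> snd (p s)" by blast
  obtain C where C: "C \<subseteq> {0..T}" "finite C" "{0..T} \<subseteq> (\<Union>s\<in>C. fst (p s))"
    by (rule compactE_image[of "{0..T}" "{0..T}" "\<lambda>s. fst (p s)"]) (use p in auto)
  have "\<bar>x r\<bar> \<le> (\<Sum>s\<in>C. \<bar>snd (p s)\<bar>)" if r: "r \<in> {0..T}" for r
  proof -
    obtain s where s: "s \<in> C" "r \<in> fst (p s)" using C r by blast
    have "\<bar>x r\<bar> \<le> snd (p s)" using p(3)[of s r] s C r by auto
    also have "\<dots> \<le> \<bar>snd (p s)\<bar>" by simp
    also have "\<dots> \<le> (\<Sum>s\<in>C. \<bar>snd (p s)\<bar>)" using s C by (intro member_le_sum) auto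
    finally show ?thesis .
  qed
  then show ?thesis by blast
qed

text \<open>
  The first grid point strictly to the right, so that right-continuity applies to the approximation.
\<close>

definition next_grid :: "nat \<Rightarrow> real \<Rightarrow> real" where
  "next_grid n w = (of_int \<lfloor>real (Suc n) * w\<rfloor> + 1) / real (Suc n)"

lemma next_grid_gt: "w < next_grid n w"
  unfolding next_grid_def by (simp add: field_simps) linarith

lemma next_grid_le: "next_grid n w \<le> w + 1 / real (Suc n)"
proof -
  have "(of_int \<lfloor>real (Suc n) * w\<rfloor> + 1) / real (Suc n) \<le> (real (Suc n) * w + 1) / real (Suc n)"
    by (intro divide_right_mono add_right_mono) auto
  also have "\<dots> = w + 1 / real (Suc n)" by (simp add: add_divide_distrib)
  finally show ?thesis unfolding next_grid_def .
qed

lemma next_grid_filterlim: "filterlim (\<lambda>n. next_grid n w) (at_right w) sequentially"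
proof (rule tendsto_imp_filterlim_at_right)
  show "(\<lambda>n. next_grid n w) \<longlonglongrightarrow> w"
  proof (rule tendsto_sandwich[of "\<lambda>_. w" _ _ "\<lambda>n. w + 1 / real (Suc n)"])
    show "(\<lambda>n. w + 1 / real (Suc n)) \<longlonglongrightarrow> w"
      using tendsto_add[OF tendsto_const LIMSEQ_inverse_real_of_nat, of w] by (simp add: inverse_eq_divide)
  qed (use next_grid_gt[of w] next_grid_le[of _ w] in \<open>auto intro!: always_eventually intro: less_imp_le\<close>)
qed (auto intro!: always_eventually next_grid_gt)

lemma cadlag_grid_tendsto:
  "cadlag x \<Longrightarrow> 0 \<le> v \<Longrightarrow> 0 \<le> w \<Longrightarrow> (\<lambda>n. x (v + next_grid n w)) \<longlonglongrightarrow> x (v + w)"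
proof -
  assume x: "cadlag x" and v: "0 \<le> v" "0 \<le> w"
  have "filterlim (\<lambda>n. v + next_grid n w) (at_right (v + w)) sequentially"
    using next_grid_filterlim[of w] unfolding filterlim_at
    by (auto intro!: tendsto_intros elim: eventually_mono)
  moreover have "(x \<longlongrightarrow> x (v + w)) (at_right (v + w))" using x v by (auto simp: cadlag_def)
  ultimately show ?thesis by (rule filterlim_compose[rotated])
qed

text \<open>
  The set where \<open>\<bar>f x - f a\<bar> \<le> e (x - a)\<close> is closed, and the right derivative pushes its supremum further to
  the right unless it is \<open>b\<close>. With \<open>e\<close> half the slope from \<open>a\<close> to \<open>b\<close> this is impossible at \<open>b\<close>.
\<close>

lemma constant_of_right_derivative_0:
  fixes f :: "real \<Rightarrow> real"
  assumes ab: "a \<le> b" and cont: "continuous_on {a..b} f"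
    and der: "\<And>x. a \<le> x \<Longrightarrow> x < b \<Longrightarrow> (f has_real_derivative 0) (at x within {x..b})"
  shows "f b = f a"
proof (rule ccontr)
  assume ne: "f b \<noteq> f a"
  then have ab': "a < b" using ab by (cases "a = b") auto
  define e where "e = \<bar>f b - f a\<bar> / (2 * (b - a))"
  have e: "0 < e" using ne ab' by (simp add: e_def)
  define S where "S = {x \<in> {a..b}. \<bar>f x - f a\<bar> - e * (x - a) \<le> 0}"
  have "closed ({a..b} \<inter> (\<lambda>x. \<bar>f x - f a\<bar> - e * (x - a)) -` {..0})"
    by (intro continuous_closed_preimage continuous_intros cont)
  also have "{a..b} \<inter> (\<lambda>x. \<bar>f x - f a\<bar> - e * (x - a)) -` {..0} = S" by (auto simp: S_def)
  finally have "closed S" .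
  moreover have aS: "a \<in> S" using ab by (simp add: S_def)
  moreover have bdd: "bdd_above S" by (rule bdd_aboveI[of _ b]) (auto simp: S_def)
  ultimately have "Sup S \<in> S" by (intro closed_contains_Sup) auto
  then obtain c where c: "c = Sup S" "c \<in> S" by blast
  have "c \<noteq> b"
  proof
    assume "c = b"
    then have "\<bar>f b - f a\<bar> \<le> e * (b - a)" using c by (simp add: S_def)
    also have "\<dots> = \<bar>f b - f a\<bar> / 2" using ab' by (simp add: e_def field_simps)
    finally show False using ne by simp
  qed
  then have cb: "a \<le> c" "c < b" using c by (auto simp: S_def)
  have "((\<lambda>y. (f y - f c) / (y - c)) \<longlongrightarrow> 0) (at c within {c..b})"
    using der[OF cb] by (simp add: has_field_derivative_iff)
  then have "eventually (\<lambda>y. dist ((f y - f c) / (y - c)) 0 < e) (at c within {c..b})" using e by (rule tendstoD)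
  then obtain d where d: "0 < d" "\<And>y. y \<in> {c..b} \<Longrightarrow> y \<noteq> c \<Longrightarrow> dist y c < d \<Longrightarrow> \<bar>(f y - f c) / (y - c)\<bar> < e"
    unfolding eventually_at by auto
  define y where "y = min b (c + d / 2)"
  have y: "c < y" "y \<le> b" "dist y c < d" using cb d by (auto simp: y_def dist_real_def min_def)
  have "\<bar>f y - f c\<bar> \<le> e * (y - c)" using d(2)[of y] y by (simp add: field_simps)
  moreover have "\<bar>f c - f a\<bar> \<le> e * (c - a)" using c by (simp add: S_def)
  ultimately have "\<bar>f y - f a\<bar> \<le> e * (y - a)" by (simp add: algebra_simps)
  then have "y \<in> S" using y cb by (simp add: S_def)
  then have "y \<le> c" unfolding c(1) using bdd by (rule cSup_upper)
  then show False using y by simp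
qed

lemma right_derivative_integral:
  fixes g :: "real \<Rightarrow> real"
  assumes g: "g integrable_on {x..b}" and xb: "x < b" and rc: "(g \<longlongrightarrow> g x) (at_right x)"
  shows "((\<lambda>u. integral {x..u} g) has_real_derivative g x) (at x within {x..b})"
proof -
  have "continuous (at x within {x..b}) g"
    using rc xb by (simp add: continuous_within at_within_Icc_at_right)
  then show ?thesis
    using integral_has_vector_derivative_continuous_at[of g x b x "{}"] g xb
    by (simp add: has_real_derivative_iff_has_vector_derivative)
qed

lemma bounded_measurable_integrable_on:
  fixes g :: "real \<Rightarrow> real"
  assumes [measurable]: "(\<lambda>x. indicator {a..b} x * g x) \<in> borel_measurable borel" and B: "\<And>x. x \<in> {a..b} \<Longrightarrow> \<bar>g x\<bar> \<le> B"
  shows "set_integrable lborel {a..b} g" "g integrable_on {a..b}"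
    "(\<integral>x. indicator {a..b} x * g x \<partial>lborel) = integral {a..b} g"
proof -
  show 1: "set_integrable lborel {a..b} g"
    unfolding set_integrable_def
  proof (rule integrableI_bounded_set[where A = "{a..b}" and B = B])
    show "AE x in lborel. x \<in> {a..b} \<longrightarrow> norm (indicat_real {a..b} x *\<^sub>R g x) \<le> B"
      using B by auto
  qed (auto simp: emeasure_lborel_Icc_eq)
  show "g integrable_on {a..b}" by (rule set_borel_integral_eq_integral(1)[OF 1])
  show "(\<integral>x. indicator {a..b} x * g x \<partial>lborel) = integral {a..b} g"
    using set_borel_integral_eq_integral(2)[OF 1] by (simp add: set_lebesgue_integral_def)
qed

text \<open>
  The chain rule for a power of the tail integral \<open>B\<close>. The integrand \<open>e\<close> is only right-continuous, so \<open>B\<close> has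
  just a right derivative; the two sides are continuous in \<open>s\<close>, agree at 0, and have equal right
  derivatives.
\<close>

lemma powr_tail_integral:
  fixes e :: "real \<Rightarrow> real" and r s T :: real
  assumes e[measurable]: "(\<lambda>w. indicator {0..} w * e w) \<in> borel_measurable borel"
    and bnd: "\<And>w. w \<in> {0..T} \<Longrightarrow> c \<le> e w" "\<And>w. w \<in> {0..T} \<Longrightarrow> e w \<le> C" and c: "0 < c"
    and rc: "\<And>w. 0 \<le> w \<Longrightarrow> (e \<longlongrightarrow> e w) (at_right w)"
    and s: "0 \<le> s" "s < T" and r: "0 < r"
  defines "B \<equiv> \<lambda>v. integral {v..T} e"
  shows "ennreal (B s powr (-r)) = ennreal (B 0 powr (-r)) + (\<integral>\<^sup>+v\<in>{0..s}. ennreal (r * B v powr (-r-1) * e v) \<partial>lborel)"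
    and "\<And>v. 0 \<le> v \<Longrightarrow> v < T \<Longrightarrow> 0 < B v"
proof -
  have me: "(\<lambda>x. indicator {a..b} x * e x) \<in> borel_measurable borel" if "0 \<le> a" for a b
  proof -
    have "(\<lambda>x. indicator {a..b} x * e x) = (\<lambda>x. indicator {a..b} x * (indicator {0..} x * e x))"
      using that by (auto simp: indicator_def)
    then show ?thesis by simp
  qed
  have ab: "\<bar>e w\<bar> \<le> C" if "w \<in> {0..T}" for w using bnd[OF that] c by auto
  have ie: "e integrable_on {a..b}" if "0 \<le> a" "b \<le> T" for a b
    by (rule bounded_measurable_integrable_on(2)[where B = C]) (use that me ab in auto)
  have Bge: "c * (T - v) \<le> B v" if "0 \<le> v" "v \<le> T" for v
  proof -
    have "integral {v..T} (\<lambda>_. c) \<le> B v" unfolding B_def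
      using that bnd by (intro integral_le ie) auto
    then show ?thesis using that by (simp add: mult.commute)
  qed
  show Bpos: "0 < B v" if "0 \<le> v" "v < T" for v
  proof -
    have "0 < c * (T - v)" using that c by simp
    then show ?thesis using Bge[of v] that by linarith
  qed
  have Bsplit: "B u = B v - integral {v..u} e" if "0 \<le> v" "v \<le> u" "u \<le> T" for u v
    using Henstock_Kurzweil_Integration.integral_combine[of v u T e] ie[of v T] that unfolding B_def by simp
  have Bcont: "continuous_on {0..T} B"
  proof -
    have "continuous_on {0..T} (\<lambda>u. B 0 - integral {0..u} e)"
      by (intro continuous_intros indefinite_integral_continuous_1 ie) auto
    then show ?thesis by (rule continuous_on_eq) (rule Bsplit[symmetric], auto)
  qed
  have Bder: "(B has_real_derivative - e v) (at v within {v..T})" if "0 \<le> v" "v < T" for v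
  proof -
    have "((\<lambda>u. B v - integral {v..u} e) has_real_derivative 0 - e v) (at v within {v..T})"
      by (intro DERIV_diff DERIV_const right_derivative_integral ie rc) (use that in auto)
    then have "((\<lambda>u. B v - integral {v..u} e) has_real_derivative - e v) (at v within {v..T})" by simp
    then show ?thesis unfolding has_field_derivative_def
    proof (rule has_derivative_transform[rotated 2])
      show "B u = B v - integral {v..u} e" if "u \<in> {v..T}" for u
        by (rule Bsplit) (use that \<open>0 \<le> v\<close> in auto)
    qed (use that in auto)
  qed
  define g where "g v = r * B v powr (-r-1) * e v" for v
  have Bge': "c * (T - s) \<le> B v" if "v \<in> {0..s}" for v
  proof -
    have "c * (T - s) \<le> c * (T - v)" using that c by simp
    also have "\<dots> \<le> B v" using Bge[of v] that s by simp
    finally show ?thesis .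
  qed
  have mg: "(\<lambda>x. indicator {0..s} x * g x) \<in> borel_measurable borel"
  proof -
    have "(\<lambda>x. indicator {0..s} x *\<^sub>R B x) \<in> borel_measurable borel"
      using s by (intro borel_measurable_continuous_on_indicator continuous_on_subset[OF Bcont]) auto
    then have [measurable]: "(\<lambda>x. indicator {0..s} x * B x) \<in> borel_measurable borel" by simp
    have "(\<lambda>x. indicator {0..s} x * (r * (indicator {0..s} x * B x) powr (-r-1) * (indicator {0..} x * e x))) \<in> borel_measurable borel"
      by measurable
    also have "(\<lambda>x. indicator {0..s} x * (r * (indicator {0..s} x * B x) powr (-r-1) * (indicator {0..} x * e x))) = (\<lambda>x. indicator {0..s} x * g x)"
      by (auto simp: g_def indicator_def)
    finally show ?thesis .
  qed
  have g0: "0 \<le> g v" if "v \<in> {0..s}" for v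
    unfolding g_def using r that s bnd(1)[of v] c by (intro mult_nonneg_nonneg) auto
  have gb: "\<bar>g v\<bar> \<le> r * (c * (T - s)) powr (-r-1) * C" if v: "v \<in> {0..s}" for v
  proof -
    have "B v powr (-r-1) \<le> (c * (T - s)) powr (-r-1)"
      using Bge'[OF v] c s r by (intro powr_mono2') auto
    then have "g v \<le> r * (c * (T - s)) powr (-r-1) * C"
      unfolding g_def using v s bnd[of v] c r by (intro mult_mono) auto
    then show ?thesis using g0[OF v] by simp
  qed
  note gI = bounded_measurable_integrable_on[OF mg gb]
  have ig: "g integrable_on {a..b}" if "0 \<le> a" "b \<le> s" for a b
    using gI(2) that by (auto intro: integrable_on_subinterval)
  have rcg: "(g \<longlongrightarrow> g v) (at_right v)" if "0 \<le> v" "v < s" for v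
  proof -
    have "continuous (at v within {v..s}) B"
      using continuous_on_subset[OF Bcont, of "{v..s}"] that s by (auto simp: continuous_on_eq_continuous_within)
    then have "(B \<longlongrightarrow> B v) (at_right v)" using that by (simp add: continuous_within at_within_Icc_at_right)
    then show ?thesis unfolding g_def using rc[OF that(1)] Bpos[of v] that s by (intro tendsto_intros) auto
  qed
  define H where "H v = B v powr (-r) - integral {0..v} g" for v
  have "H s = H 0"
  proof (rule constant_of_right_derivative_0[OF s(1)])
    have "continuous_on {0..s} (\<lambda>v. B v powr (-r))"
    proof (rule continuous_on_powr[OF continuous_on_subset[OF Bcont] continuous_on_const])
      show "\<forall>v\<in>{0..s}. B v \<noteq> 0" using Bpos s by (metis atLeastAtMost_iff less_irrefl order_le_less_trans)
    qed (use s in auto)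
    then show "continuous_on {0..s} H" unfolding H_def
      by (intro continuous_on_diff indefinite_integral_continuous_1 gI(2))
    show "(H has_real_derivative 0) (at v within {v..s})" if v: "0 \<le> v" "v < s" for v
    proof -
      have 1: "(B has_real_derivative - e v) (at v within {v..s})"
        by (rule DERIV_subset[OF Bder]) (use v s in auto)
      have 2: "((\<lambda>u. integral {v..u} g) has_real_derivative g v) (at v within {v..s})"
        by (rule right_derivative_integral) (use v ig rcg in auto)
      have 0: "((\<lambda>u. B u powr (-r)) has_real_derivative ((-r) * B v powr (-r-1)) * (- e v)) (at v within {v..s})"
        by (rule DERIV_chain2[OF has_real_derivative_powr 1]) (use Bpos v s in auto)
      have "((\<lambda>u. B u powr (-r) - integral {v..u} g - integral {0..v} g) has_real_derivative
          ((-r) * B v powr (-r-1)) * (- e v) - g v - 0) (at v within {v..s})"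
        by (intro DERIV_diff 0 2 DERIV_const)
      then have 3: "((\<lambda>u. B u powr (-r) - integral {v..u} g - integral {0..v} g) has_real_derivative 0) (at v within {v..s})"
        by (simp add: g_def mult_ac)
      show ?thesis using 3 unfolding has_field_derivative_def
      proof (rule has_derivative_transform[rotated 2])
        show "v \<in> {v..s}" using v by simp
        fix u assume u: "u \<in> {v..s}"
        have "integral {0..u} g = integral {0..v} g + integral {v..u} g"
          using Henstock_Kurzweil_Integration.integral_combine[of 0 v u g] ig[of 0 u] v u by simp
        then show "H u = B u powr (-r) - integral {v..u} g - integral {0..v} g" by (simp add: H_def)
      qed
    qed
  qed
  then have eq: "B s powr (-r) = B 0 powr (-r) + integral {0..s} g" by (simp add: H_def)
  have "(\<integral>\<^sup>+v\<in>{0..s}. ennreal (g v) \<partial>lborel) = (\<integral>\<^sup>+v. ennreal (indicator {0..s} v * g v) \<partial>lborel)"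
    by (intro nn_integral_cong) (auto simp: indicator_def)
  also have "\<dots> = ennreal (\<integral>v. indicator {0..s} v * g v \<partial>lborel)"
    using gI(1) g0 by (intro nn_integral_eq_integral) (auto simp: set_integrable_def indicator_def)
  also have "\<dots> = ennreal (integral {0..s} g)" using gI(3) by simp
  finally have nn: "(\<integral>\<^sup>+v\<in>{0..s}. ennreal (g v) \<partial>lborel) = ennreal (integral {0..s} g)" .
  have "0 \<le> integral {0..s} g" using g0 by (intro Henstock_Kurzweil_Integration.integral_nonneg gI) auto
  then show "ennreal (B s powr (-r)) = ennreal (B 0 powr (-r)) + (\<integral>\<^sup>+v\<in>{0..s}. ennreal (r * B v powr (-r-1) * e v) \<partial>lborel)"
    using nn eq unfolding g_def by (simp flip: ennreal_plus)
qed

section \<open>Negative moments of the functional over a finite horizon\<close>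

context levy_process
begin

text \<open>
  By right-continuity the path is the limit of its values at the next grid point, and the grid is countable.
\<close>

lemma Z_joint: "(\<lambda>p. Z (max 0 (fst p)) (snd p)) \<in> borel_measurable (borel \<Otimes>\<^sub>M M)"
proof (rule borel_measurable_LIMSEQ_real)
  define h where "h n p = nat \<lfloor>real (Suc n) * max 0 (fst p)\<rfloor>" for n and p :: "real \<times> 'a"
  show "(\<lambda>n. Z ((real (h n p) + 1) / real (Suc n)) (snd p)) \<longlonglongrightarrow> Z (max 0 (fst p)) (snd p)"
    if "p \<in> space (borel \<Otimes>\<^sub>M M)" for p
  proof -
    have "(real (h n p) + 1) / real (Suc n) = 0 + next_grid n (max 0 (fst p))" for n
      by (simp add: h_def next_grid_def)
    then show ?thesis
      using cadlag_grid_tendsto[OF cadlag_paths, of "snd p" 0 "max 0 (fst p)"] that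
      by (simp add: space_pair_measure mem_Times_iff)
  qed
  show "(\<lambda>p. Z ((real (h n p) + 1) / real (Suc n)) (snd p)) \<in> borel_measurable (borel \<Otimes>\<^sub>M M)" for n
  proof (rule measurable_compose_countable[where f = "\<lambda>i p. Z ((real i + 1) / real (Suc n)) (snd p)" and g = "h n"])
    show "(\<lambda>p. Z ((real i + 1) / real (Suc n)) (snd p)) \<in> borel_measurable (borel \<Otimes>\<^sub>M M)" for i :: nat
      by (rule measurable_compose[OF measurable_snd measurable_at]) simp
    show "h n \<in> measurable (borel \<Otimes>\<^sub>M M) (count_space UNIV)" unfolding h_def[abs_def] by measurable
  qed
qed

lemma Z_joint'[measurable (raw)]:
  assumes [measurable]: "f \<in> borel_measurable N" "g \<in> measurable N M"
  shows "(\<lambda>x. Z (max 0 (f x)) (g x)) \<in> borel_measurable N"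
proof -
  have "(\<lambda>x. (f x, g x)) \<in> measurable N (borel \<Otimes>\<^sub>M M)" by measurable
  from measurable_compose[OF this Z_joint] show ?thesis by simp
qed

lemma path_measurable: "\<omega> \<in> space M \<Longrightarrow> (\<lambda>w. Z (max 0 w) \<omega>) \<in> borel_measurable borel"
  by (rule Z_joint'[of "\<lambda>w. w" borel "\<lambda>_. \<omega>"]) auto

lemma path_bounded:
  assumes "\<omega> \<in> space M"
  obtains B where "\<And>w. w \<le> T \<Longrightarrow> \<bar>Z (max 0 w) \<omega>\<bar> \<le> B"
proof -
  obtain B where B: "\<forall>s\<in>{0..max 0 T}. \<bar>Z s \<omega>\<bar> \<le> B" using cadlag_bounded[OF cadlag_paths[OF assms]] by blast
  have "\<bar>Z (max 0 w) \<omega>\<bar> \<le> B" if "w \<le> T" for w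
    using B that by (intro B[rule_format]) auto
  then show ?thesis by (rule that)
qed

text \<open>
  The functional over the horizon \<open>T\<close> of the process restarted at time \<open>v\<close>. Clamping the time at 0 makes the
  integrand jointly measurable on the whole line.
\<close>

definition future :: "real \<Rightarrow> real \<Rightarrow> 'a \<Rightarrow> real" where
  "future v T \<omega> = (\<integral>w. indicator {0..T} w * exp (- (Z (max 0 (v + w)) \<omega> - Z (max 0 v) \<omega>)) \<partial>lborel)"

definition riemann :: "nat \<Rightarrow> real \<Rightarrow> real \<Rightarrow> 'a \<Rightarrow> real" where
  "riemann n v T \<omega> = (\<integral>w. indicator {0..T} w * exp (- (Z (max 0 (v + next_grid n w)) \<omega> - Z (max 0 v) \<omega>)) \<partial>lborel)"

lemma measurable_next_grid[measurable]: "next_grid n \<in> borel_measurable borel"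
  unfolding next_grid_def[abs_def] by measurable

lemma future_measurable[measurable]: "future v T \<in> borel_measurable M"
  unfolding future_def[abs_def] by measurable

lemma riemann_measurable[measurable]: "riemann n v T \<in> borel_measurable M"
  unfolding riemann_def[abs_def] by measurable

lemma riemann_tendsto:
  assumes \<omega>: "\<omega> \<in> space M" and v: "0 \<le> v"
  shows "(\<lambda>n. riemann n v T \<omega>) \<longlonglongrightarrow> future v T \<omega>"
proof -
  obtain B where B: "\<And>w. w \<le> v + T + 1 \<Longrightarrow> \<bar>Z (max 0 w) \<omega>\<bar> \<le> B" using path_bounded[OF \<omega>] by blast
  note path_measurable[OF \<omega>, measurable]
  have m: "(\<lambda>w. Z (max 0 (f w)) \<omega>) \<in> borel_measurable borel" if [measurable]: "f \<in> borel_measurable borel" for f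
    by (rule measurable_compose[OF that path_measurable[OF \<omega>]])
  show ?thesis
    unfolding riemann_def future_def
  proof (rule integral_dominated_convergence[where w = "\<lambda>w. indicator {0..T} w * exp (2 * B)"])
    show "(\<lambda>w. indicator {0..T} w * exp (- (Z (max 0 (v + w)) \<omega> - Z (max 0 v) \<omega>))) \<in> borel_measurable lborel"
      using m[of "\<lambda>w. v + w"] by measurable
    show "(\<lambda>w. indicator {0..T} w * exp (- (Z (max 0 (v + next_grid n w)) \<omega> - Z (max 0 v) \<omega>))) \<in> borel_measurable lborel" for n
      using m[of "\<lambda>w. v + next_grid n w"] by measurable
    show "integrable lborel (\<lambda>w. indicat_real {0..T} w * exp (2 * B))" by (intro integrable_mult_left) (auto simp: emeasure_lborel_Icc_eq)
    show "AE w in lborel. (\<lambda>n. indicator {0..T} w * exp (- (Z (max 0 (v + next_grid n w)) \<omega> - Z (max 0 v) \<omega>)))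
        \<longlonglongrightarrow> indicator {0..T} w * exp (- (Z (max 0 (v + w)) \<omega> - Z (max 0 v) \<omega>))"
    proof (rule AE_I2)
      fix w
      show "(\<lambda>n. indicator {0..T} w * exp (- (Z (max 0 (v + next_grid n w)) \<omega> - Z (max 0 v) \<omega>)))
        \<longlonglongrightarrow> indicator {0..T} w * exp (- (Z (max 0 (v + w)) \<omega> - Z (max 0 v) \<omega>))"
      proof (cases "w \<in> {0..T}")
        case True
        have "max 0 (v + next_grid n w) = v + next_grid n w" for n
          using next_grid_gt[of w n] v True by simp
        moreover have "max 0 (v + w) = v + w" using v True by simp
        ultimately show ?thesis using True cadlag_grid_tendsto[OF cadlag_paths[OF \<omega>] v, of w]
          by (auto intro!: tendsto_intros)
      qed simp
    qed
    show "AE w in lborel. norm (indicator {0..T} w * exp (- (Z (max 0 (v + next_grid n w)) \<omega> - Z (max 0 v) \<omega>))) \<le> indicator {0..T} w * exp (2 * B)" for n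
    proof (rule AE_I2)
      fix w
      show "norm (indicator {0..T} w * exp (- (Z (max 0 (v + next_grid n w)) \<omega> - Z (max 0 v) \<omega>))) \<le> indicator {0..T} w * exp (2 * B)"
      proof (cases "w \<in> {0..T}")
        case True
        have "1 / real (Suc n) \<le> 1" by simp
        then have "next_grid n w \<le> T + 1" using next_grid_le[of n w] True by (simp only: atLeastAtMost_iff) linarith
        then show ?thesis using True B[of "v + next_grid n w"] B[of v] by auto
      qed simp
    qed
  qed
qed

text \<open>
  A Riemann sum is a function of finitely many increments after \<open>v\<close>. These are independent of \<open>Z v\<close>, the
  increment from 0 to \<open>v\<close>, and their joint law does not depend on \<open>v\<close>.
\<close>

lemma riemann_markov:
  assumes v: "0 \<le> v"
  shows "indep_var borel (Z v) borel (riemann n v T)"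
    and "distr M borel (riemann n v T) = distr M borel (riemann n 0 T)"
proof -
  define K where "K = nat \<lceil>real (Suc n) * T\<rceil> + 1"
  define c where "c i = measure lborel {w \<in> {0..T}. nat \<lfloor>real (Suc n) * w\<rfloor> = i}" for i
  define \<Phi> where "\<Phi> x = (\<Sum>i<K. c i * exp (- (\<Sum>l\<in>{1..<i + 2}. x l)))" for x :: "nat \<Rightarrow> real"
  define P where "P = PiM {1..<K + 1} (\<lambda>_. borel :: real measure)"
  define \<tau> where "\<tau> v l = (case l of 0 \<Rightarrow> 0 | Suc i \<Rightarrow> v + real i / real (Suc n))" for v and l :: nat
  define X where "X v l \<omega> = Z (\<tau> v (Suc l)) \<omega> - Z (\<tau> v l) \<omega>" for v l \<omega>
  have \<tau>0: "\<tau> v 0 = 0" and \<tau>S: "\<tau> v (Suc i) = v + real i / real (Suc n)" for v i by (auto simp: \<tau>_def)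
  have \<tau>_mono: "\<tau> v i \<le> \<tau> v (Suc i)" if "0 \<le> v" for v i
    using that by (cases i) (auto simp: \<tau>_def divide_right_mono)
  have \<tau>_nn: "0 \<le> \<tau> v i" if "0 \<le> v" for v i using that by (cases i) (auto simp: \<tau>_def)
  have mX[measurable]: "X v l \<in> borel_measurable M" if "0 \<le> v" for v l
    unfolding X_def[abs_def] using \<tau>_nn[OF that] by (intro borel_measurable_diff measurable_at) auto
  have m\<Phi>[measurable]: "\<Phi> \<in> borel_measurable P"
    unfolding \<Phi>_def[abs_def] P_def
    by (intro borel_measurable_sum borel_measurable_times borel_measurable_const measurable_compose[OF _ borel_measurable_exp]
        borel_measurable_uminus measurable_component_singleton) auto
  have R_eq: "riemann n v T \<omega> = \<Phi> (restrict (\<lambda>l. X v l \<omega>) {1..<K + 1})" if \<omega>: "\<omega> \<in> space M" and v: "0 \<le> v" for v \<omega>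
  proof -
    define S where "S i = {w \<in> {0..T}. nat \<lfloor>real (Suc n) * w\<rfloor> = i}" for i
    have S[measurable]: "S i \<in> sets lborel" for i unfolding S_def by measurable
    have Sfin: "emeasure lborel (S i) < \<infinity>" for i
    proof -
      have "emeasure lborel (S i) \<le> emeasure lborel {0..T}" by (rule emeasure_mono) (auto simp: S_def)
      then show ?thesis by (auto simp: emeasure_lborel_Icc_eq intro: order_le_less_trans)
    qed
    define y where "y i = exp (- (Z (v + (real i + 1) / real (Suc n)) \<omega> - Z v \<omega>))" for i :: nat
    have "indicator {0..T} w * exp (- (Z (max 0 (v + next_grid n w)) \<omega> - Z (max 0 v) \<omega>)) = (\<Sum>i<K. indicator (S i) w * y i)" for w
    proof (cases "w \<in> {0..T}")
      case True
      define j where "j = nat \<lfloor>real (Suc n) * w\<rfloor>"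
      have jf: "of_int \<lfloor>real (Suc n) * w\<rfloor> = real j" using True by (simp add: j_def)
      have "real (Suc n) * w \<le> real (Suc n) * T" using True by (intro mult_left_mono) auto
      then have "\<lfloor>real (Suc n) * w\<rfloor> \<le> \<lceil>real (Suc n) * T\<rceil>" by linarith
      then have jK: "j < K" unfolding j_def K_def by (simp add: nat_mono less_Suc_eq_le)
      have Sj: "w \<in> S i \<longleftrightarrow> i = j" for i using True by (auto simp: S_def j_def)
      have "(\<Sum>i<K. indicator (S i) w * y i) = (\<Sum>i<K. if i = j then y j else 0)"
        by (intro sum.cong) (auto simp: Sj indicator_def)
      also have "\<dots> = y j" using jK by simp
      also have "y j = exp (- (Z (max 0 (v + next_grid n w)) \<omega> - Z (max 0 v) \<omega>))"
        unfolding y_def next_grid_def jf using v by (simp add: max_def)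
      finally show ?thesis using True by simp
    qed (auto simp: S_def indicator_def)
    then have "riemann n v T \<omega> = (\<integral>w. (\<Sum>i<K. indicator (S i) w * y i) \<partial>lborel)" unfolding riemann_def by simp
    also have "\<dots> = (\<Sum>i<K. measure lborel (S i) * y i)"
      using S Sfin by (subst Bochner_Integration.integral_sum) (auto intro!: integrable_mult_left)
    also have "\<dots> = \<Phi> (restrict (\<lambda>l. X v l \<omega>) {1..<K + 1})"
      unfolding \<Phi>_def
    proof (intro sum.cong refl)
      fix i assume i: "i \<in> {..<K}"
      have "(\<Sum>l\<in>{1..<i + 2}. restrict (\<lambda>l. X v l \<omega>) {1..<K + 1} l) = (\<Sum>l\<in>{1..<i + 2}. X v l \<omega>)"
        using i by (intro sum.cong) auto
      also have "\<dots> = Z (\<tau> v (i + 2)) \<omega> - Z (\<tau> v 1) \<omega>" unfolding X_def by (rule sum_increments[OF \<omega>]) simp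
      also have "\<dots> = Z (v + (real i + 1) / real (Suc n)) \<omega> - Z v \<omega>" by (simp add: \<tau>_def add.commute)
      finally show "measure lborel (S i) * y i = c i * exp (- (\<Sum>l\<in>{1..<i + 2}. restrict (\<lambda>l. X v l \<omega>) {1..<K + 1} l))"
        by (simp add: y_def c_def S_def)
    qed
    finally show ?thesis .
  qed
  have ind: "indep_vars (\<lambda>_. borel) (X v) {..<K + 1}" if "0 \<le> v" for v
    unfolding X_def[abs_def] by (rule indep_increments) (use \<tau>_mono[OF that] \<tau>_nn[OF that] in auto)
  have "indep_var (PiM {0} (\<lambda>_. borel)) (\<lambda>\<omega>. restrict (\<lambda>l. X v l \<omega>) {0}) P (\<lambda>\<omega>. restrict (\<lambda>l. X v l \<omega>) {1..<K + 1})"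
    unfolding P_def by (rule indep_var_restrict[OF ind[OF v]]) auto
  from indep_var_compose[OF this, of "\<lambda>x. x 0" borel \<Phi> borel]
  have "indep_var borel ((\<lambda>x. x 0) \<circ> (\<lambda>\<omega>. restrict (\<lambda>l. X v l \<omega>) {0})) borel (\<Phi> \<circ> (\<lambda>\<omega>. restrict (\<lambda>l. X v l \<omega>) {1..<K + 1}))"
    by auto
  then have 1: "indep_var borel (X v 0) borel (\<lambda>\<omega>. \<Phi> (restrict (\<lambda>l. X v l \<omega>) {1..<K + 1}))" by (simp add: comp_def)
  have X0: "X v 0 \<omega> = Z v \<omega>" if "\<omega> \<in> space M" for \<omega>
    using start_zero[OF that] by (simp add: X_def \<tau>_def)
  show "indep_var borel (Z v) borel (riemann n v T)"
    using 1 v measurable_at[OF v] unfolding indep_var_distribution_eq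
    by (simp add: X0 R_eq cong: distr_cong)
  have law: "distr M borel (riemann n v T) = distr (PiM {1..<K + 1} (\<lambda>_. distr M borel (Z (1 / real (Suc n))))) borel \<Phi>"
    if v: "0 \<le> v" for v
  proof -
    have i1: "indep_vars (\<lambda>_. borel) (X v) {1..<K + 1}" by (rule indep_vars_subset[OF ind[OF v]]) auto
    have ne: "{1..<K + 1} \<noteq> {}" by (simp add: K_def)
    have "distr M P (\<lambda>\<omega>. \<lambda>l\<in>{1..<K + 1}. X v l \<omega>) = PiM {1..<K + 1} (\<lambda>l. distr M borel (X v l))"
      unfolding P_def using i1 indep_vars_iff_distr_eq_PiM'[OF ne, where M' = "\<lambda>_. borel" and X = "X v"] mX[OF v] by simp
    also have "\<dots> = PiM {1..<K + 1} (\<lambda>_. distr M borel (Z (1 / real (Suc n))))"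
    proof (rule PiM_cong[OF refl])
      fix l assume "l \<in> {1..<K + 1}"
      then obtain i where l: "l = Suc i" by (cases l) auto
      have "X v l = (\<lambda>\<omega>. Z (\<tau> v l + 1 / real (Suc n)) \<omega> - Z (\<tau> v l) \<omega>)"
        unfolding X_def l by (simp add: \<tau>_def add_divide_distrib add_ac)
      then show "distr M borel (X v l) = distr M borel (Z (1 / real (Suc n)))"
        using stationary_increments[of "\<tau> v l" "1 / real (Suc n)"] \<tau>_nn[OF v] by simp
    qed
    finally have eq: "distr M P (\<lambda>\<omega>. \<lambda>l\<in>{1..<K + 1}. X v l \<omega>) = PiM {1..<K + 1} (\<lambda>_. distr M borel (Z (1 / real (Suc n))))" .
    have mr: "(\<lambda>\<omega>. \<lambda>l\<in>{1..<K + 1}. X v l \<omega>) \<in> measurable M P" unfolding P_def using mX[OF v] by (intro measurable_restrict) auto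
    have "distr M borel (riemann n v T) = distr M borel (\<Phi> \<circ> (\<lambda>\<omega>. \<lambda>l\<in>{1..<K + 1}. X v l \<omega>))"
      using R_eq v by (intro distr_cong) (auto simp: comp_def)
    also have "\<dots> = distr (distr M P (\<lambda>\<omega>. \<lambda>l\<in>{1..<K + 1}. X v l \<omega>)) borel \<Phi>" by (rule distr_distr[symmetric, OF m\<Phi> mr])
    finally show ?thesis unfolding eq .
  qed
  show "distr M borel (riemann n v T) = distr M borel (riemann n 0 T)"
    using law[OF v] law[OF order_refl] by simp
qed

lemma future_indep:
  assumes v: "0 \<le> v"
  shows "indep_var borel (Z v) borel (future v T)"
proof (rule indep_var_of_char)
  have [measurable]: "Z v \<in> borel_measurable M" using v by (rule measurable_at)
  show "Z v \<in> borel_measurable M" "future v T \<in> borel_measurable M" by measurable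
  fix a b :: real
  have 1: "(\<lambda>n. \<integral>\<omega>. iexp (a * Z v \<omega>) * iexp (b * riemann n v T \<omega>) \<partial>M) \<longlonglongrightarrow> (\<integral>\<omega>. iexp (a * Z v \<omega>) * iexp (b * future v T \<omega>) \<partial>M)"
    by (rule integral_dominated_convergence[where w = "\<lambda>_. 1"])
       (use v in \<open>auto intro!: AE_I2 tendsto_intros riemann_tendsto simp: norm_mult\<close>)
  have 2: "(\<lambda>n. \<integral>\<omega>. iexp (b * riemann n v T \<omega>) \<partial>M) \<longlonglongrightarrow> (\<integral>\<omega>. iexp (b * future v T \<omega>) \<partial>M)"
    by (rule integral_dominated_convergence[where w = "\<lambda>_. 1"])
       (use v in \<open>auto intro!: AE_I2 tendsto_intros riemann_tendsto simp: norm_mult\<close>)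
  have 3: "(\<integral>\<omega>. iexp (a * Z v \<omega>) * iexp (b * riemann n v T \<omega>) \<partial>M) = (\<integral>\<omega>. iexp (a * Z v \<omega>) \<partial>M) * (\<integral>\<omega>. iexp (b * riemann n v T \<omega>) \<partial>M)" for n
  proof (rule indep_var_lebesgue_integral)
    show "indep_var borel (\<lambda>\<omega>. iexp (a * Z v \<omega>)) borel (\<lambda>\<omega>. iexp (b * riemann n v T \<omega>))"
      using indep_var_compose[OF riemann_markov(1)[OF v, of n T], of "\<lambda>x. iexp (a * x)" borel "\<lambda>x. iexp (b * x)" borel]
      by (simp add: comp_def)
  qed (auto intro!: integrable_const_bound[where B = 1])
  show "(\<integral>\<omega>. iexp (a * Z v \<omega>) * iexp (b * future v T \<omega>) \<partial>M) = (\<integral>\<omega>. iexp (a * Z v \<omega>) \<partial>M) * (\<integral>\<omega>. iexp (b * future v T \<omega>) \<partial>M)"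
    by (rule LIMSEQ_unique[OF 1]) (unfold 3, intro tendsto_mult tendsto_const 2)
qed

lemma future_law:
  assumes v: "0 \<le> v"
  shows "distr M borel (future v T) = distr M borel (future 0 T)"
proof (rule Levy_uniqueness)
  show "char (distr M borel (future v T)) = char (distr M borel (future 0 T))"
  proof
    fix b
    have 2: "(\<lambda>n. \<integral>\<omega>. iexp (b * riemann n v T \<omega>) \<partial>M) \<longlonglongrightarrow> (\<integral>\<omega>. iexp (b * future v T \<omega>) \<partial>M)" if "0 \<le> v" for v
      by (rule integral_dominated_convergence[where w = "\<lambda>_. 1"])
         (use that in \<open>auto intro!: AE_I2 tendsto_intros riemann_tendsto simp: norm_mult\<close>)
    have 3: "(\<integral>\<omega>. iexp (b * riemann n v T \<omega>) \<partial>M) = (\<integral>\<omega>. iexp (b * riemann n 0 T \<omega>) \<partial>M)" for n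
    proof -
      have "(\<integral>\<omega>. iexp (b * riemann n u T \<omega>) \<partial>M) = (\<integral>x. iexp (b * x) \<partial>distr M borel (riemann n u T))" for u
        by (subst integral_distr) auto
      then show ?thesis using riemann_markov(2)[OF v, of n T] by simp
    qed
    have "(\<integral>\<omega>. iexp (b * future v T \<omega>) \<partial>M) = (\<integral>\<omega>. iexp (b * future 0 T \<omega>) \<partial>M)"
      using 2[OF v] 2[OF order_refl] unfolding 3 by (rule LIMSEQ_unique)
    then show "char (distr M borel (future v T)) b = char (distr M borel (future 0 T)) b"
      unfolding char_def by (subst (1 2) integral_distr) auto
  qed
qed auto

lemma future_markov:
  assumes v: "0 \<le> v" and f[measurable]: "f \<in> borel_measurable borel" and g[measurable]: "g \<in> borel_measurable borel"
  shows "(\<integral>\<^sup>+\<omega>. f (Z v \<omega>) * g (future v T \<omega>) \<partial>M) = (\<integral>\<^sup>+\<omega>. f (Z v \<omega>) \<partial>M) * (\<integral>\<^sup>+\<omega>. g (future 0 T \<omega>) \<partial>M)"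
proof -
  have "(\<integral>\<^sup>+\<omega>. g (future u T \<omega>) \<partial>M) = (\<integral>\<^sup>+x. g x \<partial>distr M borel (future u T))" for u
    by (subst nn_integral_distr) auto
  then show ?thesis
    using indep_var_nn_integral_mult[OF future_indep[OF v] f g] future_law[OF v, of T] by simp
qed

definition remaining :: "real \<Rightarrow> real \<Rightarrow> 'a \<Rightarrow> real" where
  "remaining v T \<omega> = (\<integral>w. indicator {v..T} w * exp (- Z (max 0 w) \<omega>) \<partial>lborel)"

lemma remaining_measurable[measurable (raw)]:
  assumes [measurable]: "f \<in> borel_measurable N" "g \<in> measurable N M"
  shows "(\<lambda>x. remaining (f x) T (g x)) \<in> borel_measurable N"
proof -
  have "(\<lambda>x. \<integral>w. of_bool (f x \<le> w \<and> w \<le> T) * exp (- Z (max 0 w) (g x)) \<partial>lborel) \<in> borel_measurable N"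
    by measurable
  then show ?thesis unfolding remaining_def by (simp add: indicator_def)
qed

lemma remaining_eq:
  assumes "0 \<le> v"
  shows "remaining v T \<omega> = exp (- Z v \<omega>) * future v (T - v) \<omega>"
proof -
  have "remaining v T \<omega> = (\<integral>w. indicator {v..T} (v + 1 * w) * exp (- Z (max 0 (v + 1 * w)) \<omega>) \<partial>lborel)"
    unfolding remaining_def by (subst lborel_integral_real_affine[where c = 1 and t = v]) auto
  also have "\<dots> = (\<integral>w. exp (- Z v \<omega>) * (indicator {0..T - v} w * exp (- (Z (max 0 (v + w)) \<omega> - Z (max 0 v) \<omega>))) \<partial>lborel)"
    using assms by (intro Bochner_Integration.integral_cong) (auto simp: indicator_def exp_add[symmetric])
  also have "\<dots> = exp (- Z v \<omega>) * future v (T - v) \<omega>" unfolding future_def by simp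
  finally show ?thesis .
qed

lemma future_0: "\<omega> \<in> space M \<Longrightarrow> future 0 T \<omega> = remaining 0 T \<omega>"
  using remaining_eq[of 0 T \<omega>] start_zero[of \<omega>] by simp

lemma exp_path_regularity:
  assumes \<omega>: "\<omega> \<in> space M"
  defines "e \<equiv> \<lambda>w. exp (- Z (max 0 w) \<omega>)"
  shows "(\<lambda>w. indicator {0..} w * e w) \<in> borel_measurable borel"
    and "\<exists>c>0. \<exists>C. \<forall>w\<in>{0..T}. c \<le> e w \<and> e w \<le> C"
    and "\<And>w. 0 \<le> w \<Longrightarrow> (e \<longlongrightarrow> e w) (at_right w)"
    and "0 \<le> v \<Longrightarrow> remaining v T \<omega> = integral {v..T} e"
    and "0 \<le> v \<Longrightarrow> set_integrable lborel {v..T} e"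
proof -
  note [measurable] = path_measurable[OF \<omega>]
  obtain B where B: "\<And>w. w \<le> T \<Longrightarrow> \<bar>Z (max 0 w) \<omega>\<bar> \<le> B" using path_bounded[OF \<omega>] by blast
  show "(\<lambda>w. indicator {0..} w * e w) \<in> borel_measurable borel" unfolding e_def by measurable
  have b: "exp (- B) \<le> e w" "e w \<le> exp B" if "w \<le> T" for w
    using B[OF that] unfolding e_def by auto
  show "\<exists>c>0. \<exists>C. \<forall>w\<in>{0..T}. c \<le> e w \<and> e w \<le> C"
    using b by (intro exI[of _ "exp (- B)"] conjI exI[of _ "exp B"]) auto
  show "(e \<longlongrightarrow> e w) (at_right w)" if "0 \<le> w" for w
  proof -
    have "((\<lambda>s. Z s \<omega>) \<longlongrightarrow> Z w \<omega>) (at_right w)" using cadlag_paths[OF \<omega>] that by (simp add: cadlag_def)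
    moreover have "\<forall>\<^sub>F s in at_right w. Z s \<omega> = Z (max 0 s) \<omega>"
      using that by (intro eventually_at_rightI[of w "w + 1"]) auto
    ultimately have "((\<lambda>s. Z (max 0 s) \<omega>) \<longlongrightarrow> Z w \<omega>) (at_right w)" by (rule Lim_transform_eventually)
    then show ?thesis unfolding e_def using that by (auto intro!: tendsto_intros simp: max_def)
  qed
  have m: "(\<lambda>x. indicator {v..T} x * e x) \<in> borel_measurable borel" unfolding e_def by measurable
  have b': "\<bar>e x\<bar> \<le> exp B" if "x \<in> {v..T}" for x using b[of x] that by (auto simp: e_def)
  note * = bounded_measurable_integrable_on[OF m b']
  show "remaining v T \<omega> = integral {v..T} e" if "0 \<le> v" unfolding remaining_def using *(3) unfolding e_def by simp
  show "set_integrable lborel {v..T} e" if "0 \<le> v" by (rule *(1))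
qed

lemma remaining_pos:
  assumes \<omega>: "\<omega> \<in> space M" and "0 \<le> v" "v < T"
  shows "0 < remaining v T \<omega>"
proof -
  obtain c C where "0 < c" "\<And>w. w \<in> {0..T} \<Longrightarrow> c \<le> exp (- Z (max 0 w) \<omega>)" "\<And>w. w \<in> {0..T} \<Longrightarrow> exp (- Z (max 0 w) \<omega>) \<le> C"
    using exp_path_regularity(2)[OF \<omega>] by blast
  note P = powr_tail_integral(2)[OF exp_path_regularity(1)[OF \<omega>] this(2,3,1) exp_path_regularity(3)[OF \<omega>], where s = v and r = 1]
  have "0 < integral {v..T} (\<lambda>w. exp (- Z (max 0 w) \<omega>))" by (rule P) (use assms in auto)
  then show ?thesis using assms by (simp add: exp_path_regularity(4)[OF \<omega>])
qed

lemma remaining_powr: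
  assumes \<omega>: "\<omega> \<in> space M" and s: "0 \<le> s" "s < T" and r: "0 < r"
  shows "ennreal (remaining s T \<omega> powr (-r)) = ennreal (remaining 0 T \<omega> powr (-r)) +
     (\<integral>\<^sup>+v\<in>{0..s}. ennreal (r * remaining v T \<omega> powr (-r-1) * exp (- Z (max 0 v) \<omega>)) \<partial>lborel)"
proof -
  obtain c C where "0 < c" "\<And>w. w \<in> {0..T} \<Longrightarrow> c \<le> exp (- Z (max 0 w) \<omega>)" "\<And>w. w \<in> {0..T} \<Longrightarrow> exp (- Z (max 0 w) \<omega>) \<le> C"
    using exp_path_regularity(2)[OF \<omega>] by blast
  from powr_tail_integral(1)[OF exp_path_regularity(1)[OF \<omega>] this(2,3,1) exp_path_regularity(3)[OF \<omega>] s r]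
  have "ennreal (remaining s T \<omega> powr (-r)) = ennreal (remaining 0 T \<omega> powr (-r)) +
     (\<integral>\<^sup>+v\<in>{0..s}. ennreal (r * integral {v..T} (\<lambda>w. exp (- Z (max 0 w) \<omega>)) powr (-r-1) * exp (- Z (max 0 v) \<omega>)) \<partial>lborel)"
    using s by (simp add: exp_path_regularity(4)[OF \<omega>])
  also have "(\<integral>\<^sup>+v\<in>{0..s}. ennreal (r * integral {v..T} (\<lambda>w. exp (- Z (max 0 w) \<omega>)) powr (-r-1) * exp (- Z (max 0 v) \<omega>)) \<partial>lborel)
     = (\<integral>\<^sup>+v\<in>{0..s}. ennreal (r * remaining v T \<omega> powr (-r-1) * exp (- Z (max 0 v) \<omega>)) \<partial>lborel)"
    by (intro nn_integral_cong) (auto simp: exp_path_regularity(4)[OF \<omega>] indicator_def)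
  finally show ?thesis .
qed

definition neg_moment :: "real \<Rightarrow> real \<Rightarrow> ennreal" where
  "neg_moment r T = (\<integral>\<^sup>+\<omega>. ennreal (remaining 0 T \<omega> powr (-r)) \<partial>M)"

text \<open>
  The remaining integral is \<open>exp (- Z v)\<close> times the functional of the process restarted at \<open>v\<close>, and the two
  factors are independent.
\<close>

lemma moment_split:
  assumes v: "0 \<le> v" "v < T" and p: "0 \<le> p"
    and mgf: "(\<integral>\<^sup>+\<omega>. ennreal (exp (q * Z v \<omega>)) \<partial>M) = E"
  shows "(\<integral>\<^sup>+\<omega>. ennreal (exp ((q - p) * Z v \<omega>) * remaining v T \<omega> powr (-p)) \<partial>M) = E * neg_moment p (T - v)"
proof -
  have "(\<integral>\<^sup>+\<omega>. ennreal (exp ((q - p) * Z v \<omega>) * remaining v T \<omega> powr (-p)) \<partial>M)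
     = (\<integral>\<^sup>+\<omega>. ennreal (exp (q * Z v \<omega>)) * ennreal (future v (T - v) \<omega> powr (-p)) \<partial>M)"
  proof (rule nn_integral_cong)
    fix \<omega> assume \<omega>: "\<omega> \<in> space M"
    have "0 < future v (T - v) \<omega>" using remaining_pos[OF \<omega> v] unfolding remaining_eq[OF v(1)] by (simp add: zero_less_mult_iff)
    then have "remaining v T \<omega> powr (-p) = exp (p * Z v \<omega>) * future v (T - v) \<omega> powr (-p)"
      unfolding remaining_eq[OF v(1)] by (subst powr_mult) (auto simp: exp_powr_real mult.commute)
    then have "exp ((q - p) * Z v \<omega>) * remaining v T \<omega> powr (-p) = (exp ((q - p) * Z v \<omega>) * exp (p * Z v \<omega>)) * future v (T - v) \<omega> powr (-p)"
      by (simp add: mult.assoc)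
    also have "exp ((q - p) * Z v \<omega>) * exp (p * Z v \<omega>) = exp (q * Z v \<omega>)" by (simp add: exp_add[symmetric] algebra_simps)
    finally show "ennreal (exp ((q - p) * Z v \<omega>) * remaining v T \<omega> powr (-p)) = ennreal (exp (q * Z v \<omega>)) * ennreal (future v (T - v) \<omega> powr (-p))"
      by (simp add: ennreal_mult)
  qed
  also have "\<dots> = E * (\<integral>\<^sup>+\<omega>. ennreal (future 0 (T - v) \<omega> powr (-p)) \<partial>M)"
    using future_markov[OF v(1), of "\<lambda>x. ennreal (exp (q * x))" "\<lambda>x. ennreal (x powr (-p))" "T - v"] mgf by simp
  also have "(\<integral>\<^sup>+\<omega>. ennreal (future 0 (T - v) \<omega> powr (-p)) \<partial>M) = neg_moment p (T - v)"
    unfolding neg_moment_def by (intro nn_integral_cong) (simp add: future_0)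
  finally show ?thesis .
qed

text \<open>
  This is the expectation of \<open>remaining_powr\<close>, with \<open>moment_split\<close> applied at time \<open>s\<close> on the left and at every
  time \<open>v\<close> under the integral.
\<close>

lemma neg_moment_recursion:
  assumes mgf: "\<And>v. 0 \<le> v \<Longrightarrow> (\<integral>\<^sup>+\<omega>. ennreal (exp (r * Z v \<omega>)) \<partial>M) = ennreal (exp (v * \<kappa>))"
    and s: "0 \<le> s" "s < T" and r: "0 < r"
  shows "ennreal (exp (s * \<kappa>)) * neg_moment r (T - s) = neg_moment r T +
     (\<integral>\<^sup>+v\<in>{0..s}. ennreal (r * exp (v * \<kappa>)) * neg_moment (r + 1) (T - v) \<partial>lborel)"
proof -
  interpret LM: pair_sigma_finite lborel M ..
  have "ennreal (exp (s * \<kappa>)) * neg_moment r (T - s) = (\<integral>\<^sup>+\<omega>. ennreal (remaining s T \<omega> powr (-r)) \<partial>M)"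
    using moment_split[OF s, of r r] mgf[OF s(1)] r by simp
  also have "\<dots> = (\<integral>\<^sup>+\<omega>. ennreal (remaining 0 T \<omega> powr (-r)) +
     (\<integral>\<^sup>+v\<in>{0..s}. ennreal (r * remaining v T \<omega> powr (-r-1) * exp (- Z (max 0 v) \<omega>)) \<partial>lborel) \<partial>M)"
    by (intro nn_integral_cong remaining_powr s r)
  also have "\<dots> = neg_moment r T +
     (\<integral>\<^sup>+\<omega>. (\<integral>\<^sup>+v\<in>{0..s}. ennreal (r * remaining v T \<omega> powr (-r-1) * exp (- Z (max 0 v) \<omega>)) \<partial>lborel) \<partial>M)"
    unfolding neg_moment_def by (intro nn_integral_add) measurable
  also have "(\<integral>\<^sup>+\<omega>. (\<integral>\<^sup>+v\<in>{0..s}. ennreal (r * remaining v T \<omega> powr (-r-1) * exp (- Z (max 0 v) \<omega>)) \<partial>lborel) \<partial>M)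
     = (\<integral>\<^sup>+v. (\<integral>\<^sup>+\<omega>. ennreal (r * remaining v T \<omega> powr (-r-1) * exp (- Z (max 0 v) \<omega>)) * indicator {0..s} v \<partial>M) \<partial>lborel)"
    by (rule LM.Fubini') measurable
  also have "\<dots> = (\<integral>\<^sup>+v\<in>{0..s}. ennreal (r * exp (v * \<kappa>)) * neg_moment (r + 1) (T - v) \<partial>lborel)"
  proof (intro nn_integral_cong)
    fix v :: real
    show "(\<integral>\<^sup>+\<omega>. ennreal (r * remaining v T \<omega> powr (-r-1) * exp (- Z (max 0 v) \<omega>)) * indicator {0..s} v \<partial>M)
       = ennreal (r * exp (v * \<kappa>)) * neg_moment (r + 1) (T - v) * indicator {0..s} v"
    proof (cases "v \<in> {0..s}")
      case True
      then have v: "0 \<le> v" "v < T" using s by auto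
      have "(\<integral>\<^sup>+\<omega>. ennreal (r * remaining v T \<omega> powr (-r-1) * exp (- Z (max 0 v) \<omega>)) \<partial>M)
         = (\<integral>\<^sup>+\<omega>. ennreal r * ennreal (exp ((r - (r + 1)) * Z v \<omega>) * remaining v T \<omega> powr (-(r+1))) \<partial>M)"
        using r v by (intro nn_integral_cong) (simp add: ennreal_mult[symmetric] mult_ac max_def)
      also have "\<dots> = ennreal r * (ennreal (exp (v * \<kappa>)) * neg_moment (r + 1) (T - v))"
      proof (subst nn_integral_cmult)
        have [measurable]: "Z v \<in> borel_measurable M" using v(1) by (rule measurable_at)
        show "(\<lambda>\<omega>. ennreal (exp ((r - (r + 1)) * Z v \<omega>) * remaining v T \<omega> powr (-(r+1)))) \<in> borel_measurable M" by measurable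
      qed (use moment_split[OF v, of "r + 1" r] mgf[OF v(1)] r in simp)
      finally show ?thesis using True r by (simp add: ennreal_mult mult.assoc)
    qed simp
  qed
  finally show ?thesis .
qed

end

section \<open>Moments of the reciprocal exponential functional\<close>

lemma powr_le_1_plus:
  fixes x r :: real
  assumes "0 \<le> x" "0 \<le> r" "r \<le> 1"
  shows "x powr r \<le> 1 + x"
proof (cases "x \<le> 1")
  case True
  then have "x powr r \<le> 1" using assms by (intro powr_le1) auto
  then show ?thesis using assms by simp
next
  case False
  then have "x powr r \<le> x powr 1" using assms by (intro powr_mono) auto
  then show ?thesis using False by simp
qed

text \<open>
  As \<open>0 powr r = 0\<close>, the powers with small exponents converge to the indicator of \<open>X > 0\<close> and not to 1.
\<close>

lemma (in prob_space) small_power_limits: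
  fixes X :: "'a \<Rightarrow> real"
  assumes [measurable]: "X \<in> borel_measurable M" and nn: "\<And>\<omega>. 0 \<le> X \<omega>"
    and fin: "(\<integral>\<^sup>+\<omega>. ennreal (X \<omega>) \<partial>M) < \<infinity>" "(\<integral>\<^sup>+\<omega>. ennreal ((X \<omega>) powr 2) \<partial>M) < \<infinity>"
    and r: "r \<longlonglongrightarrow> 0" "\<And>j :: nat. 0 < r j" "\<And>j. r j \<le> 1"
  shows "(\<lambda>j. \<integral>\<^sup>+\<omega>. ennreal (X \<omega> powr r j) \<partial>M) \<longlonglongrightarrow> emeasure M {\<omega> \<in> space M. 0 < X \<omega>}"
    and "(\<lambda>j. \<integral>\<^sup>+\<omega>. ennreal (X \<omega> powr (r j + 1)) \<partial>M) \<longlonglongrightarrow> (\<integral>\<^sup>+\<omega>. ennreal (X \<omega>) \<partial>M)"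
proof -
  have "(\<lambda>j. \<integral>\<^sup>+\<omega>. ennreal (X \<omega> powr r j) \<partial>M) \<longlonglongrightarrow> (\<integral>\<^sup>+\<omega>. indicator {\<omega> \<in> space M. 0 < X \<omega>} \<omega> \<partial>M)"
  proof (rule nn_integral_dominated_convergence[where w = "\<lambda>\<omega>. 1 + ennreal (X \<omega>)"])
    show "(\<integral>\<^sup>+\<omega>. 1 + ennreal (X \<omega>) \<partial>M) < \<infinity>" using fin by (subst nn_integral_add) (auto simp: emeasure_space_1)
    show "AE \<omega> in M. ennreal (X \<omega> powr r j) \<le> 1 + ennreal (X \<omega>)" for j
      using powr_le_1_plus[OF nn less_imp_le[OF r(2)] r(3)] nn
      by (auto intro!: AE_I2 ennreal_leI simp flip: ennreal_1 ennreal_plus)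
    show "AE \<omega> in M. (\<lambda>j. ennreal (X \<omega> powr r j)) \<longlonglongrightarrow> indicator {\<omega> \<in> space M. 0 < X \<omega>} \<omega>"
    proof (rule AE_I2)
      fix \<omega> assume \<omega>: "\<omega> \<in> space M"
      show "(\<lambda>j. ennreal (X \<omega> powr r j)) \<longlonglongrightarrow> indicator {\<omega> \<in> space M. 0 < X \<omega>} \<omega>"
      proof (cases "0 < X \<omega>")
        case True
        have "(\<lambda>j. X \<omega> powr r j) \<longlonglongrightarrow> X \<omega> powr 0" using True by (intro tendsto_powr tendsto_const r) auto
        then have "(\<lambda>j. ennreal (X \<omega> powr r j)) \<longlonglongrightarrow> ennreal (X \<omega> powr 0)" by (rule tendsto_ennrealI)
        then show ?thesis using True \<omega> by simp
      next
        case False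
        then have "X \<omega> = 0" using nn[of \<omega>] by simp
        then show ?thesis by simp
      qed
    qed
  qed measurable
  then show "(\<lambda>j. \<integral>\<^sup>+\<omega>. ennreal (X \<omega> powr r j) \<partial>M) \<longlonglongrightarrow> emeasure M {\<omega> \<in> space M. 0 < X \<omega>}" by simp
  show "(\<lambda>j. \<integral>\<^sup>+\<omega>. ennreal (X \<omega> powr (r j + 1)) \<partial>M) \<longlonglongrightarrow> (\<integral>\<^sup>+\<omega>. ennreal (X \<omega>) \<partial>M)"
  proof (rule nn_integral_dominated_convergence[where w = "\<lambda>\<omega>. ennreal (X \<omega>) + ennreal (X \<omega> powr 2)"])
    show "(\<integral>\<^sup>+\<omega>. ennreal (X \<omega>) + ennreal (X \<omega> powr 2) \<partial>M) < \<infinity>" using fin by (subst nn_integral_add) auto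
    show "AE \<omega> in M. ennreal (X \<omega> powr (r j + 1)) \<le> ennreal (X \<omega>) + ennreal (X \<omega> powr 2)" for j
    proof (rule AE_I2)
      fix \<omega>
      have "X \<omega> powr (r j + 1) = X \<omega> powr r j * X \<omega>" using nn[of \<omega>] by (simp add: powr_add)
      also have "\<dots> \<le> (1 + X \<omega>) * X \<omega>" using powr_le_1_plus[OF nn less_imp_le[OF r(2)] r(3)] nn[of \<omega>] by (intro mult_right_mono) auto
      also have "\<dots> = X \<omega> + X \<omega> powr 2" using nn[of \<omega>] by (simp add: algebra_simps power2_eq_square)
      finally show "ennreal (X \<omega> powr (r j + 1)) \<le> ennreal (X \<omega>) + ennreal (X \<omega> powr 2)"
        using nn[of \<omega>] by (auto intro!: ennreal_leI simp flip: ennreal_plus)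
    qed
    show "AE \<omega> in M. (\<lambda>j. ennreal (X \<omega> powr (r j + 1))) \<longlonglongrightarrow> ennreal (X \<omega>)"
    proof (rule AE_I2)
      fix \<omega>
      have "(\<lambda>j. X \<omega> powr (r j + 1)) \<longlonglongrightarrow> X \<omega>"
      proof (cases "0 < X \<omega>")
        case True
        have "(\<lambda>j. X \<omega> powr (r j + 1)) \<longlonglongrightarrow> X \<omega> powr (0 + 1)" using True by (intro tendsto_powr tendsto_add tendsto_const r) auto
        then show ?thesis using True by simp
      next
        case False
        then have "X \<omega> = 0" using nn[of \<omega>] by simp
        then show ?thesis by simp
      qed
      then show "(\<lambda>j. ennreal (X \<omega> powr (r j + 1))) \<longlonglongrightarrow> ennreal (X \<omega>)" by (rule tendsto_ennrealI)
    qed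
  qed measurable
qed

locale levy_laplace = levy_process M Z for M :: "'a measure" and Z +
  fixes \<phi> :: "real \<Rightarrow> real"
  assumes laplace: "\<And>u v. 0 < u \<Longrightarrow> 0 \<le> v \<Longrightarrow> (\<integral>\<^sup>+\<omega>. ennreal (exp (u * Z v \<omega>)) \<partial>M) = ennreal (exp (v * (u * \<phi> u)))"
    and \<phi>_pos: "\<And>u. 0 \<le> u \<Longrightarrow> 0 < \<phi> u"
    and \<phi>_lim: "(\<phi> \<longlongrightarrow> \<phi> 0) (at_right 0)"
begin

text \<open>
  The value 0 stands for an infinite functional.
\<close>

definition recip :: "'a \<Rightarrow> real" where "recip \<omega> = enn2real (inverse (exp_functional Z \<omega>))"

lemma nn_remaining:
  assumes \<omega>: "\<omega> \<in> space M"
  shows "ennreal (remaining 0 T \<omega>) = (\<integral>\<^sup>+w\<in>{0..T}. ennreal (exp (- Z (max 0 w) \<omega>)) \<partial>lborel)"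
proof -
  have "(\<integral>\<^sup>+w. ennreal (indicator {0..T} w * exp (- Z (max 0 w) \<omega>)) \<partial>lborel) = ennreal (remaining 0 T \<omega>)"
    unfolding remaining_def
    by (rule nn_integral_eq_integral) (use exp_path_regularity(5)[OF \<omega>, of 0 T] in \<open>auto simp: set_integrable_def\<close>)
  then show ?thesis by (simp add: ennreal_mult ennreal_indicator mult.commute)
qed

lemma remaining_mono: "\<omega> \<in> space M \<Longrightarrow> T \<le> T' \<Longrightarrow> remaining 0 T \<omega> \<le> remaining 0 T' \<omega>"
  unfolding remaining_def
  by (rule integral_mono) (use exp_path_regularity(5)[of \<omega> 0] in \<open>auto simp: set_integrable_def indicator_def\<close>)

lemma neg_moment_antimono:
  assumes "0 < T" "T \<le> T'" "0 \<le> r"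
  shows "neg_moment r T' \<le> neg_moment r T"
  unfolding neg_moment_def
  by (intro nn_integral_mono ennreal_leI powr_mono2') (use assms remaining_mono remaining_pos in auto)

text \<open>
  Cauchy-Schwarz bounds \<open>1 / \<integral> exp (- Z)\<close> by \<open>(\<integral> exp Z) / T\<^sup>2\<close>, whose expectation is finite. It is obtained by
  integrating \<open>2 c \<le> c\<^sup>2 exp Z + exp (- Z)\<close> with \<open>c\<close> the mean of \<open>exp (- Z)\<close> over the horizon.
\<close>

lemma neg_moment_1_finite:
  assumes T: "0 < T"
  shows "neg_moment 1 T < \<infinity>"
proof -
  interpret LM: pair_sigma_finite lborel M ..
  have pw: "ennreal (remaining 0 T \<omega> powr (-1)) \<le> ennreal (1 / T\<^sup>2) * (\<integral>\<^sup>+w\<in>{0..T}. ennreal (exp (Z (max 0 w) \<omega>)) \<partial>lborel)"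
    if \<omega>: "\<omega> \<in> space M" for \<omega>
  proof -
    note [measurable] = path_measurable[OF \<omega>]
    define A where "A = remaining 0 T \<omega>"
    define D where "D = (\<integral>\<^sup>+w\<in>{0..T}. ennreal (exp (Z (max 0 w) \<omega>)) \<partial>lborel)"
    have A: "0 < A" unfolding A_def using remaining_pos[OF \<omega>, of 0 T] T by simp
    define c where "c = A / T"
    have c: "0 < c" using A T by (simp add: c_def)
    have "ennreal A + ennreal A = ennreal (2 * c) * emeasure lborel {0..T}"
      using A T by (simp add: c_def emeasure_lborel_Icc_eq ennreal_mult[symmetric] flip: ennreal_plus)
    also have "\<dots> = (\<integral>\<^sup>+w. ennreal (2 * c) * indicator {0..T} w \<partial>lborel)" by (simp add: nn_integral_cmult_indicator)
    also have "\<dots> \<le> (\<integral>\<^sup>+w. ennreal (c\<^sup>2) * (ennreal (exp (Z (max 0 w) \<omega>)) * indicator {0..T} w)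
        + ennreal (exp (- Z (max 0 w) \<omega>)) * indicator {0..T} w \<partial>lborel)"
    proof (rule nn_integral_mono)
      fix w
      have "0 \<le> (c * exp (Z (max 0 w) \<omega> / 2) - exp (- Z (max 0 w) \<omega> / 2))\<^sup>2" by simp
      also have "\<dots> = c\<^sup>2 * exp (Z (max 0 w) \<omega>) + exp (- Z (max 0 w) \<omega>) - 2 * c"
        by (simp add: power2_diff power_mult_distrib exp_double[symmetric] mult.assoc exp_add[symmetric])
      finally have "2 * c \<le> c\<^sup>2 * exp (Z (max 0 w) \<omega>) + exp (- Z (max 0 w) \<omega>)" by simp
      then show "ennreal (2 * c) * indicator {0..T} w \<le> ennreal (c\<^sup>2) * (ennreal (exp (Z (max 0 w) \<omega>)) * indicator {0..T} w)
        + ennreal (exp (- Z (max 0 w) \<omega>)) * indicator {0..T} w"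
        using c by (auto simp: indicator_def ennreal_mult[symmetric] simp flip: ennreal_plus intro!: ennreal_leI)
    qed
    also have "\<dots> = ennreal (c\<^sup>2) * D + ennreal A"
      unfolding D_def A_def nn_remaining[OF \<omega>] by (subst nn_integral_add) (auto simp: nn_integral_cmult)
    finally have AD: "ennreal A \<le> ennreal (c\<^sup>2) * D" by (simp add: add.commute)
    have "ennreal (A powr (-1)) = ennreal (1 / A\<^sup>2) * ennreal A"
      using A by (simp add: ennreal_mult[symmetric] powr_minus_divide power2_eq_square)
    also have "\<dots> \<le> ennreal (1 / A\<^sup>2) * (ennreal (c\<^sup>2) * D)" by (intro mult_left_mono AD) simp
    also have "\<dots> = ennreal (1 / T\<^sup>2) * D"
      using A T by (simp add: c_def mult.assoc[symmetric] ennreal_mult[symmetric] power_divide)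
    finally show ?thesis unfolding A_def D_def .
  qed
  have "neg_moment 1 T \<le> (\<integral>\<^sup>+\<omega>. ennreal (1 / T\<^sup>2) * (\<integral>\<^sup>+w\<in>{0..T}. ennreal (exp (Z (max 0 w) \<omega>)) \<partial>lborel) \<partial>M)"
    unfolding neg_moment_def by (rule nn_integral_mono) (rule pw)
  also have "\<dots> = ennreal (1 / T\<^sup>2) * (\<integral>\<^sup>+\<omega>. (\<integral>\<^sup>+w\<in>{0..T}. ennreal (exp (Z (max 0 w) \<omega>)) \<partial>lborel) \<partial>M)"
    by (rule nn_integral_cmult) measurable
  finally have le: "neg_moment 1 T \<le> ennreal (1 / T\<^sup>2) * (\<integral>\<^sup>+\<omega>. (\<integral>\<^sup>+w\<in>{0..T}. ennreal (exp (Z (max 0 w) \<omega>)) \<partial>lborel) \<partial>M)" .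
  have "(\<integral>\<^sup>+\<omega>. (\<integral>\<^sup>+w\<in>{0..T}. ennreal (exp (Z (max 0 w) \<omega>)) \<partial>lborel) \<partial>M)
     = (\<integral>\<^sup>+w. (\<integral>\<^sup>+\<omega>. ennreal (exp (Z (max 0 w) \<omega>)) * indicator {0..T} w \<partial>M) \<partial>lborel)"
    by (rule LM.Fubini') measurable
  also have "\<dots> \<le> (\<integral>\<^sup>+w. ennreal (exp (T * \<phi> 1)) * indicator {0..T} w \<partial>lborel)"
  proof (rule nn_integral_mono)
    fix w
    show "(\<integral>\<^sup>+\<omega>. ennreal (exp (Z (max 0 w) \<omega>)) * indicator {0..T} w \<partial>M) \<le> ennreal (exp (T * \<phi> 1)) * indicator {0..T} w"
      using laplace[of 1 "max 0 w"] \<phi>_pos[of 1] by (auto simp: indicator_def max_def intro!: ennreal_leI)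
  qed
  also have "\<dots> < \<infinity>" using T by (simp add: nn_integral_cmult_indicator emeasure_lborel_Icc_eq ennreal_mult_less_top)
  finally have fin: "(\<integral>\<^sup>+\<omega>. (\<integral>\<^sup>+w\<in>{0..T}. ennreal (exp (Z (max 0 w) \<omega>)) \<partial>lborel) \<partial>M) < \<infinity>" .
  show ?thesis by (rule order_le_less_trans[OF le]) (use fin in \<open>simp add: ennreal_mult_less_top\<close>)
qed

text \<open>
  The integral of \<open>r exp (v r \<phi> r)\<close> over \<open>v\<close> from 0 to \<open>s\<close>.
\<close>

definition growth :: "real \<Rightarrow> real \<Rightarrow> real" where
  "growth r s = (exp (s * (r * \<phi> r)) - 1) / \<phi> r"

lemma growth_integral:
  assumes r: "0 < r" and s: "0 \<le> s"
  shows "(\<integral>\<^sup>+v\<in>{0..s}. ennreal (r * exp (v * (r * \<phi> r))) \<partial>lborel) = ennreal (growth r s)"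
proof -
  have p: "0 < \<phi> r" using \<phi>_pos[of r] r by simp
  have "(\<integral>\<^sup>+v. ennreal (r * exp (v * (r * \<phi> r))) * indicator {0..s} v \<partial>lborel) = ennreal (exp (s * (r * \<phi> r)) / \<phi> r - exp (0 * (r * \<phi> r)) / \<phi> r)"
    by (rule nn_integral_FTC_Icc) (use p r s in \<open>auto intro!: derivative_eq_intros simp: field_simps\<close>)
  then show ?thesis by (simp add: growth_def diff_divide_distrib)
qed

text \<open>
  Negative moments decrease with the horizon, so in \<open>neg_moment_recursion\<close> the moment of order \<open>- (r + 1)\<close> can
  be replaced by its value at either end of the interval of integration.
\<close>

lemma neg_moment_bounds:
  assumes r: "0 < r" and s: "0 \<le> s" "s < T"
  shows "neg_moment r T + ennreal (growth r s) * neg_moment (r + 1) T \<le> ennreal (exp (s * (r * \<phi> r))) * neg_moment r (T - s)"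
    and "ennreal (exp (s * (r * \<phi> r))) * neg_moment r (T - s) \<le> neg_moment r T + ennreal (growth r s) * neg_moment (r + 1) (T - s)"
proof -
  have rec: "ennreal (exp (s * (r * \<phi> r))) * neg_moment r (T - s) = neg_moment r T +
     (\<integral>\<^sup>+v\<in>{0..s}. ennreal (r * exp (v * (r * \<phi> r))) * neg_moment (r + 1) (T - v) \<partial>lborel)"
    by (rule neg_moment_recursion) (use laplace r s in auto)
  have c: "ennreal (growth r s) * C = (\<integral>\<^sup>+v\<in>{0..s}. ennreal (r * exp (v * (r * \<phi> r))) * C \<partial>lborel)" for C
    unfolding growth_integral[OF r s(1), symmetric] by (subst nn_integral_multc[symmetric]) (auto simp: mult_ac)
  show "neg_moment r T + ennreal (growth r s) * neg_moment (r + 1) T \<le> ennreal (exp (s * (r * \<phi> r))) * neg_moment r (T - s)"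
    unfolding rec c using r s
    by (intro add_left_mono nn_integral_mono) (auto simp: indicator_def intro!: mult_left_mono neg_moment_antimono)
  show "ennreal (exp (s * (r * \<phi> r))) * neg_moment r (T - s) \<le> neg_moment r T + ennreal (growth r s) * neg_moment (r + 1) (T - s)"
    unfolding rec c using r s
    by (intro add_left_mono nn_integral_mono) (auto simp: indicator_def intro!: mult_left_mono neg_moment_antimono)
qed

lemma growth_pos: "0 < r \<Longrightarrow> 0 < s \<Longrightarrow> 0 < growth r s"
  unfolding growth_def using \<phi>_pos[of r] by simp

text \<open>
  In the first of \<open>neg_moment_bounds\<close> the left side contains the moment of order \<open>- (r + 1)\<close> with a positive
  factor, and the right side is finite.
\<close>

lemma neg_moment_finite_step:
  assumes r: "0 < r" and fin: "\<And>T. 0 < T \<Longrightarrow> neg_moment r T < \<infinity>" and T: "0 < T"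
  shows "neg_moment (r + 1) T < \<infinity>"
proof -
  have "neg_moment r T + ennreal (growth r (T/2)) * neg_moment (r + 1) T \<le> ennreal (exp ((T/2) * (r * \<phi> r))) * neg_moment r (T - T/2)"
    by (rule neg_moment_bounds(1)) (use r T in auto)
  also have "\<dots> < \<infinity>" using fin[of "T/2"] T by (simp add: ennreal_mult_less_top)
  finally have "ennreal (growth r (T/2)) * neg_moment (r + 1) T < \<infinity>"
    by (rule order_le_less_trans[rotated]) simp
  then show ?thesis using growth_pos[OF r, of "T/2"] T by (auto simp: ennreal_mult_less_top)
qed

lemma neg_moment_finite_01:
  assumes r: "0 \<le> r" "r \<le> 1" and T: "0 < T"
  shows "neg_moment r T < \<infinity>"
proof -
  have "neg_moment r T \<le> (\<integral>\<^sup>+\<omega>. 1 + ennreal (remaining 0 T \<omega> powr (-1)) \<partial>M)"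
    unfolding neg_moment_def
  proof (rule nn_integral_mono)
    fix \<omega> assume "\<omega> \<in> space M"
    then have p: "0 < remaining 0 T \<omega>" using remaining_pos[of \<omega> 0 T] T by simp
    then have "remaining 0 T \<omega> powr (-r) \<le> 1 + remaining 0 T \<omega> powr (-1)"
    proof -
      have "(remaining 0 T \<omega> powr (-1)) powr r = remaining 0 T \<omega> powr (-r)" by (simp only: powr_powr) simp
      then show ?thesis using powr_le_1_plus[of "remaining 0 T \<omega> powr (-1)" r] r by (simp only: powr_ge_zero)
    qed
    then show "ennreal (remaining 0 T \<omega> powr (-r)) \<le> 1 + ennreal (remaining 0 T \<omega> powr (-1))"
      by (auto intro!: ennreal_leI simp flip: ennreal_1 ennreal_plus)
  qed
  also have "\<dots> = 1 + neg_moment 1 T" unfolding neg_moment_def by (subst nn_integral_add) (auto simp: emeasure_space_1)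
  also have "\<dots> < \<infinity>" using neg_moment_1_finite[OF T] by simp
  finally show ?thesis .
qed

lemma neg_moment_finite_nat: "0 \<le> r \<Longrightarrow> r \<le> 1 \<Longrightarrow> 0 < r + real n \<Longrightarrow> 0 < T \<Longrightarrow> neg_moment (r + real n) T < \<infinity>"
proof (induction n arbitrary: T)
  case 0 then show ?case using neg_moment_finite_01 by simp
next
  case (Suc n)
  show ?case
  proof (cases "r + real n = 0")
    case True
    then have "r + real (Suc n) = 1" by simp
    then show ?thesis using neg_moment_1_finite[OF Suc.prems(4)] by (simp only:)
  next
    case False
    then have "0 < r + real n" using Suc.prems by linarith
    from neg_moment_finite_step[OF this Suc.IH[OF Suc.prems(1,2) this] Suc.prems(4)]
    show ?thesis by (simp add: add_ac)
  qed
qed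

lemma neg_moment_finite:
  assumes "0 \<le> r" "0 < T"
  shows "neg_moment r T < \<infinity>"
proof (cases "r \<le> 1")
  case True
  then show ?thesis using neg_moment_finite_01 assms by simp
next
  case False
  define n where "n = nat \<lfloor>r\<rfloor>"
  have "real n = of_int \<lfloor>r\<rfloor>" using assms by (simp add: n_def)
  then have "0 \<le> r - real n" "r - real n \<le> 1" by linarith+
  from neg_moment_finite_nat[OF this, of n T] show ?thesis using assms False by simp
qed

lemma remaining_limit:
  assumes \<omega>: "\<omega> \<in> space M"
  shows "(\<lambda>n. ennreal (remaining 0 (real (Suc n)) \<omega>)) \<longlonglongrightarrow> exp_functional Z \<omega>"
proof -
  note [measurable] = path_measurable[OF \<omega>]
  have "(\<lambda>n. \<integral>\<^sup>+w. ennreal (exp (- Z (max 0 w) \<omega>)) * indicator {0..real (Suc n)} w \<partial>lborel)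
      \<longlonglongrightarrow> (\<integral>\<^sup>+w. ennreal (exp (- Z (max 0 w) \<omega>)) * indicator {0..} w \<partial>lborel)"
  proof (rule nn_integral_LIMSEQ)
    show "incseq (\<lambda>n w. ennreal (exp (- Z (max 0 w) \<omega>)) * indicator {0..real (Suc n)} w)"
      by (auto simp: incseq_def le_fun_def indicator_def)
    show "(\<lambda>n. ennreal (exp (- Z (max 0 w) \<omega>)) * indicator {0..real (Suc n)} w) \<longlonglongrightarrow> ennreal (exp (- Z (max 0 w) \<omega>)) * indicator {0..} w" for w
    proof (rule tendsto_eventually)
      obtain N :: nat where N: "w \<le> real N" using real_arch_simple by blast
      show "\<forall>\<^sub>F n in sequentially. ennreal (exp (- Z (max 0 w) \<omega>)) * indicator {0..real (Suc n)} w = ennreal (exp (- Z (max 0 w) \<omega>)) * indicator {0..} w"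
        using eventually_ge_at_top[of N] by eventually_elim (use N in \<open>auto simp: indicator_def\<close>)
    qed
  qed measurable
  also have "(\<integral>\<^sup>+w. ennreal (exp (- Z (max 0 w) \<omega>)) * indicator {0..} w \<partial>lborel) = exp_functional Z \<omega>"
    unfolding exp_functional_def by (intro nn_integral_cong) (auto simp: indicator_def max_def)
  finally show ?thesis by (simp only: nn_remaining[OF \<omega>])
qed

lemma exp_functional_measurable[measurable]: "exp_functional Z \<in> borel_measurable M"
proof -
  have "(\<lambda>\<omega>. \<integral>\<^sup>+w. ennreal (exp (- Z (max 0 w) \<omega>)) * indicator {0..} w \<partial>lborel) \<in> borel_measurable M" by measurable
  also have "(\<lambda>\<omega>. \<integral>\<^sup>+w. ennreal (exp (- Z (max 0 w) \<omega>)) * indicator {0..} w \<partial>lborel) = exp_functional Z"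
    unfolding exp_functional_def by (intro ext nn_integral_cong) (auto simp: indicator_def max_def)
  finally show ?thesis .
qed

lemma recip_measurable[measurable]: "recip \<in> borel_measurable M" unfolding recip_def[abs_def] by measurable

lemma recip_nonneg: "0 \<le> recip \<omega>" by (simp add: recip_def)

lemma exp_functional_pos: "\<omega> \<in> space M \<Longrightarrow> 0 < exp_functional Z \<omega>"
proof -
  assume \<omega>: "\<omega> \<in> space M"
  have "ennreal (remaining 0 (real (Suc 0)) \<omega>) \<le> exp_functional Z \<omega>"
    by (rule LIMSEQ_le_const[OF remaining_limit[OF \<omega>]]) (use remaining_mono[OF \<omega>] in \<open>auto intro!: ennreal_leI exI[of _ 0]\<close>)
  moreover have "0 < ennreal (remaining 0 (real (Suc 0)) \<omega>)" using remaining_pos[OF \<omega>, of 0 1] by simp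
  ultimately show ?thesis by (rule less_le_trans[rotated])
qed

lemma remaining_powr_limit:
  assumes \<omega>: "\<omega> \<in> space M" and r: "0 < r"
  shows "(\<lambda>n. remaining 0 (real (Suc n)) \<omega> powr (-r)) \<longlonglongrightarrow> recip \<omega> powr r"
proof -
  have p: "0 < remaining 0 (real (Suc n)) \<omega>" for n using remaining_pos[OF \<omega>, of 0 "real (Suc n)"] by simp
  show ?thesis
  proof (cases "exp_functional Z \<omega>")
    case top
    then have "(\<lambda>n. ennreal (remaining 0 (real (Suc n)) \<omega>)) \<longlonglongrightarrow> top" using remaining_limit[OF \<omega>] by simp
    then have "filterlim (\<lambda>n. remaining 0 (real (Suc n)) \<omega>) at_top sequentially"
      by (simp only: ennreal_tendsto_top_eq_at_top)
    then have "(\<lambda>n. remaining 0 (real (Suc n)) \<omega> powr (-r)) \<longlonglongrightarrow> 0" using r by (intro tendsto_neg_powr) auto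
    then show ?thesis using top by (simp add: recip_def)
  next
    case (real I)
    have I0: "0 < I" using exp_functional_pos[OF \<omega>] real by simp
    have "(\<lambda>n. remaining 0 (real (Suc n)) \<omega>) \<longlonglongrightarrow> I"
      using remaining_limit[OF \<omega>] p unfolding real(2) by (subst (asm) tendsto_ennreal_iff) (use real less_imp_le[OF p] in \<open>auto intro!: always_eventually simp del: of_nat_Suc\<close>)
    then have "(\<lambda>n. remaining 0 (real (Suc n)) \<omega> powr (-r)) \<longlonglongrightarrow> I powr (-r)" using I0 by (intro tendsto_powr tendsto_const) auto
    moreover have "recip \<omega> = inverse I" unfolding recip_def real(2) using I0 by (simp add: inverse_ennreal)
    then have "recip \<omega> powr r = I powr (-r)" using I0 by (simp add: powr_minus inverse_powr)
    ultimately show ?thesis by simp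
  qed
qed

definition moment :: "real \<Rightarrow> ennreal" where "moment r = (\<integral>\<^sup>+\<omega>. ennreal (recip \<omega> powr r) \<partial>M)"

lemma moment_limit:
  assumes r: "0 < r"
  shows "(\<lambda>n. neg_moment r (real (Suc n))) \<longlonglongrightarrow> moment r"
  unfolding neg_moment_def moment_def
proof (rule nn_integral_dominated_convergence[where w = "\<lambda>\<omega>. ennreal (remaining 0 1 \<omega> powr (-r))"])
  show "(\<integral>\<^sup>+\<omega>. ennreal (remaining 0 1 \<omega> powr (-r)) \<partial>M) < \<infinity>"
    using neg_moment_finite[of r 1] r by (simp add: neg_moment_def)
  show "AE \<omega> in M. ennreal (remaining 0 (real (Suc n)) \<omega> powr (-r)) \<le> ennreal (remaining 0 1 \<omega> powr (-r))" for n
    by (intro AE_I2 ennreal_leI powr_mono2') (use r remaining_mono remaining_pos in auto)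
  show "AE \<omega> in M. (\<lambda>n. ennreal (remaining 0 (real (Suc n)) \<omega> powr (-r))) \<longlonglongrightarrow> ennreal (recip \<omega> powr r)"
    by (intro AE_I2 tendsto_ennrealI remaining_powr_limit r)
qed measurable

lemma moment_finite: "0 < r \<Longrightarrow> moment r < \<infinity>"
proof -
  assume r: "0 < r"
  have "moment r \<le> neg_moment r (real (Suc 0))"
    by (rule LIMSEQ_le_const2[OF moment_limit[OF r]], intro exI[of _ 0] allI impI neg_moment_antimono) (use r in auto)
  also have "\<dots> < \<infinity>" by (rule neg_moment_finite) (use r in auto)
  finally show ?thesis .
qed

text \<open>
  The second of \<open>neg_moment_bounds\<close> with \<open>s = 1\<close>, after the moment of order \<open>- r\<close> at the longer horizon is
  replaced by the larger one at the shorter horizon. It holds at every finite horizon.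
\<close>

lemma neg_moment_lower_bound:
  assumes r: "0 < r"
  shows "ennreal (\<phi> r) * neg_moment r (real (Suc n)) \<le> neg_moment (r + 1) (real (Suc n))"
proof -
  define a where "a = enn2real (neg_moment r (real (Suc n)))"
  define b where "b = enn2real (neg_moment (r + 1) (real (Suc n)))"
  define e where "e = exp (r * \<phi> r)"
  have a: "neg_moment r (real (Suc n)) = ennreal a" "0 \<le> a" using neg_moment_finite[of r "real (Suc n)"] r by (auto simp: a_def)
  have b: "neg_moment (r + 1) (real (Suc n)) = ennreal b" "0 \<le> b" using neg_moment_finite[of "r + 1" "real (Suc n)"] r by (auto simp: b_def)
  have e: "1 < e" unfolding e_def using \<phi>_pos[of r] r by simp
  have g: "0 < growth r 1" using growth_pos[OF r] by simp
  have "ennreal e * neg_moment r (real (Suc n)) \<le> neg_moment r (real (Suc n) + 1) + ennreal (growth r 1) * neg_moment (r + 1) (real (Suc n))"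
    using neg_moment_bounds(2)[OF r, of 1 "real (Suc n) + 1"] by (simp add: e_def)
  also have "\<dots> \<le> neg_moment r (real (Suc n)) + ennreal (growth r 1) * neg_moment (r + 1) (real (Suc n))"
    by (intro add_right_mono neg_moment_antimono) (use r in auto)
  finally have "ennreal (e * a) \<le> ennreal (a + growth r 1 * b)"
    unfolding a b using a b e g by (simp add: ennreal_mult ennreal_plus)
  then have "e * a \<le> a + growth r 1 * b" using a b g by (subst (asm) ennreal_le_iff) auto
  then have "(e - 1) * a \<le> (e - 1) / \<phi> r * b" by (simp add: growth_def e_def algebra_simps)
  then have "(e - 1) * (\<phi> r * a) \<le> (e - 1) * b" using \<phi>_pos[of r] r by (simp add: field_simps)
  then have "\<phi> r * a \<le> b" using e by simp
  then show ?thesis unfolding a b using a \<phi>_pos[of r] r by (simp add: ennreal_mult[symmetric] ennreal_leI)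
qed

text \<open>
  As the horizon grows, the bounds from above and below have the same limit.
\<close>

lemma moment_recursion:
  assumes r: "0 < r"
  shows "moment (r + 1) = ennreal (\<phi> r) * moment r"
proof (rule antisym)
  have "(\<lambda>n. ennreal (\<phi> r) * neg_moment r (real (Suc n))) \<longlonglongrightarrow> ennreal (\<phi> r) * moment r"
    by (intro ennreal_tendsto_cmult moment_limit r) simp
  then show "ennreal (\<phi> r) * moment r \<le> moment (r + 1)"
    by (rule LIMSEQ_le[OF _ moment_limit]) (use r neg_moment_lower_bound in auto)
  define e where "e = exp (r * \<phi> r)"
  have e: "1 < e" unfolding e_def using \<phi>_pos[of r] r by simp
  have g: "0 < growth r 1" using growth_pos[OF r] by simp
  have "(\<lambda>n. neg_moment r (real (Suc (Suc n))) + ennreal (growth r 1) * neg_moment (r + 1) (real (Suc (Suc n)))) \<longlonglongrightarrow> moment r + ennreal (growth r 1) * moment (r + 1)"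
    by (intro tendsto_add ennreal_tendsto_cmult LIMSEQ_Suc[OF moment_limit]) (use r in auto)
  moreover have "(\<lambda>n. ennreal e * neg_moment r (real (Suc n))) \<longlonglongrightarrow> ennreal e * moment r"
    by (intro ennreal_tendsto_cmult moment_limit r) simp
  moreover have "neg_moment r (real (Suc (Suc n))) + ennreal (growth r 1) * neg_moment (r + 1) (real (Suc (Suc n))) \<le> ennreal e * neg_moment r (real (Suc n))" for n
    using neg_moment_bounds(1)[OF r, of 1 "real (Suc (Suc n))"] by (simp add: e_def)
  ultimately have le: "moment r + ennreal (growth r 1) * moment (r + 1) \<le> ennreal e * moment r"
    by (intro LIMSEQ_le) auto
  define a where "a = enn2real (moment r)"
  define b where "b = enn2real (moment (r + 1))"
  have a: "moment r = ennreal a" "0 \<le> a" using moment_finite[of r] r by (auto simp: a_def)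
  have b: "moment (r + 1) = ennreal b" "0 \<le> b" using moment_finite[of "r + 1"] r by (auto simp: b_def)
  have "ennreal (a + growth r 1 * b) \<le> ennreal (e * a)"
    using le unfolding a b using a b e g by (simp add: ennreal_mult ennreal_plus)
  then have "a + growth r 1 * b \<le> e * a" using a b e by (subst (asm) ennreal_le_iff) auto
  then have "(e - 1) / \<phi> r * b \<le> (e - 1) * a" by (simp add: growth_def e_def algebra_simps)
  then have "(e - 1) * b \<le> (e - 1) * (\<phi> r * a)" using \<phi>_pos[of r] r by (simp add: field_simps)
  then have "b \<le> \<phi> r * a" using e by simp
  then show "moment (r + 1) \<le> ennreal (\<phi> r) * moment r"
    unfolding a b using a \<phi>_pos[of r] r by (simp add: ennreal_mult[symmetric] ennreal_leI)
qed

text \<open>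
  Let \<open>r\<close> tend to 0. At a finite horizon the functional is finite and positive, so \<open>neg_moment_lower_bound\<close> becomes
  \<open>\<phi> 0 \<le> neg_moment 1 T\<close>, and hence \<open>\<phi> 0 \<le> moment 1\<close>. At the infinite horizon \<open>moment_recursion\<close> becomes
  \<open>moment 1 = \<phi> 0 * P (0 < recip)\<close>. So this probability is 1.
\<close>

lemma moment_1_and_finiteness:
  shows "moment 1 = ennreal (\<phi> 0)" and "AE \<omega> in M. 0 < recip \<omega>"
proof -
  define r where "r j = 1 / real (Suc j)" for j
  have r: "r \<longlonglongrightarrow> 0" "\<And>j. 0 < r j" "\<And>j. r j \<le> 1"
    using LIMSEQ_inverse_real_of_nat by (auto simp: r_def[abs_def] inverse_eq_divide)
  have "filterlim r (at_right 0) sequentially"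
    by (rule tendsto_imp_filterlim_at_right[OF r(1)]) (use r(2) in auto)
  then have "(\<lambda>j. \<phi> (r j)) \<longlonglongrightarrow> \<phi> 0" by (rule filterlim_compose[OF \<phi>_lim])
  then have \<phi>r: "(\<lambda>j. ennreal (\<phi> (r j))) \<longlonglongrightarrow> ennreal (\<phi> 0)" by (rule tendsto_ennrealI)
  have lb: "ennreal (\<phi> 0) \<le> neg_moment 1 (real (Suc n))" for n
  proof -
    define X where "X \<omega> = remaining 0 (real (Suc n)) \<omega> powr (-1)" for \<omega>
    have [measurable]: "X \<in> borel_measurable M" unfolding X_def[abs_def] by measurable
    have Xp: "X \<omega> powr p = remaining 0 (real (Suc n)) \<omega> powr (-p)" for \<omega> p by (simp only: X_def powr_powr) simp
    have X1: "(\<integral>\<^sup>+\<omega>. ennreal (X \<omega>) \<partial>M) = neg_moment 1 (real (Suc n))" by (simp add: X_def neg_moment_def)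
    have X2: "(\<integral>\<^sup>+\<omega>. ennreal (X \<omega> powr p) \<partial>M) = neg_moment p (real (Suc n))" for p by (simp add: Xp neg_moment_def)
    have "{\<omega> \<in> space M. 0 < X \<omega>} = space M" using remaining_pos[of _ 0 "real (Suc n)"] by (force simp: X_def)
    then have e1: "emeasure M {\<omega> \<in> space M. 0 < X \<omega>} = 1" by (simp add: emeasure_space_1)
    note L = small_power_limits[of X r, OF _ _ _ _ r]
    have f1: "(\<integral>\<^sup>+\<omega>. ennreal (X \<omega>) \<partial>M) < \<infinity>" unfolding X1 by (rule neg_moment_finite) auto
    have f2: "(\<integral>\<^sup>+\<omega>. ennreal (X \<omega> powr 2) \<partial>M) < \<infinity>" unfolding X2 by (rule neg_moment_finite) auto
    have L1: "(\<lambda>j. neg_moment (r j) (real (Suc n))) \<longlonglongrightarrow> 1"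
      using L(1)[OF _ _ f1 f2] unfolding X2 e1 by (simp add: X_def)
    have L2: "(\<lambda>j. neg_moment (r j + 1) (real (Suc n))) \<longlonglongrightarrow> neg_moment 1 (real (Suc n))"
      using L(2)[OF _ _ f1 f2] unfolding X2 X1 by (simp add: X_def)
    have "(\<lambda>j. ennreal (\<phi> (r j)) * neg_moment (r j) (real (Suc n))) \<longlonglongrightarrow> ennreal (\<phi> 0) * 1"
      by (intro tendsto_mult_ennreal \<phi>r L1) auto
    then show ?thesis using LIMSEQ_le[OF _ L2] neg_moment_lower_bound[OF r(2)] by auto
  qed
  have ge: "ennreal (\<phi> 0) \<le> moment 1"
    by (rule LIMSEQ_le_const[OF moment_limit]) (use lb in auto)
  have K1: "(\<integral>\<^sup>+\<omega>. ennreal (recip \<omega>) \<partial>M) = moment 1" by (simp add: moment_def recip_nonneg)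
  have f1: "(\<integral>\<^sup>+\<omega>. ennreal (recip \<omega>) \<partial>M) < \<infinity>" unfolding K1 by (rule moment_finite) simp
  have f2: "(\<integral>\<^sup>+\<omega>. ennreal (recip \<omega> powr 2) \<partial>M) < \<infinity>" using moment_finite[of 2] by (simp add: moment_def)
  note L = small_power_limits[of recip r, OF recip_measurable recip_nonneg f1 f2 r]
  define p where "p = emeasure M {\<omega> \<in> space M. 0 < recip \<omega>}"
  have "(\<lambda>j. ennreal (\<phi> (r j)) * moment (r j)) \<longlonglongrightarrow> ennreal (\<phi> 0) * p"
    using L(1) unfolding p_def moment_def by (intro tendsto_mult_ennreal \<phi>r) auto
  moreover have "(\<lambda>j. ennreal (\<phi> (r j)) * moment (r j)) \<longlonglongrightarrow> moment 1"
    using L(2) unfolding moment_recursion[OF r(2), symmetric] K1 by (simp add: moment_def)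
  ultimately have eq: "moment 1 = ennreal (\<phi> 0) * p" by (metis LIMSEQ_unique)
  have p1: "p \<le> 1" unfolding p_def using emeasure_le_1 by simp
  have \<phi>0: "0 < \<phi> 0" using \<phi>_pos by simp
  have "1 \<le> p"
  proof -
    have "ennreal (1 / \<phi> 0) * ennreal (\<phi> 0) \<le> ennreal (1 / \<phi> 0) * (ennreal (\<phi> 0) * p)"
      using ge unfolding eq by (rule mult_left_mono) simp
    then show ?thesis using \<phi>0 by (simp add: mult.assoc[symmetric] ennreal_mult[symmetric])
  qed
  with p1 have p: "p = 1" by simp
  then show "moment 1 = ennreal (\<phi> 0)" using eq by simp
  have "prob {\<omega> \<in> space M. 0 < recip \<omega>} = 1" using p unfolding p_def by (simp add: emeasure_eq_measure)
  then show "AE \<omega> in M. 0 < recip \<omega>" by (subst (asm) prob_Collect_eq_1) auto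
qed

theorem exp_functional_moments:
  shows "AE \<omega> in M. 0 < recip \<omega>" and "(\<integral>\<^sup>+\<omega>. ennreal (recip \<omega> ^ n) \<partial>M) = ennreal (\<Prod>j<n. \<phi> (real j))"
proof -
  show pos: "AE \<omega> in M. 0 < recip \<omega>" by (rule moment_1_and_finiteness)
  have "moment (real n) = ennreal (\<Prod>j<n. \<phi> (real j))" if "0 < n" for n
    using that
  proof (induction n)
    case (Suc n)
    show ?case
    proof (cases "n = 0")
      case True
      then show ?thesis using moment_1_and_finiteness(1) by simp
    next
      case False
      then have "moment (real n + 1) = ennreal (\<phi> (real n)) * ennreal (\<Prod>j<n. \<phi> (real j))"
        using Suc.IH moment_recursion[of "real n"] by simp
      then show ?thesis using \<phi>_pos by (simp add: add.commute mult.commute ennreal_mult[symmetric] prod_nonneg less_imp_le)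
    qed
  qed simp
  moreover have "(\<integral>\<^sup>+\<omega>. ennreal (recip \<omega> ^ n) \<partial>M) = moment (real n)"
    unfolding moment_def by (intro nn_integral_cong_AE) (use pos in eventually_elim, auto simp: powr_realpow)
  ultimately show "(\<integral>\<^sup>+\<omega>. ennreal (recip \<omega> ^ n) \<partial>M) = ennreal (\<Prod>j<n. \<phi> (real j))"
    by (cases "n = 0") (auto simp: emeasure_space_1)
qed

end

section \<open>Moment determinacy and the Gamma law\<close>

text \<open>
  The Taylor polynomials of the characteristic function depend on the moments alone.
\<close>

lemma char_limit_of_moments:
  fixes X :: "'a \<Rightarrow> real"
  assumes M: "prob_space M" and X[measurable]: "X \<in> borel_measurable M" and nn: "\<And>x. 0 \<le> X x"
    and mom: "\<And>n :: nat. (\<integral>\<^sup>+x. ennreal (X x ^ n) \<partial>M) = ennreal (m n)" "\<And>n. 0 \<le> m n"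
    and growth: "(\<lambda>n. \<bar>\<theta>\<bar> ^ n / fact n * m n) \<longlonglongrightarrow> 0"
  shows "(\<lambda>n. \<Sum>k\<le>n. ((\<i> * of_real \<theta>) ^ k / fact k) * of_real (m k)) \<longlonglongrightarrow> char (distr M borel X) \<theta>"
proof -
  interpret prob_space M by (rule M)
  have i: "integrable M (\<lambda>x. X x ^ n)" for n by (rule integrableI_nonneg) (use nn mom in auto)
  have e: "expectation (\<lambda>x. X x ^ n) = m n" for n
  proof -
    have "ennreal (expectation (\<lambda>x. X x ^ n)) = ennreal (m n)"
      unfolding mom(1)[symmetric] by (rule nn_integral_eq_integral[OF i, symmetric]) (simp add: nn)
    moreover have "0 \<le> expectation (\<lambda>x. X x ^ n)" by (rule integral_nonneg_AE) (simp add: nn)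
    ultimately show ?thesis using mom(2)[of n] by simp
  qed
  have ea: "expectation (\<lambda>x. \<bar>X x\<bar> ^ n) = m n" for n
    unfolding abs_of_nonneg[OF nn] by (rule e)
  have "cmod (char (distr M borel X) \<theta> - (\<Sum>k\<le>n. ((\<i> * of_real \<theta>) ^ k / fact k) * of_real (m k))) \<le> 2 * \<bar>\<theta>\<bar> ^ n / fact n * m n" for n
    using char_approx1'[OF i X refl, where n = n and t = \<theta>] unfolding e ea .
  then have c: "cmod (char (distr M borel X) \<theta> - (\<Sum>k\<le>n. ((\<i> * of_real \<theta>) ^ k / fact k) * of_real (m k))) \<le> 2 * (\<bar>\<theta>\<bar> ^ n / fact n * m n)" for n
    by (simp only: times_divide_eq_right times_divide_eq_left mult.assoc)
  have d: "(\<lambda>n. 2 * (\<bar>\<theta>\<bar> ^ n / fact n * m n)) \<longlonglongrightarrow> 0" using tendsto_mult[OF tendsto_const growth, of 2] by simp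
  have "(\<lambda>n. char (distr M borel X) \<theta> - (\<Sum>k\<le>n. ((\<i> * of_real \<theta>) ^ k / fact k) * of_real (m k))) \<longlonglongrightarrow> 0"
    by (rule Lim_null_comparison[OF _ d]) (intro always_eventually allI c)
  from tendsto_diff[OF tendsto_const this, of "char (distr M borel X) \<theta>"] show ?thesis by simp
qed

text \<open>
  The \<open>n\<close>-th term of the exponential series bounds \<open>b ^ n E (Y ^ n) / fact n\<close> by \<open>E exp (b Y)\<close>; any \<open>b\<close> above \<open>\<bar>\<theta>\<bar>\<close>
  gives geometric decay.
\<close>

lemma moment_growth_of_exponential:
  fixes Y :: "'a \<Rightarrow> real"
  assumes Y[measurable]: "Y \<in> borel_measurable M" and nn: "\<And>x. 0 \<le> Y x"
    and mom: "\<And>n :: nat. (\<integral>\<^sup>+x. ennreal (Y x ^ n) \<partial>M) = ennreal (m n)" "\<And>n. 0 \<le> m n"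
    and expo: "\<And>b :: real. 0 < b \<Longrightarrow> (\<integral>\<^sup>+x. ennreal (exp (b * Y x)) \<partial>M) < \<infinity>"
  shows "(\<lambda>n. \<bar>\<theta>\<bar> ^ n / fact n * m n) \<longlonglongrightarrow> 0"
proof -
  define b where "b = 2 * \<bar>\<theta>\<bar> + 1"
  have b: "0 < b" by (simp add: b_def)
  obtain C where C: "(\<integral>\<^sup>+x. ennreal (exp (b * Y x)) \<partial>M) = ennreal C" "0 \<le> C"
    using expo[OF b] by (cases "\<integral>\<^sup>+x. ennreal (exp (b * Y x)) \<partial>M") auto
  have le: "b ^ n / fact n * m n \<le> C" for n
  proof -
    have "ennreal (b ^ n / fact n * m n) = ennreal (b ^ n / fact n) * (\<integral>\<^sup>+x. ennreal (Y x ^ n) \<partial>M)"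
      unfolding mom(1) using b mom(2) by (subst ennreal_mult) auto
    also have "\<dots> = (\<integral>\<^sup>+x. ennreal (b ^ n / fact n) * ennreal (Y x ^ n) \<partial>M)" by (rule nn_integral_cmult[symmetric]) measurable
    also have "\<dots> \<le> (\<integral>\<^sup>+x. ennreal (exp (b * Y x)) \<partial>M)"
    proof (rule nn_integral_mono)
      fix x
      have "(b * Y x) ^ n /\<^sub>R fact n \<le> (\<Sum>k. (b * Y x) ^ k /\<^sub>R fact k)"
        using sum_le_suminf[OF summable_exp_generic[of "b * Y x"], of "{n}"] b nn[of x] by simp
      then have "b ^ n / fact n * Y x ^ n \<le> exp (b * Y x)"
        by (simp add: exp_def power_mult_distrib field_simps)
      then show "ennreal (b ^ n / fact n) * ennreal (Y x ^ n) \<le> ennreal (exp (b * Y x))"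
        using b nn[of x] by (simp add: ennreal_mult[symmetric] ennreal_leI)
    qed
    also have "\<dots> = ennreal C" by (rule C)
    finally show ?thesis using C by simp
  qed
  show ?thesis
  proof (rule tendsto_sandwich[of "\<lambda>_. 0" _ _ "\<lambda>n. C * (\<bar>\<theta>\<bar> / b) ^ n"])
    show "\<forall>\<^sub>F n in sequentially. \<bar>\<theta>\<bar> ^ n / fact n * m n \<le> C * (\<bar>\<theta>\<bar> / b) ^ n"
    proof (rule always_eventually, rule allI)
      fix n
      have "\<bar>\<theta>\<bar> ^ n / fact n * m n = (b ^ n / fact n * m n) * (\<bar>\<theta>\<bar> / b) ^ n" using b by (simp add: power_divide)
      also have "\<dots> \<le> C * (\<bar>\<theta>\<bar> / b) ^ n" using b by (intro mult_right_mono le) auto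
      finally show "\<bar>\<theta>\<bar> ^ n / fact n * m n \<le> C * (\<bar>\<theta>\<bar> / b) ^ n" .
    qed
    have "(\<lambda>n. (\<bar>\<theta>\<bar> / b) ^ n) \<longlonglongrightarrow> 0" by (rule LIMSEQ_power_zero) (simp add: b_def)
    then show "(\<lambda>n. C * (\<bar>\<theta>\<bar> / b) ^ n) \<longlonglongrightarrow> 0" by (rule tendsto_mult_right_zero)
  qed (use mom in auto)
qed

lemma law_determined_by_moments:
  fixes X :: "'a \<Rightarrow> real" and Y :: "'b \<Rightarrow> real"
  assumes M: "prob_space M" and N: "prob_space N"
    and X[measurable]: "X \<in> borel_measurable M" and Y[measurable]: "Y \<in> borel_measurable N"
    and nn: "\<And>x. 0 \<le> X x" "\<And>y. 0 \<le> Y y"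
    and momX: "\<And>n :: nat. (\<integral>\<^sup>+x. ennreal (X x ^ n) \<partial>M) = ennreal (m n)"
    and momY: "\<And>n :: nat. (\<integral>\<^sup>+x. ennreal (Y x ^ n) \<partial>N) = ennreal (m n)"
    and m: "\<And>n. 0 \<le> m n"
    and expo: "\<And>b :: real. 0 < b \<Longrightarrow> (\<integral>\<^sup>+x. ennreal (exp (b * Y x)) \<partial>N) < \<infinity>"
  shows "distr M borel X = distr N borel Y"
proof (rule Levy_uniqueness)
  show "real_distribution (distr M borel X)" "real_distribution (distr N borel Y)"
    using M N X Y by (auto intro: prob_space.real_distribution_distr)
  show "char (distr M borel X) = char (distr N borel Y)"
  proof
    fix \<theta>
    have g: "(\<lambda>n. \<bar>\<theta>\<bar> ^ n / fact n * m n) \<longlonglongrightarrow> 0"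
      by (rule moment_growth_of_exponential[OF Y nn(2) momY m expo])
    show "char (distr M borel X) \<theta> = char (distr N borel Y) \<theta>"
      using char_limit_of_moments[OF M X nn(1) momX m g] char_limit_of_moments[OF N Y nn(2) momY m g]
      by (rule LIMSEQ_unique)
  qed
qed

lemma nn_integral_Gamma:
  fixes p :: real
  assumes "0 < p"
  shows "(\<integral>\<^sup>+x. ennreal (if 0 < x then x powr (p - 1) * exp (- x) else 0) \<partial>lborel) = ennreal (Gamma p)"
proof -
  have "(\<integral>\<^sup>+x. ennreal (x powr (p - 1) / exp x) * indicator {0..} x \<partial>lborel) = ennreal (Gamma p)"
    by (rule nn_integral_has_integral_lebesgue'[OF _ Gamma_integral_real[OF assms]]) simp
  also have "(\<integral>\<^sup>+x. ennreal (x powr (p - 1) / exp x) * indicator {0..} x \<partial>lborel)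
     = (\<integral>\<^sup>+x. ennreal (if 0 < x then x powr (p - 1) * exp (- x) else 0) \<partial>lborel)"
  proof (rule nn_integral_cong_AE)
    have "AE x in lborel. x \<noteq> (0::real)" by (rule AE_lborel_singleton)
    then show "AE x in lborel. ennreal (x powr (p - 1) / exp x) * indicator {0..} x = ennreal (if 0 < x then x powr (p - 1) * exp (- x) else 0)"
      by eventually_elim (auto simp: indicator_def exp_minus divide_inverse)
  qed
  finally show ?thesis .
qed

lemma gamma_density_measurable[measurable]: "gamma_density t \<in> borel_measurable borel"
  unfolding gamma_density_def[abs_def] by measurable

lemma gamma_moments:
  assumes t: "0 < t" and \<alpha>: "0 < \<alpha>"
    and G: "distributed P lborel G (\<lambda>x. ennreal (gamma_density t x))"
  shows "(\<integral>\<^sup>+x. ennreal ((max 0 (G x) powr \<alpha>) ^ n) \<partial>P) = ennreal (Gamma (t + \<alpha> * real n) / Gamma t)"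
proof -
  have p: "0 < t + \<alpha> * real n" using t \<alpha> by (simp add: add_pos_nonneg)
  have "(\<integral>\<^sup>+x. ennreal ((max 0 (G x) powr \<alpha>) ^ n) \<partial>P) = (\<integral>\<^sup>+x. ennreal (gamma_density t x) * ennreal ((max 0 x powr \<alpha>) ^ n) \<partial>lborel)"
    by (rule distributed_nn_integral[OF G, symmetric]) measurable
  also have "\<dots> = (\<integral>\<^sup>+x. ennreal (1 / Gamma t) * ennreal (if 0 < x then x powr (t + \<alpha> * real n - 1) * exp (- x) else 0) \<partial>lborel)"
  proof (rule nn_integral_cong)
    fix x :: real
    show "ennreal (gamma_density t x) * ennreal ((max 0 x powr \<alpha>) ^ n) = ennreal (1 / Gamma t) * ennreal (if 0 < x then x powr (t + \<alpha> * real n - 1) * exp (- x) else 0)"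
    proof (cases "0 < x")
      case True
      have "(x powr \<alpha>) ^ n = x powr (\<alpha> * real n)" using True by (simp add: powr_realpow[symmetric] powr_powr)
      moreover have "x powr (t + \<alpha> * real n - 1) = x powr (t - 1) * x powr (\<alpha> * real n)" by (simp add: powr_add[symmetric] algebra_simps)
      ultimately show ?thesis using True t
        by (simp add: gamma_density_def max_def ennreal_mult[symmetric] mult_ac)
    qed (simp add: gamma_density_def)
  qed
  also have "\<dots> = ennreal (1 / Gamma t) * ennreal (Gamma (t + \<alpha> * real n))"
    using p by (subst nn_integral_cmult) (auto simp: nn_integral_Gamma)
  also have "\<dots> = ennreal (Gamma (t + \<alpha> * real n) / Gamma t)"
    using t Gamma_real_pos[OF p] by (subst ennreal_mult[symmetric]) auto
  finally show ?thesis .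
qed

lemma powr_le_linear:
  fixes b \<alpha> x :: real
  assumes b: "0 < b" and \<alpha>: "0 < \<alpha>" "\<alpha> < 1" and x: "0 < x"
  shows "b * x powr \<alpha> \<le> b * ((2 * b) powr (1 / (1 - \<alpha>))) powr \<alpha> + x / 2"
proof (cases "x \<le> (2 * b) powr (1 / (1 - \<alpha>))")
  case True
  then have "x powr \<alpha> \<le> ((2 * b) powr (1 / (1 - \<alpha>))) powr \<alpha>" using x \<alpha> by (intro powr_mono2) auto
  then have "b * x powr \<alpha> \<le> b * ((2 * b) powr (1 / (1 - \<alpha>))) powr \<alpha>" using b by simp
  then show ?thesis using x by linarith
next
  case False
  have "2 * b = ((2 * b) powr (1 / (1 - \<alpha>))) powr (1 - \<alpha>)" using b \<alpha> by (simp add: powr_powr)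
  also have "\<dots> \<le> x powr (1 - \<alpha>)" using False \<alpha> by (intro powr_mono2) auto
  finally have "2 * b * x powr \<alpha> \<le> x powr (1 - \<alpha>) * x powr \<alpha>" by (intro mult_right_mono) auto
  also have "\<dots> = x" using x by (simp add: powr_add[symmetric])
  finally have "b * x powr \<alpha> \<le> x / 2" by simp
  moreover have "0 \<le> b * ((2 * b) powr (1 / (1 - \<alpha>))) powr \<alpha>" using b by simp
  ultimately show ?thesis by linarith
qed

text \<open>
  Since \<open>\<alpha> < 1\<close>, the exponent \<open>b x powr \<alpha>\<close> is at most \<open>x / 2\<close> plus a constant, and half of the exponential decay
  of the density remains.
\<close>

lemma gamma_exponential_moments:
  assumes t: "0 < t" and \<alpha>: "0 < \<alpha>" "\<alpha> < 1" and b: "0 < b"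
    and G: "distributed P lborel G (\<lambda>x. ennreal (gamma_density t x))"
  shows "(\<integral>\<^sup>+x. ennreal (exp (b * max 0 (G x) powr \<alpha>)) \<partial>P) < \<infinity>"
proof -
  define C where "C = b * ((2 * b) powr (1 / (1 - \<alpha>))) powr \<alpha>"
  let ?g = "\<lambda>x :: real. ennreal (if 0 < x then x powr (t - 1) * exp (- x / 2) else 0)"
  have "(\<integral>\<^sup>+x. ennreal (exp (b * max 0 (G x) powr \<alpha>)) \<partial>P) = (\<integral>\<^sup>+x. ennreal (gamma_density t x) * ennreal (exp (b * max 0 x powr \<alpha>)) \<partial>lborel)"
    by (rule distributed_nn_integral[OF G, symmetric]) measurable
  also have "\<dots> \<le> (\<integral>\<^sup>+x. ennreal (exp C / Gamma t) * ?g x \<partial>lborel)"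
  proof (rule nn_integral_mono)
    fix x :: real
    show "ennreal (gamma_density t x) * ennreal (exp (b * max 0 x powr \<alpha>)) \<le> ennreal (exp C / Gamma t) * ?g x"
    proof (cases "0 < x")
      case True
      have "exp (- x) * exp (b * x powr \<alpha>) \<le> exp C * exp (- x / 2)"
        using powr_le_linear[OF b \<alpha> True] by (simp add: C_def flip: exp_add)
      then have "x powr (t - 1) / Gamma t * (exp (- x) * exp (b * x powr \<alpha>)) \<le> x powr (t - 1) / Gamma t * (exp C * exp (- x / 2))"
        using t by (intro mult_left_mono) auto
      then show ?thesis using True t
        by (simp add: gamma_density_def max_def ennreal_mult[symmetric] mult_ac ennreal_leI)
    qed (simp add: gamma_density_def)
  qed
  also have "\<dots> = ennreal (exp C / Gamma t) * (\<integral>\<^sup>+x. ?g x \<partial>lborel)" by (rule nn_integral_cmult) measurable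
  also have "(\<integral>\<^sup>+x. ?g x \<partial>lborel) = 2 * (\<integral>\<^sup>+x. ?g (0 + 2 * x) \<partial>lborel)"
    by (subst nn_integral_real_affine[where c = 2 and t = 0]) auto
  also have "(\<integral>\<^sup>+x. ?g (0 + 2 * x) \<partial>lborel) = (\<integral>\<^sup>+x. ennreal (2 powr (t - 1)) * ennreal (if 0 < x then x powr (t - 1) * exp (- x) else 0) \<partial>lborel)"
    by (intro nn_integral_cong) (auto simp: powr_mult ennreal_mult[symmetric] mult_ac)
  also have "\<dots> = ennreal (2 powr (t - 1)) * ennreal (Gamma t)"
    using t by (subst nn_integral_cmult) (auto simp: nn_integral_Gamma)
  also have "ennreal (exp C / Gamma t) * (2 * (ennreal (2 powr (t - 1)) * ennreal (Gamma t))) < \<infinity>"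
    by (simp add: ennreal_mult_less_top)
  finally show ?thesis .
qed

section \<open>The Gamma ratio as a Laplace exponent\<close>

definition ratio :: "real \<Rightarrow> real \<Rightarrow> real \<Rightarrow> real" where
  "ratio t \<alpha> u = Gamma (t + \<alpha> + \<alpha> * u) / Gamma (t + \<alpha> * u)"

text \<open>
  The density of the jump measure in the variable \<open>x = exp (- y / \<alpha>)\<close>. It equals \<open>1 / Gamma (1 - \<alpha>)\<close> times the
  derivative of \<open>x powr (t + \<alpha>) * (1 - x) powr (- \<alpha> - 1)\<close>.
\<close>

definition ratio_density :: "real \<Rightarrow> real \<Rightarrow> real \<Rightarrow> real" where
  "ratio_density t \<alpha> x = x powr (t + \<alpha> - 1) * (1 - x) powr (- \<alpha> - 2) * ((t + \<alpha>) * (1 - x) + (\<alpha> + 1) * x) / Gamma (1 - \<alpha>)"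

lemma boundary_0:
  fixes t \<alpha> \<sigma> :: real
  assumes "0 < t" "0 < \<alpha>" "\<alpha> < 1" "0 < \<sigma>"
  shows "((\<lambda>x. (x powr \<sigma> - 1 - \<sigma> * ln x) * (x powr (t + \<alpha>) * (1 - x) powr (- \<alpha> - 1))
      + \<sigma> / \<alpha> * ((x powr t - x powr (t + \<sigma>)) * (x powr \<alpha> * (1 - x) powr (- \<alpha>)))) \<longlongrightarrow> 0) (at_right 0)"
proof -
  have a: "((\<lambda>x::real. x powr p * ln x) \<longlongrightarrow> 0) (at_right 0)" if "0 < p" for p using that by real_asymp
  have b: "((\<lambda>x::real. x powr p) \<longlongrightarrow> 0) (at_right 0)" if "0 < p" for p using that by real_asymp
  have c: "((\<lambda>x::real. (1 - x) powr p) \<longlongrightarrow> 1) (at_right 0)" for p by real_asymp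
  have "((\<lambda>x. (x powr (\<sigma> + (t + \<alpha>)) - x powr (t + \<alpha>) - \<sigma> * (x powr (t + \<alpha>) * ln x)) * (1 - x) powr (- \<alpha> - 1)
      + \<sigma> / \<alpha> * ((x powr t - x powr (t + \<sigma>)) * (x powr \<alpha> * (1 - x) powr (- \<alpha>)))) \<longlongrightarrow> (0 - 0 - \<sigma> * 0) * 1 + \<sigma> / \<alpha> * ((0 - 0) * (0 * 1))) (at_right 0)"
    by (intro tendsto_intros a b c) (use assms in auto)
  moreover have "(x powr (\<sigma> + (t + \<alpha>)) - x powr (t + \<alpha>) - \<sigma> * (x powr (t + \<alpha>) * ln x)) * (1 - x) powr (- \<alpha> - 1)
     = (x powr \<sigma> - 1 - \<sigma> * ln x) * (x powr (t + \<alpha>) * (1 - x) powr (- \<alpha> - 1))" for x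
    by (simp add: powr_add algebra_simps)
  ultimately show ?thesis by simp
qed

lemma boundary_1:
  fixes t \<alpha> \<sigma> :: real
  assumes "0 < t" "0 < \<alpha>" "\<alpha> < 1" "0 < \<sigma>"
  shows "((\<lambda>x. (x powr \<sigma> - 1 - \<sigma> * ln x) * (x powr (t + \<alpha>) * (1 - x) powr (- \<alpha> - 1))
      + \<sigma> / \<alpha> * ((x powr t - x powr (t + \<sigma>)) * (x powr \<alpha> * (1 - x) powr (- \<alpha>)))) \<longlongrightarrow> 0) (at_left 1)"
proof -
  have a: "((\<lambda>x::real. (x powr \<sigma> - 1 - \<sigma> * ln x) * (1 - x) powr (-2)) \<longlongrightarrow> (\<sigma> - 1) * \<sigma> / 2 + \<sigma> / 2) (at_left 1)"
    using assms by real_asymp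
  have b: "((\<lambda>x::real. (x powr t - x powr (t + \<sigma>)) * (1 - x) powr (-1)) \<longlongrightarrow> \<sigma>) (at_left 1)"
    using assms by real_asymp
  have c: "((\<lambda>x::real. x powr p) \<longlongrightarrow> 1) (at_left 1)" for p by real_asymp
  have d: "((\<lambda>x::real. (1 - x) powr p) \<longlongrightarrow> 0) (at_left 1)" if "0 < p" for p using that by real_asymp
  have "((\<lambda>x. ((x powr \<sigma> - 1 - \<sigma> * ln x) * (1 - x) powr (-2)) * (x powr (t + \<alpha>) * (1 - x) powr (1 - \<alpha>))
      + \<sigma> / \<alpha> * (((x powr t - x powr (t + \<sigma>)) * (1 - x) powr (-1)) * (x powr \<alpha> * (1 - x) powr (1 - \<alpha>)))) \<longlongrightarrow>
      ((\<sigma> - 1) * \<sigma> / 2 + \<sigma> / 2) * (1 * 0) + \<sigma> / \<alpha> * (\<sigma> * (1 * 0))) (at_left 1)"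
    by (intro tendsto_intros a b c d) (use assms in auto)
  moreover have "((x powr \<sigma> - 1 - \<sigma> * ln x) * (1 - x) powr (-2)) * (x powr (t + \<alpha>) * (1 - x) powr (1 - \<alpha>))
      + \<sigma> / \<alpha> * (((x powr t - x powr (t + \<sigma>)) * (1 - x) powr (-1)) * (x powr \<alpha> * (1 - x) powr (1 - \<alpha>)))
     = (x powr \<sigma> - 1 - \<sigma> * ln x) * (x powr (t + \<alpha>) * (1 - x) powr (- \<alpha> - 1))
      + \<sigma> / \<alpha> * ((x powr t - x powr (t + \<sigma>)) * (x powr \<alpha> * (1 - x) powr (- \<alpha>)))" for x
  proof -
    have e1: "(1 - x) powr (- \<alpha> - 1) = (1 - x) powr (-2) * (1 - x) powr (1 - \<alpha>)"
    proof -
      have "- \<alpha> - 1 = - 2 + (1 - \<alpha>)" by simp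
      then show ?thesis by (simp only: powr_add)
    qed
    have e2: "(1 - x) powr (- \<alpha>) = (1 - x) powr (-1) * (1 - x) powr (1 - \<alpha>)"
    proof -
      have "- \<alpha> = - 1 + (1 - \<alpha>)" by simp
      then show ?thesis by (simp only: powr_add)
    qed
    show ?thesis unfolding e1 e2 by (simp add: mult_ac)
  qed
  ultimately show ?thesis by simp
qed

lemma beta_part:
  fixes a b :: real
  assumes a: "0 < a" and b: "0 < b"
  defines "f \<equiv> \<lambda>x. x powr (a - 1) * (1 - x) powr (b - 1)"
  defines "I \<equiv> \<lambda>x. integral {0..x} f"
  shows "\<And>x. 0 < x \<Longrightarrow> x < 1 \<Longrightarrow> (I has_real_derivative f x) (at x)"
    and "(I \<longlongrightarrow> 0) (at_right 0)" and "(I \<longlongrightarrow> Beta a b) (at_left 1)"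
proof -
  have hi: "(f has_integral Beta a b) {0..1}" unfolding f_def by (rule has_integral_Beta_real[OF a b])
  then have i: "f integrable_on {0..1}" by blast
  show "(I has_real_derivative f x) (at x)" if x: "0 < x" "x < 1" for x
  proof -
    have "continuous (at x) f" unfolding f_def using x by (intro continuous_intros) auto
    then have "continuous (at x within {0..1}) f" by (rule continuous_at_imp_continuous_at_within)
    then have "(I has_vector_derivative f x) (at x within {0..1})"
      using integral_has_vector_derivative_continuous_at[OF i, of x "{}"] x unfolding I_def by simp
    then show ?thesis using x by (simp add: at_within_Icc_at has_real_derivative_iff_has_vector_derivative)
  qed
  have c: "continuous_on {0..1} I" unfolding I_def by (rule indefinite_integral_continuous_1[OF i])
  show "(I \<longlongrightarrow> 0) (at_right 0)"
    using c unfolding continuous_on by (auto simp: I_def at_within_Icc_at_right dest!: bspec[of _ _ 0])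
  show "(I \<longlongrightarrow> Beta a b) (at_left 1)"
    using c integral_unique[OF hi] unfolding continuous_on by (auto simp: I_def at_within_Icc_at_left dest!: bspec[of _ _ 1])
qed

text \<open>
  Two integrations by parts, combined in one antiderivative \<open>F\<close>. The first uses that \<open>ratio_density\<close> is a
  derivative, the second that \<open>x powr (\<alpha> - 1) * (1 - x) powr (- \<alpha> - 1)\<close> is the derivative of
  \<open>(x / (1 - x)) powr \<alpha> / \<alpha>\<close>. The boundary terms vanish, and two Beta integrals remain; with \<open>\<sigma> = \<alpha> u\<close> they are
  \<open>Gamma (1 - \<alpha>) / t\<close> times \<open>ratio t \<alpha> 0\<close> and \<open>Gamma (1 - \<alpha>) / (t + \<sigma>)\<close> times \<open>ratio t \<alpha> u\<close>.
\<close>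

lemma ratio_density_integral:
  fixes t \<alpha> u :: real
  assumes t: "0 < t" and \<alpha>: "0 < \<alpha>" "\<alpha> < 1" and u: "0 < u"
  shows "(\<integral>\<^sup>+x\<in>{0<..<1}. ennreal ((x powr (\<alpha> * u) - 1 - (\<alpha> * u) * ln x) * ratio_density t \<alpha> x) \<partial>lborel)
    = ennreal (u * (ratio t \<alpha> u - ratio t \<alpha> 0))"
    and "0 \<le> u * (ratio t \<alpha> u - ratio t \<alpha> 0)"
proof -
  define \<sigma> where "\<sigma> = \<alpha> * u"
  have \<sigma>: "0 < \<sigma>" using \<alpha> u by (simp add: \<sigma>_def)
  define f1 where "f1 x = x powr ((t + \<alpha>) - 1) * (1 - x) powr ((1 - \<alpha>) - 1)" for x :: real
  define f2 where "f2 x = x powr ((t + \<sigma> + \<alpha>) - 1) * (1 - x) powr ((1 - \<alpha>) - 1)" for x :: real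
  define I1 where "I1 x = integral {0..x} f1" for x
  define I2 where "I2 x = integral {0..x} f2" for x
  have I1: "\<And>x. 0 < x \<Longrightarrow> x < 1 \<Longrightarrow> (I1 has_real_derivative f1 x) (at x)" "(I1 \<longlongrightarrow> 0) (at_right 0)" "(I1 \<longlongrightarrow> Beta (t + \<alpha>) (1 - \<alpha>)) (at_left 1)"
    unfolding I1_def f1_def by (rule beta_part; use t \<alpha> \<sigma> in simp)+
  have I2: "\<And>x. 0 < x \<Longrightarrow> x < 1 \<Longrightarrow> (I2 has_real_derivative f2 x) (at x)" "(I2 \<longlongrightarrow> 0) (at_right 0)" "(I2 \<longlongrightarrow> Beta (t + \<sigma> + \<alpha>) (1 - \<alpha>)) (at_left 1)"
    unfolding I2_def f2_def by (rule beta_part; use t \<alpha> \<sigma> in simp)+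
  \<comment> \<open>The boundary part of both integrations by parts.\<close>
  define W where "W x = (x powr \<sigma> - 1 - \<sigma> * ln x) * (x powr (t + \<alpha>) * (1 - x) powr (- \<alpha> - 1))
      + \<sigma> / \<alpha> * ((x powr t - x powr (t + \<sigma>)) * (x powr \<alpha> * (1 - x) powr (- \<alpha>)))" for x
  define F where "F x = (W x - \<sigma> / \<alpha> * (t * I1 x - (t + \<sigma>) * I2 x)) / Gamma (1 - \<alpha>)" for x
  define h where "h x = (x powr \<sigma> - 1 - \<sigma> * ln x) * ratio_density t \<alpha> x" for x
  have G: "0 < Gamma (1 - \<alpha>)" using \<alpha> by simp
  have dF: "(F has_real_derivative h x) (at x)" if x: "0 < x" "x < 1" for x
  proof -
    define y where "y = 1 - x"
    have y: "0 < y" using x by (simp add: y_def)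
    define A where "A = x powr t"
    define B where "B = x powr \<alpha>"
    define S where "S = x powr \<sigma>"
    define C where "C = y powr (- \<alpha>)"
    have px: "x powr (t + \<alpha>) = A * B" "x powr (t + \<sigma>) = A * S" "x powr (t + \<sigma> + \<alpha>) = A * S * B"
      by (simp_all add: A_def B_def S_def powr_add)
    have py: "y powr (- \<alpha> - 1) = C / y" "y powr (- \<alpha> - 2) = C / y\<^sup>2"
      using y by (simp_all add: C_def powr_diff power2_eq_square powr_numeral)
    have pm: "x powr (p - 1) = x powr p / x" for p using x by (simp add: powr_diff)
    have pym: "y powr (p - 1) = y powr p / y" for p using y by (simp add: powr_diff)
    have "(W has_real_derivative
      (\<sigma> * x powr (\<sigma> - 1) - \<sigma> / x) * (x powr (t + \<alpha>) * (1 - x) powr (- \<alpha> - 1))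
      + (x powr \<sigma> - 1 - \<sigma> * ln x) * (((t + \<alpha>) * x powr (t + \<alpha> - 1)) * (1 - x) powr (- \<alpha> - 1) + x powr (t + \<alpha>) * (- ((- \<alpha> - 1) * (1 - x) powr (- \<alpha> - 1 - 1))))
      + \<sigma> / \<alpha> * ((t * x powr (t - 1) - (t + \<sigma>) * x powr (t + \<sigma> - 1)) * (x powr \<alpha> * (1 - x) powr (- \<alpha>))
        + (x powr t - x powr (t + \<sigma>)) * ((\<alpha> * x powr (\<alpha> - 1)) * (1 - x) powr (- \<alpha>) + x powr \<alpha> * (- (- \<alpha> * (1 - x) powr (- \<alpha> - 1)))))) (at x)"
      unfolding W_def[abs_def] using x \<alpha>(1)
      by (auto intro!: derivative_eq_intros) (simp add: algebra_simps add_divide_distrib diff_divide_distrib)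
    then have "(F has_real_derivative
      ((\<sigma> * x powr (\<sigma> - 1) - \<sigma> / x) * (x powr (t + \<alpha>) * (1 - x) powr (- \<alpha> - 1))
      + (x powr \<sigma> - 1 - \<sigma> * ln x) * (((t + \<alpha>) * x powr (t + \<alpha> - 1)) * (1 - x) powr (- \<alpha> - 1) + x powr (t + \<alpha>) * (- ((- \<alpha> - 1) * (1 - x) powr (- \<alpha> - 1 - 1))))
      + \<sigma> / \<alpha> * ((t * x powr (t - 1) - (t + \<sigma>) * x powr (t + \<sigma> - 1)) * (x powr \<alpha> * (1 - x) powr (- \<alpha>))
        + (x powr t - x powr (t + \<sigma>)) * ((\<alpha> * x powr (\<alpha> - 1)) * (1 - x) powr (- \<alpha>) + x powr \<alpha> * (- (- \<alpha> * (1 - x) powr (- \<alpha> - 1)))))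
      - \<sigma> / \<alpha> * (t * f1 x - (t + \<sigma>) * f2 x)) / Gamma (1 - \<alpha>)) (at x)"
      unfolding F_def[abs_def] by (intro DERIV_cdivide DERIV_diff DERIV_cmult I1 I2 x)
    moreover have "((\<sigma> * x powr (\<sigma> - 1) - \<sigma> / x) * (x powr (t + \<alpha>) * (1 - x) powr (- \<alpha> - 1))
      + (x powr \<sigma> - 1 - \<sigma> * ln x) * (((t + \<alpha>) * x powr (t + \<alpha> - 1)) * (1 - x) powr (- \<alpha> - 1) + x powr (t + \<alpha>) * (- ((- \<alpha> - 1) * (1 - x) powr (- \<alpha> - 1 - 1))))
      + \<sigma> / \<alpha> * ((t * x powr (t - 1) - (t + \<sigma>) * x powr (t + \<sigma> - 1)) * (x powr \<alpha> * (1 - x) powr (- \<alpha>))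
        + (x powr t - x powr (t + \<sigma>)) * ((\<alpha> * x powr (\<alpha> - 1)) * (1 - x) powr (- \<alpha>) + x powr \<alpha> * (- (- \<alpha> * (1 - x) powr (- \<alpha> - 1)))))
      - \<sigma> / \<alpha> * (t * f1 x - (t + \<sigma>) * f2 x)) / Gamma (1 - \<alpha>) = h x"
    proof -
      define L where "L = S - 1 - \<sigma> * ln x"
      have xy: "x = 1 - y" by (simp add: y_def)
      have "(\<sigma> * (S / x) - \<sigma> / x) * (A * B * (C / y))
         + L * (((t + \<alpha>) * (A * B / x)) * (C / y) + A * B * (- ((- \<alpha> - 1) * (C / y / y))))
         + \<sigma> / \<alpha> * ((t * (A / x) - (t + \<sigma>) * (A * S / x)) * (B * C)
            + (A - A * S) * ((\<alpha> * (B / x)) * C + B * (- (- \<alpha> * (C / y)))))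
         - \<sigma> / \<alpha> * (t * (A * B / x * C) - (t + \<sigma>) * (A * S * B / x * C))
         = L * (A * B / x * (C / y\<^sup>2) * ((t + \<alpha>) * y + (\<alpha> + 1) * x))"
      proof -
        have 1: "(\<sigma> * (S / x) - \<sigma> / x) * (A * B * (C / y)) + \<sigma> / \<alpha> * ((A - A * S) * ((\<alpha> * (B / x)) * C + B * (- (- \<alpha> * (C / y))))) = 0"
          using x y \<alpha>(1) by (simp add: divide_simps) (simp add: xy algebra_simps)
        have 2: "((t + \<alpha>) * (A * B / x)) * (C / y) + A * B * (- ((- \<alpha> - 1) * (C / y / y))) = A * B / x * (C / y\<^sup>2) * ((t + \<alpha>) * y + (\<alpha> + 1) * x)"
          using x y by (simp add: divide_simps power2_eq_square) (simp add: algebra_simps)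
        have 3: "(t * (A / x) - (t + \<sigma>) * (A * S / x)) * (B * C) = t * (A * B / x * C) - (t + \<sigma>) * (A * S * B / x * C)"
          by (simp add: algebra_simps)
        show ?thesis unfolding 2[symmetric] using 1 3 by (simp only: distrib_left)
      qed
      note big = this
      have e: "x powr (\<sigma> - 1) = S / x" "x powr (t + \<alpha> - 1) = A * B / x" "x powr (t - 1) = A / x"
        "x powr (t + \<sigma> - 1) = A * S / x" "x powr (\<alpha> - 1) = B / x" "x powr (t + \<sigma> + \<alpha> - 1) = A * S * B / x"
        unfolding pm px A_def B_def S_def by (rule refl)+
      have e': "y powr (- \<alpha> - 1 - 1) = C / y / y" unfolding pym C_def by (rule refl)
      have "1 - \<alpha> - 1 = - \<alpha>" by simp
      then have f: "f1 x = A * B / x * C" "f2 x = A * S * B / x * C"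
        unfolding f1_def f2_def y_def[symmetric] e C_def by (simp_all only:)
      have g: "h x = L * (A * B / x * (C / y\<^sup>2) * ((t + \<alpha>) * y + (\<alpha> + 1) * x)) / Gamma (1 - \<alpha>)"
        unfolding h_def ratio_density_def y_def[symmetric] e py L_def S_def by (simp only: times_divide_eq_right)
      show ?thesis
        unfolding f g y_def[symmetric] e e' py(1) px A_def[symmetric] B_def[symmetric] C_def[symmetric] S_def[symmetric] L_def[symmetric]
        by (subst big) (rule refl)
    qed
    ultimately show ?thesis by simp
  qed
  have h0: "0 \<le> h x" if x: "0 < x" "x < 1" for x
  proof -
    have "1 + \<sigma> * ln x \<le> exp (\<sigma> * ln x)" by (rule exp_ge_add_one_self)
    also have "exp (\<sigma> * ln x) = x powr \<sigma>" using x by (simp add: powr_def)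
    finally show ?thesis unfolding h_def ratio_density_def using x t \<alpha> G by (intro mult_nonneg_nonneg divide_nonneg_pos add_nonneg_nonneg) auto
  qed
  have hc: "isCont h x" if x: "0 < x" "x < 1" for x
    unfolding h_def ratio_density_def using x G by (intro continuous_intros) auto
  have lim0: "(F \<longlongrightarrow> (0 - \<sigma> / \<alpha> * (t * 0 - (t + \<sigma>) * 0)) / Gamma (1 - \<alpha>)) (at_right 0)"
    unfolding F_def[abs_def] W_def by (intro tendsto_intros I1 I2 boundary_0 t \<alpha> \<sigma>) (use G in auto)
  have lim1: "(F \<longlongrightarrow> (0 - \<sigma> / \<alpha> * (t * Beta (t + \<alpha>) (1 - \<alpha>) - (t + \<sigma>) * Beta (t + \<sigma> + \<alpha>) (1 - \<alpha>))) / Gamma (1 - \<alpha>)) (at_left 1)"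
    unfolding F_def[abs_def] W_def by (intro tendsto_intros I1 I2 boundary_1 t \<alpha> \<sigma>) (use G in auto)
  have beta: "p * Beta (p + \<alpha>) (1 - \<alpha>) = Gamma (p + \<alpha>) * Gamma (1 - \<alpha>) / Gamma p" if "0 < p" for p
  proof -
    have "Gamma (p + 1) = p * Gamma p" using that by (intro Gamma_plus1) auto
    then show ?thesis using that unfolding Beta_def by simp
  qed
  have val: "(0 - \<sigma> / \<alpha> * (t * Beta (t + \<alpha>) (1 - \<alpha>) - (t + \<sigma>) * Beta (t + \<sigma> + \<alpha>) (1 - \<alpha>))) / Gamma (1 - \<alpha>) = u * (ratio t \<alpha> u - ratio t \<alpha> 0)"
  proof -
    have x1: "t * Beta (t + \<alpha>) (1 - \<alpha>) = ratio t \<alpha> 0 * Gamma (1 - \<alpha>)"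
      using beta[of t] t by (simp add: ratio_def)
    have x2: "(t + \<sigma>) * Beta (t + \<sigma> + \<alpha>) (1 - \<alpha>) = ratio t \<alpha> u * Gamma (1 - \<alpha>)"
      using beta[of "t + \<sigma>"] t \<sigma> by (simp add: ratio_def \<sigma>_def add_ac)
    have gen: "(0 - \<sigma> / \<alpha> * (a * g - b * g)) / g = u * (b - a)" if "g \<noteq> 0" for a b g :: real
      using that \<alpha> by (simp add: \<sigma>_def field_simps)
    show ?thesis unfolding x1 x2 by (rule gen) (use G in simp)
  qed
  have fin: "set_integrable lborel (einterval 0 1) h" "(LBINT x=0..1. h x) = u * (ratio t \<alpha> u - ratio t \<alpha> 0)"
  proof -
    have L0: "((F \<circ> real_of_ereal) \<longlongrightarrow> 0) (at_right 0)"
      using lim0 unfolding zero_ereal_def comp_def at_right_ereal filterlim_filtermap by simp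
    have L1: "((F \<circ> real_of_ereal) \<longlongrightarrow> u * (ratio t \<alpha> u - ratio t \<alpha> 0)) (at_left 1)"
      using lim1 unfolding val one_ereal_def comp_def at_left_ereal filterlim_filtermap by simp
    note FTC = interval_integral_FTC_nonneg[of 0 1 F h 0 "u * (ratio t \<alpha> u - ratio t \<alpha> 0)", OF _ _ _ _ L0 L1]
    show "set_integrable lborel (einterval 0 1) h" "(LBINT x=0..1. h x) = u * (ratio t \<alpha> u - ratio t \<alpha> 0)"
      using dF hc h0 FTC by (auto simp: zero_ereal_def one_ereal_def)
  qed
  have e01: "einterval 0 1 = {0<..<1::real}" by (auto simp: einterval_def zero_ereal_def one_ereal_def)
  have "(\<integral>\<^sup>+x\<in>{0<..<1}. ennreal (h x) \<partial>lborel) = (\<integral>\<^sup>+x. ennreal (indicator {0<..<1} x * h x) \<partial>lborel)"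
    by (intro nn_integral_cong) (auto simp: indicator_def)
  also have "\<dots> = ennreal (\<integral>x. indicator {0<..<1} x * h x \<partial>lborel)"
    using fin(1) h0 unfolding e01 by (intro nn_integral_eq_integral) (auto simp: set_integrable_def indicator_def)
  also have eq: "(\<integral>x. indicator {0<..<1} x * h x \<partial>lborel) = u * (ratio t \<alpha> u - ratio t \<alpha> 0)"
    unfolding fin(2)[symmetric] by (simp add: interval_lebesgue_integral_def e01 set_lebesgue_integral_def)
  finally show "(\<integral>\<^sup>+x\<in>{0<..<1}. ennreal ((x powr (\<alpha> * u) - 1 - (\<alpha> * u) * ln x) * ratio_density t \<alpha> x) \<partial>lborel)
    = ennreal (u * (ratio t \<alpha> u - ratio t \<alpha> 0))"
    by (simp only: h_def \<sigma>_def)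
  show "0 \<le> u * (ratio t \<alpha> u - ratio t \<alpha> 0)"
    unfolding eq[symmetric] by (rule integral_nonneg_AE) (use h0 in \<open>auto simp: indicator_def\<close>)
qed

section \<open>Path space and the exponential functional\<close>

lemma (in prob_space) indep_vars_distr:
  assumes f: "f \<in> measurable M N" and X: "\<And>i. i \<in> I \<Longrightarrow> X i \<in> measurable N (M' i)"
    and ind: "indep_vars M' (\<lambda>i \<omega>. X i (f \<omega>)) I"
  shows "prob_space.indep_vars (distr M N f) M' X I"
proof -
  interpret D: prob_space "distr M N f" using f by (rule prob_space_distr)
  show ?thesis
    unfolding D.indep_vars_def2
  proof (intro conjI ballI)
    show "X i \<in> measurable (distr M N f) (M' i)" if "i \<in> I" for i using X[OF that] by simp
    show "D.indep_sets (\<lambda>i. {X i -` A \<inter> space (distr M N f) |A. A \<in> sets (M' i)}) I"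
    proof (rule D.indep_setsI)
      show "{X i -` A \<inter> space (distr M N f) |A. A \<in> sets (M' i)} \<subseteq> D.events" if "i \<in> I" for i
        using X[OF that] by (auto intro: measurable_sets)
      fix A J assume J: "J \<noteq> {}" "J \<subseteq> I" "finite J"
        and A: "\<forall>j\<in>J. A j \<in> {X j -` A \<inter> space (distr M N f) |A. A \<in> sets (M' j)}"
      from A have "\<forall>j\<in>J. \<exists>B. B \<in> sets (M' j) \<and> A j = X j -` B \<inter> space N" by auto
      from bchoice[OF this] obtain B where B: "\<And>j. j \<in> J \<Longrightarrow> B j \<in> sets (M' j)" "\<And>j. j \<in> J \<Longrightarrow> A j = X j -` B j \<inter> space N" by blast
      have pre: "f -` A j \<inter> space M = (\<lambda>\<omega>. X j (f \<omega>)) -` B j \<inter> space M" if "j \<in> J" for j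
        using measurable_space[OF f] B(2)[OF that] by auto
      have Am: "A j \<in> sets N" if "j \<in> J" for j
        unfolding B(2)[OF that] using X B(1)[OF that] J that by (intro measurable_sets) auto
      have "D.prob (\<Inter>(A ` J)) = prob (f -` (\<Inter>(A ` J)) \<inter> space M)"
        using J Am by (intro measure_distr[OF f] sets.finite_INT) auto
      also have "f -` (\<Inter>(A ` J)) \<inter> space M = (\<Inter>j\<in>J. (\<lambda>\<omega>. X j (f \<omega>)) -` B j \<inter> space M)"
      proof -
        have "f -` (\<Inter>(A ` J)) \<inter> space M = (\<Inter>j\<in>J. f -` A j \<inter> space M)" using J by auto
        also have "\<dots> = (\<Inter>j\<in>J. (\<lambda>\<omega>. X j (f \<omega>)) -` B j \<inter> space M)" by (rule INF_cong[OF refl pre])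
        finally show ?thesis .
      qed
      also have "prob \<dots> = (\<Prod>j\<in>J. prob ((\<lambda>\<omega>. X j (f \<omega>)) -` B j \<inter> space M))"
        by (rule indep_varsD[OF ind J(1,3,2) B(1)])
      also have "\<dots> = (\<Prod>j\<in>J. D.prob (A j))"
        by (intro prod.cong refl) (simp add: measure_distr[OF f Am] pre)
      finally show "D.prob (\<Inter>(A ` J)) = (\<Prod>j\<in>J. D.prob (A j))" .
    qed
  qed
qed

text \<open>
  The process is transported to path space. The trace of the product sigma-algebra on the regular paths
  makes the regularity hold for every outcome.
\<close>

lemma canonical_levy_process:
  assumes levy: "levy_process M Z" and down: "\<And>\<omega>. \<omega> \<in> space M \<Longrightarrow> cadlag_down (\<lambda>s. Z s \<omega>)"
    and lap: "\<And>u s. 0 < u \<Longrightarrow> 0 \<le> s \<Longrightarrow> (\<integral>\<^sup>+\<omega>. ennreal (exp (u * Z s \<omega>)) \<partial>M) = ennreal (L u s)"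
  shows "\<exists>(N :: (real \<Rightarrow> real) measure) X. levy_process N X \<and> (\<forall>x\<in>space N. cadlag_down (\<lambda>s. X s x)) \<and>
     (\<forall>u>0. \<forall>s\<ge>0. (\<integral>\<^sup>+x. ennreal (exp (u * X s x)) \<partial>N) = ennreal (L u s))"
proof -
  interpret levy_process M Z by (rule levy)
  define C where "C = {x :: real \<Rightarrow> real. cadlag_down x \<and> x 0 = 0}"
  define P where "P = restrict_space (PiM UNIV (\<lambda>_ :: real. borel :: real measure)) C"
  define path where "path \<omega> = (\<lambda>s. Z (max 0 s) \<omega>)" for \<omega>
  define N where "N = distr M P path"
  define X where "X s x = x s" for s :: real and x :: "real \<Rightarrow> real"
  have cd: "cadlag_down (\<lambda>s. Z (max 0 s) \<omega>)" if "\<omega> \<in> space M" for \<omega>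
    by (rule cadlag_down_local) (use down[OF that] in auto)
  have path: "path \<in> measurable M P"
    unfolding P_def
  proof (rule measurable_restrict_space2)
    show "path \<in> space M \<rightarrow> C" using cd start_zero by (auto simp: C_def path_def)
    show "path \<in> measurable M (PiM UNIV (\<lambda>_. borel))"
      by (rule measurable_PiM_single') (auto simp: path_def intro!: measurable_at)
  qed
  have Xm: "X s \<in> borel_measurable P" for s
    unfolding P_def X_def by (intro measurable_restrict_space1 measurable_component_singleton) simp
  have Xp: "X s (path \<omega>) = Z s \<omega>" if "0 \<le> s" for s \<omega> using that by (simp add: X_def path_def)
  have sp: "space N = C" by (simp add: N_def P_def space_restrict_space space_PiM)
  have "levy_process N X"
  proof (intro levy_process.intro levy_process_axioms.intro)
    show "prob_space N" unfolding N_def using path by (rule prob_space_distr)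
    show "X s \<in> borel_measurable N" for s using Xm by (simp add: N_def)
    show "X 0 x = 0" if "x \<in> space N" for x using that by (simp add: sp C_def X_def)
    show "cadlag (\<lambda>s. X s x)" if "x \<in> space N" for x
      using that cadlag_down_imp_cadlag by (simp add: sp C_def X_def)
    show "prob_space.indep_vars N (\<lambda>_. borel) (\<lambda>i x. X (\<tau> (Suc i)) x - X (\<tau> i) x) {..<n}"
      if \<tau>: "0 \<le> \<tau> 0" "\<And>i. i < n \<Longrightarrow> \<tau> i \<le> \<tau> (Suc i)" for \<tau> :: "nat \<Rightarrow> real" and n
      unfolding N_def
    proof (rule indep_vars_distr[OF path])
      show "(\<lambda>x. X (\<tau> (Suc i)) x - X (\<tau> i) x) \<in> borel_measurable P" for i using Xm by measurable
      have nn: "0 \<le> \<tau> i" if "i \<le> n" for i using that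
        by (induction i) (auto intro: \<tau>(1) order_trans[OF _ \<tau>(2)])
      show "indep_vars (\<lambda>_. borel) (\<lambda>i \<omega>. X (\<tau> (Suc i)) (path \<omega>) - X (\<tau> i) (path \<omega>)) {..<n}"
        by (rule indep_vars_cong[THEN iffD1, OF refl _ refl indep_increments[of \<tau> n, OF \<tau>]]) (use nn in \<open>auto simp: Xp\<close>)
    qed
    show "distr N borel (\<lambda>x. X (s + h) x - X s x) = distr N borel (X h)" if "0 \<le> s" "0 \<le> h" for s h
    proof -
      have "distr N borel (\<lambda>x. X (s + h) x - X s x) = distr M borel (\<lambda>\<omega>. Z (s + h) \<omega> - Z s \<omega>)"
        unfolding N_def using Xm that by (subst distr_distr[OF _ path]) (auto simp: comp_def Xp)
      also have "\<dots> = distr M borel (Z h)" by (rule stationary_increments[OF that])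
      also have "\<dots> = distr N borel (X h)"
        unfolding N_def using Xm that by (subst distr_distr[OF _ path]) (auto simp: comp_def Xp)
      finally show ?thesis .
    qed
  qed
  moreover have "cadlag_down (\<lambda>s. X s x)" if "x \<in> space N" for x using that by (simp add: sp C_def X_def)
  moreover have "(\<integral>\<^sup>+x. ennreal (exp (u * X s x)) \<partial>N) = ennreal (L u s)" if "0 < u" "0 \<le> s" for u s
    unfolding N_def using Xm lap[OF that] that(2) by (subst nn_integral_distr[OF path]) (auto simp: Xp)
  ultimately show ?thesis by blast
qed

lemma ennreal_inverse_inverse: "inverse (inverse x) = (x :: ennreal)"
proof (cases x)
  case (real r)
  then show ?thesis by (cases "r = 0") (auto simp: inverse_ennreal)
qed simp

lemma ratio_pos: "0 < t \<Longrightarrow> 0 < \<alpha> \<Longrightarrow> 0 \<le> u \<Longrightarrow> 0 < ratio t \<alpha> u"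
  unfolding ratio_def by (intro divide_pos_pos Gamma_real_pos add_pos_nonneg add_pos_pos) auto

lemma ratio_limit:
  assumes "0 < t" "0 < \<alpha>"
  shows "(ratio t \<alpha> \<longlongrightarrow> ratio t \<alpha> 0) (at_right 0)"
proof -
  have G: "p \<notin> \<int>\<^sub>\<le>\<^sub>0" if "0 < p" for p :: real using that by (auto elim!: nonpos_Ints_cases)
  have ne: "Gamma t \<noteq> 0" by (metis Gamma_real_pos assms(1) less_irrefl)
  have "isCont (ratio t \<alpha>) 0"
    unfolding ratio_def[abs_def] using assms G[of t] G[of "t + \<alpha>"] ne
    by (intro continuous_intros) auto
  then show ?thesis unfolding isCont_def by (rule tendsto_mono[rotated]) (simp add: at_le)
qed

lemma ratio_prod:
  assumes "0 < t" "0 < \<alpha>"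
  shows "(\<Prod>j<n. ratio t \<alpha> (real j)) = Gamma (t + \<alpha> * real n) / Gamma t"
proof (induction n)
  case 0
  then show ?case using Gamma_real_pos[OF assms(1)] by simp
next
  case (Suc n)
  have "0 < Gamma (t + \<alpha> * real n)" using assms by (intro Gamma_real_pos add_pos_nonneg) auto
  then show ?case using Suc by (simp add: ratio_def algebra_simps)
qed

text \<open>
  The drift is \<open>ratio t \<alpha> 0\<close>, the mean of \<open>Z\<close> at time 1, and the compensated jumps contribute
  \<open>u (ratio t \<alpha> u - ratio t \<alpha> 0)\<close>.
\<close>

lemma ratio_levy_process:
  assumes t: "0 < t" and \<alpha>: "0 < \<alpha>" "\<alpha> < 1"
  shows "\<exists>(M :: (real \<Rightarrow> real) measure) Z. levy_process M Z \<and> (\<forall>\<omega>\<in>space M. cadlag_down (\<lambda>s. Z s \<omega>)) \<and>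
     (\<forall>u>0. \<forall>s\<ge>0. (\<integral>\<^sup>+\<omega>. ennreal (exp (u * Z s \<omega>)) \<partial>M) = ennreal (exp (s * (u * ratio t \<alpha> u))))"
proof -
  define n where "n x = ennreal (ratio_density t \<alpha> x) * indicator {0<..<1} x" for x :: real
  have n[measurable]: "n \<in> borel_measurable borel"
    unfolding n_def[abs_def] ratio_density_def by measurable
  define \<nu> where "\<nu> = distr (density lborel n) borel (\<lambda>x. - \<alpha> * ln x)"
  have rd: "0 \<le> ratio_density t \<alpha> x" if "0 < x" "x < 1" for x
    unfolding ratio_density_def using that t \<alpha> by (intro divide_nonneg_pos mult_nonneg_nonneg add_nonneg_nonneg Gamma_real_pos) auto
  have exponent: "(\<integral>\<^sup>+y. ennreal (exp (- u * y) - 1 + u * y) \<partial>\<nu>) = ennreal (u * (ratio t \<alpha> u - ratio t \<alpha> 0))" if u: "0 < u" for u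
  proof -
    have "(\<integral>\<^sup>+y. ennreal (exp (- u * y) - 1 + u * y) \<partial>\<nu>) = (\<integral>\<^sup>+x. n x * ennreal (exp (- u * (- \<alpha> * ln x)) - 1 + u * (- \<alpha> * ln x)) \<partial>lborel)"
      unfolding \<nu>_def by (subst nn_integral_distr, simp, simp, subst nn_integral_density) auto
    also have "\<dots> = (\<integral>\<^sup>+x\<in>{0<..<1}. ennreal ((x powr (\<alpha> * u) - 1 - (\<alpha> * u) * ln x) * ratio_density t \<alpha> x) \<partial>lborel)"
    proof (rule nn_integral_cong)
      fix x :: real
      show "n x * ennreal (exp (- u * (- \<alpha> * ln x)) - 1 + u * (- \<alpha> * ln x)) = ennreal ((x powr (\<alpha> * u) - 1 - (\<alpha> * u) * ln x) * ratio_density t \<alpha> x) * indicator {0<..<1} x"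
      proof (cases "x \<in> {0<..<1}")
        case True
        have "exp (- u * (- \<alpha> * ln x)) = x powr (\<alpha> * u)" using True by (simp add: powr_def mult_ac)
        then have e: "exp (- u * (- \<alpha> * ln x)) - 1 + u * (- \<alpha> * ln x) = x powr (\<alpha> * u) - 1 - (\<alpha> * u) * ln x" by (simp add: mult_ac)
        show ?thesis unfolding e n_def using True rd[of x] by (simp add: ennreal_mult'[symmetric] mult.commute)
      qed (simp add: n_def)
    qed
    also have "\<dots> = ennreal (u * (ratio t \<alpha> u - ratio t \<alpha> 0))" by (rule ratio_density_integral(1)[OF t \<alpha> u])
    finally show ?thesis .
  qed
  interpret small_jump_measure \<nu> "\<lambda>u. u * (ratio t \<alpha> u - ratio t \<alpha> 0)"
  proof
    show "sets \<nu> = sets borel" by (simp add: \<nu>_def)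
    have "AE x in density lborel n. 0 < - \<alpha> * ln x"
      by (subst AE_density) (auto intro!: AE_I2 simp: n_def indicator_def mult_pos_neg \<alpha> split: if_splits)
    then show "AE y in \<nu>. 0 < y" unfolding \<nu>_def by (subst AE_distr_iff) auto
  qed (use exponent ratio_density_integral(2)[OF t \<alpha>] in auto)
  from levy_existence[of "ratio t \<alpha> 0"] obtain Z where Z: "levy_process \<Omega> Z" "\<And>\<omega>. \<omega> \<in> space \<Omega> \<Longrightarrow> cadlag_down (\<lambda>s. Z s \<omega>)"
    "\<And>u s. 0 < u \<Longrightarrow> 0 \<le> s \<Longrightarrow> (\<integral>\<^sup>+\<omega>. ennreal (exp (u * Z s \<omega>)) \<partial>\<Omega>) = ennreal (exp (s * (u * ratio t \<alpha> 0 + u * (ratio t \<alpha> u - ratio t \<alpha> 0))))"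
    by blast
  from Z(3) have "(\<integral>\<^sup>+\<omega>. ennreal (exp (u * Z s \<omega>)) \<partial>\<Omega>) = ennreal (exp (s * (u * ratio t \<alpha> u)))" if "0 < u" "0 \<le> s" for u s
    using that by (simp add: algebra_simps)
  from canonical_levy_process[OF Z(1,2) this] show ?thesis .
qed

theorem mainTheorem3:
  fixes t \<alpha> :: real and P :: "'b measure" and G :: "'b \<Rightarrow> real"
  assumes "0 < t" and "0 < \<alpha>" and "\<alpha> < 1"
    and "prob_space P"
    and "distributed P lborel G (\<lambda>x. ennreal (gamma_density t x))"
  shows "\<exists>(M :: (real \<Rightarrow> real) measure) (Z :: real \<Rightarrow> (real \<Rightarrow> real) \<Rightarrow> real).
           spectrally_negative_levy M Z \<and>
           distr P borel (\<lambda>\<omega>. ennreal (G \<omega> powr (- \<alpha>))) = distr M borel (exp_functional Z)"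
proof -
  obtain M :: "(real \<Rightarrow> real) measure" and Z where Z: "levy_process M Z" "\<And>\<omega>. \<omega> \<in> space M \<Longrightarrow> cadlag_down (\<lambda>s. Z s \<omega>)"
    "\<And>u s. 0 < u \<Longrightarrow> 0 \<le> s \<Longrightarrow> (\<integral>\<^sup>+\<omega>. ennreal (exp (u * Z s \<omega>)) \<partial>M) = ennreal (exp (s * (u * ratio t \<alpha> u)))"
    using ratio_levy_process[OF assms(1-3)] by blast
  have sn: "spectrally_negative_levy M Z"
    unfolding spectrally_negative_levy_def using Z(1) cadlag_down_imp_jump[OF Z(2)] by (auto intro!: AE_I2)
  interpret levy_laplace M Z "ratio t \<alpha>"
    by (intro levy_laplace.intro Z(1) levy_laplace_axioms.intro Z(3) ratio_pos ratio_limit assms)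
  define Y where "Y \<omega> = max 0 (G \<omega>) powr \<alpha>" for \<omega>
  have [measurable]: "G \<in> borel_measurable P" using distributed_measurable[OF assms(5)] by simp
  have Ym[measurable]: "Y \<in> borel_measurable P" unfolding Y_def[abs_def] by measurable
  have law: "distr M borel recip = distr P borel Y"
  proof (rule law_determined_by_moments[where m = "\<lambda>n. Gamma (t + \<alpha> * real n) / Gamma t"])
    show "(\<integral>\<^sup>+x. ennreal (recip x ^ n) \<partial>M) = ennreal (Gamma (t + \<alpha> * real n) / Gamma t)" for n
      unfolding exp_functional_moments(2) ratio_prod[OF assms(1,2)] ..
    show "(\<integral>\<^sup>+x. ennreal (Y x ^ n) \<partial>P) = ennreal (Gamma (t + \<alpha> * real n) / Gamma t)" for n
      unfolding Y_def by (rule gamma_moments[OF assms(1,2,5)])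
    show "0 \<le> Gamma (t + \<alpha> * real n) / Gamma t" for n
      using assms by (intro divide_nonneg_pos less_imp_le[OF Gamma_real_pos] Gamma_real_pos add_pos_nonneg) auto
    show "(\<integral>\<^sup>+x. ennreal (exp (b * Y x)) \<partial>P) < \<infinity>" if "0 < b" for b
      unfolding Y_def by (rule gamma_exponential_moments[OF assms(1-3) that assms(5)])
  qed (use prob_space_axioms assms recip_nonneg in \<open>auto simp: Y_def\<close>)
  define h where "h x = inverse (ennreal x)" for x
  have [measurable]: "h \<in> borel_measurable borel" unfolding h_def[abs_def] by measurable
  have "distr M borel (exp_functional Z) = distr M borel (\<lambda>\<omega>. h (recip \<omega>))"
  proof (rule distr_cong_AE)
    show "AE \<omega> in M. exp_functional Z \<omega> = h (recip \<omega>)"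
      using exp_functional_moments(1)
    proof eventually_elim
      case (elim \<omega>)
      then have "inverse (exp_functional Z \<omega>) \<noteq> top" by (auto simp: recip_def)
      then have "ennreal (recip \<omega>) = inverse (exp_functional Z \<omega>)" unfolding recip_def less_top by (rule ennreal_enn2real)
      then show ?case by (simp add: h_def ennreal_inverse_inverse)
    qed
  qed auto
  also have "\<dots> = distr (distr M borel recip) borel h" by (subst distr_distr) (auto simp: comp_def)
  also have "\<dots> = distr P borel (\<lambda>\<omega>. h (Y \<omega>))" unfolding law by (subst distr_distr) (auto simp: comp_def)
  also have "\<dots> = distr P borel (\<lambda>\<omega>. ennreal (G \<omega> powr (- \<alpha>)))"
  proof (rule distr_cong_AE)
    have "AE x in lborel. 0 < ennreal (gamma_density t x) \<longrightarrow> 0 < x" by (auto simp: gamma_density_def intro!: AE_I2)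
    then have "AE x in density lborel (\<lambda>x. ennreal (gamma_density t x)). 0 < x" by (subst AE_density) auto
    then have "AE x in distr P lborel G. 0 < x" unfolding distributed_distr_eq_density[OF assms(5)] .
    then have "AE \<omega> in P. 0 < G \<omega>" by (subst (asm) AE_distr_iff) auto
    then show "AE \<omega> in P. h (Y \<omega>) = ennreal (G \<omega> powr (- \<alpha>))"
      by eventually_elim (auto simp: h_def Y_def max_def inverse_ennreal powr_minus)
  qed auto
  finally show ?thesis using sn by metis
qed

end
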